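(* For every chordal graph $G$ on vertex set $[N]$ there is a threshold graph $T$ on vertex set $[N]$, unique up to isomorphism, with $\beta(\mathbf{k}[T])=\beta(\mathbf{k}[G])$.
   Context: $\mathbf{k}$ is a field. For a graph $H$ on vertex set $[N]$, let $A=\mathbf{k}[x_1,\dots,x_N]$, let $I^c(H)\subseteq A$ be the ideal generated by the $x_ix_j$ with $i\neq j$ and $ij$ not an edge of $H$, and $\mathbf{k}[H]=A/I^c(H)$; $\beta(\mathbf{k}[H])$ is the array of graded Betti numbers $\beta_{i,j}(\mathbf{k}[H])=\dim_{\mathbf{k}}\operatorname{Tor}^A_i(\mathbf{k}[H],\mathbf{k})_j$. A graph is chordal if it has no induced cycle of length greater than three. $G_\ast$ is $G$ with a new isolated vertex added and $G^\ast$ is $G$ with a new vertex adjacent to all of $G$ added; a graph is threshold if it can be obtained from a single vertex by a finite sequence of the operations $G\mapsto G_\ast$, $G\mapsto G^\ast$. *)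

theory Defs
  imports Complex_Main "HOL-Library.Poly_Mapping" "HOL-Library.Function_Algebras"
begin

section \<open>Graphs\<close>

definition simple_graph :: "'v set \<Rightarrow> 'v set set \<Rightarrow> bool" where
  "simple_graph V E \<longleftrightarrow> finite V \<and> (\<forall>e\<in>E. e \<subseteq> V \<and> card e = 2)"

definition graph_iso :: "'v set \<Rightarrow> 'v set set \<Rightarrow> 'w set \<Rightarrow> 'w set set \<Rightarrow> bool" where
  "graph_iso V E W F \<longleftrightarrow>
     (\<exists>f. bij_betw f V W \<and> (\<forall>u\<in>V. \<forall>v\<in>V. {u, v} \<in> E \<longleftrightarrow> {f u, f v} \<in> F))"

definition induced_cycle :: "'v set \<Rightarrow> 'v set set \<Rightarrow> 'v list \<Rightarrow> bool" where
  "induced_cycle V E c \<longleftrightarrow> length c \<ge> 3 \<and> distinct c \<and> set c \<subseteq> V \<and>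
     (\<forall>i j. i < j \<longrightarrow> j < length c \<longrightarrow>
        ({c ! i, c ! j} \<in> E \<longleftrightarrow> j = Suc i \<or> (i = 0 \<and> Suc j = length c)))"

definition chordal :: "'v set \<Rightarrow> 'v set set \<Rightarrow> bool" where
  "chordal V E \<longleftrightarrow> \<not> (\<exists>c. induced_cycle V E c \<and> length c > 3)"

text \<open>The vertices carry arbitrary labels, so that threshold graphs on a prescribed vertex set
  can be considered.\<close>

inductive threshold :: "'v set \<Rightarrow> 'v set set \<Rightarrow> bool" where
  single_vertex: "threshold {v} {}"
| add_isolated: "threshold V E \<Longrightarrow> v \<notin> V \<Longrightarrow> threshold (insert v V) E"
| add_dominating: "threshold V E \<Longrightarrow> v \<notin> V \<Longrightarrow>
    threshold (insert v V) (E \<union> {{u, v} | u. u \<in> V})"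


section \<open>The polynomial ring and its ideals\<close>

text \<open>Polynomials in the variables \<open>x\<^sub>i\<close>, \<open>i\<close> a natural number; the ring \<open>A\<close> in \<open>x\<^sub>1, \<dots>, x\<^sub>N\<close> is the
  subring \<open>poly_ring N\<close>. The multiplication of \<^type>\<open>poly_mapping\<close> is convolution.\<close>

type_synonym 'k mpoly = "(nat \<Rightarrow>\<^sub>0 nat) \<Rightarrow>\<^sub>0 'k"

definition poly_ring :: "nat \<Rightarrow> 'k::field mpoly set" where
  "poly_ring N = {p. \<forall>m\<in>Poly_Mapping.keys p. Poly_Mapping.keys m \<subseteq> {1..N}}"

definition var :: "nat \<Rightarrow> 'k::field mpoly" where
  "var i = Poly_Mapping.single (Poly_Mapping.single i 1) 1"

definition const :: "'k::field \<Rightarrow> 'k mpoly" where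
  "const c = Poly_Mapping.single 0 c"

definition mono_degree :: "(nat \<Rightarrow>\<^sub>0 nat) \<Rightarrow> nat" where
  "mono_degree m = (\<Sum>i\<in>Poly_Mapping.keys m. Poly_Mapping.lookup m i)"

text \<open>The zero polynomial is homogeneous of every degree, and is the only one that is
  homogeneous of a negative degree.\<close>

definition homogeneous :: "int \<Rightarrow> 'k::field mpoly \<Rightarrow> bool" where
  "homogeneous d p \<longleftrightarrow> (\<forall>m\<in>Poly_Mapping.keys p. int (mono_degree m) = d)"

definition ideal_gen :: "nat \<Rightarrow> 'k::field mpoly set \<Rightarrow> 'k mpoly set" where
  "ideal_gen N S = {\<Sum>s\<in>F. a s * s | F a. finite F \<and> F \<subseteq> S \<and> (\<forall>s\<in>F. a s \<in> poly_ring N)}"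

definition nonedge_ideal :: "nat \<Rightarrow> nat set set \<Rightarrow> 'k::field mpoly set" where
  "nonedge_ideal N E = ideal_gen N
     {var i * var j | i j. i \<in> {1..N} \<and> j \<in> {1..N} \<and> i \<noteq> j \<and> {i, j} \<notin> E}"

definition irrelevant_ideal :: "nat \<Rightarrow> 'k::field mpoly set" where
  "irrelevant_ideal N = ideal_gen N (var ` {1..N})"


section \<open>Graded free resolutions of cyclic modules\<close>

text \<open>A complex of graded free modules of finite rank over \<open>A\<close>, with an augmentation to \<open>A\<close>:
  \<open>F\<^sub>n = \<Oplus>\<^sub>p A(-s\<^sub>n\<^sub>,\<^sub>p)\<close> for \<open>p < rank F n\<close>, where \<open>s\<^sub>n\<^sub>,\<^sub>p = shift F n p\<close>. The \<open>(q, p)\<close> entry of the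
  matrix of \<open>F\<^sub>n\<^sub>+\<^sub>1 \<rightarrow> F\<^sub>n\<close> is \<open>dmat F n q p\<close>, and \<open>aug F p\<close> is the image in \<open>A\<close> of the
  \<open>p\<close>-th basis element of \<open>F\<^sub>0\<close>.\<close>

record (overloaded) ('k::zero) free_complex =
  rank :: "nat \<Rightarrow> nat"
  shift :: "nat \<Rightarrow> nat \<Rightarrow> int"
  dmat :: "nat \<Rightarrow> nat \<Rightarrow> nat \<Rightarrow> 'k mpoly"
  aug :: "nat \<Rightarrow> 'k mpoly"

definition free_module :: "nat \<Rightarrow> 'k::field free_complex \<Rightarrow> nat \<Rightarrow> (nat \<Rightarrow> 'k mpoly) set" where
  "free_module N F n =
     {v. (\<forall>p < rank F n. v p \<in> poly_ring N) \<and> (\<forall>p \<ge> rank F n. v p = 0)}"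

definition graded_piece :: "nat \<Rightarrow> 'k::field free_complex \<Rightarrow> nat \<Rightarrow> int \<Rightarrow> (nat \<Rightarrow> 'k mpoly) set" where
  "graded_piece N F n j =
     {v \<in> free_module N F n. \<forall>p < rank F n. homogeneous (j - shift F n p) (v p)}"

fun boundary :: "'k::field free_complex \<Rightarrow> nat \<Rightarrow> (nat \<Rightarrow> 'k mpoly) \<Rightarrow> (nat \<Rightarrow> 'k mpoly)" where
  "boundary F 0 v = 0"
| "boundary F (Suc n) v =
     (\<lambda>q. if q < rank F n then \<Sum>p < rank F (Suc n). dmat F n q p * v p else 0)"

definition augmentation :: "'k::field free_complex \<Rightarrow> (nat \<Rightarrow> 'k mpoly) \<Rightarrow> 'k mpoly" where
  "augmentation F v = (\<Sum>p < rank F 0. aug F p * v p)"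

text \<open>\<open>\<cdots> \<rightarrow> F\<^sub>1 \<rightarrow> F\<^sub>0 \<rightarrow> A/J \<rightarrow> 0\<close> is exact and all maps are homogeneous of degree zero.
  Finite ranks lose nothing: \<open>A\<close> is Noetherian.\<close>

definition graded_free_resolution :: "nat \<Rightarrow> 'k::field mpoly set \<Rightarrow> 'k free_complex \<Rightarrow> bool" where
  "graded_free_resolution N J F \<longleftrightarrow>
     (\<forall>n. \<forall>q < rank F n. \<forall>p < rank F (Suc n).
        dmat F n q p \<in> poly_ring N \<and> homogeneous (shift F (Suc n) p - shift F n q) (dmat F n q p)) \<and>
     (\<forall>p < rank F 0. aug F p \<in> poly_ring N \<and> homogeneous (shift F 0 p) (aug F p)) \<and>
     (\<forall>a \<in> poly_ring N. \<exists>v \<in> free_module N F 0. a - augmentation F v \<in> J) \<and>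
     {v \<in> free_module N F 0. augmentation F v \<in> J} = boundary F 1 ` free_module N F 1 \<and>
     (\<forall>n. {v \<in> free_module N F (Suc n). boundary F (Suc n) v = 0} =
          boundary F (Suc (Suc n)) ` free_module N F (Suc (Suc n)))"


section \<open>Tor and graded Betti numbers\<close>

definition scale :: "'k::field \<Rightarrow> (nat \<Rightarrow> 'k mpoly) \<Rightarrow> (nat \<Rightarrow> 'k mpoly)" where
  "scale c v = (\<lambda>p. const c * v p)"

lemma vector_space_scale: "vector_space (scale :: 'k::field \<Rightarrow> _)"
  by unfold_locales
    (auto simp: scale_def const_def fun_eq_iff single_add algebra_simps mult_single
      simp flip: mult.assoc)

text \<open>\<open>(A/I) \<otimes> F\<^sub>n\<close> is the direct sum of shifted copies of \<open>A/I\<close>, with boundary given by the same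
  matrices. The degree \<open>j\<close> cycles and boundaries of \<open>(A/I) \<otimes> F\<close> are represented here by their
  preimages in the degree \<open>j\<close> part of \<open>F\<^sub>n\<close>.\<close>

definition tor_cycles ::
  "nat \<Rightarrow> 'k::field mpoly set \<Rightarrow> 'k free_complex \<Rightarrow> nat \<Rightarrow> int \<Rightarrow> (nat \<Rightarrow> 'k mpoly) set" where
  "tor_cycles N I F i j = {v \<in> graded_piece N F i j. \<forall>q. boundary F i v q \<in> I}"

definition tor_boundaries ::
  "nat \<Rightarrow> 'k::field mpoly set \<Rightarrow> 'k free_complex \<Rightarrow> nat \<Rightarrow> int \<Rightarrow> (nat \<Rightarrow> 'k mpoly) set" where
  "tor_boundaries N I F i j =
     {v \<in> graded_piece N F i j.
        \<exists>w \<in> graded_piece N F (Suc i) j. \<forall>p. v p - boundary F (Suc i) w p \<in> I}"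

text \<open>The dimension of the degree \<open>j\<close> part of \<open>Tor\<^sub>i\<close> of \<open>A/I\<close> and \<open>A/J\<close>, for homogeneous ideals, as
  the \<open>i\<close>-th left derived functor of \<open>(A/I) \<otimes> -\<close> at \<open>A/J\<close>. The boundaries form a subspace of the
  cycles and both are finite-dimensional, so the difference is the dimension of the quotient. The
  choice of \<open>F\<close> is immaterial, by the usual comparison of resolutions.\<close>

definition tor_dim :: "nat \<Rightarrow> 'k::field mpoly set \<Rightarrow> 'k mpoly set \<Rightarrow> nat \<Rightarrow> int \<Rightarrow> nat" where
  "tor_dim N I J i j =
     (let F = (SOME F. graded_free_resolution N J F)
      in vector_space.dim scale (tor_cycles N I F i j)
         - vector_space.dim scale (tor_boundaries N I F i j))"

definition graded_betti :: "'k::field itself \<Rightarrow> nat \<Rightarrow> nat set set \<Rightarrow> nat \<Rightarrow> int \<Rightarrow> nat" where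
  "graded_betti K N E i j =
     tor_dim N (nonedge_ideal N E :: 'k mpoly set) (irrelevant_ideal N) i j"

end

theory Submission
  imports Defs "HOL-Library.Multiset"
begin

text \<open>
  Eliminate the vertices of a chordal graph one simplicial vertex at a time and let \<open>D\<close> be the multiset
  of the numbers of later neighbours. Adding the non-edges one by one, those at early vertices first,
  every colon ideal that occurs is generated by variables. By induction \<open>Tor\<close> sits in so few degrees
  that all connecting maps vanish for degree reasons, the Betti numbers add up, and they determine and
  are determined by the binomial sums \<open>\<Sum>d\<in>D. (N - 1 - d choose k)\<close>, that is, by \<open>D\<close>. The multisets \<open>D\<close>
  that occur are exactly the nonempty downward closed ones, and each of them belongs to exactly one threshold graph:
  an isolated vertex adds a \<open>0\<close>, a dominating one increases all values by one and adds a \<open>0\<close>.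

  The additivity argument works over any graded free resolution of the residue field, so no
  comparison of resolutions is needed, only the existence of one, obtained by iterated mapping cones.
\<close>


section \<open>Dimensions of quotients\<close>

text \<open>\<open>Tor\<close> is computed by tensoring a resolution \<open>F\<close> of the residue
  field with \<open>A/I\<close>. One \<open>F\<close> thus serves all ideals, and for
  \<open>J = (I : x)\<close> and \<open>I' = I + (x)\<close> the sequence 0 -> A/J(-d) -> A/I ->
  A/I' -> 0 stays exact after tensoring with the free modules of \<open>F\<close>. When a non-edge
  is added, \<open>Tor\<close> of \<open>A/J(-2)\<close> lives in degrees \<open>i + 2\<close>, and
  \<open>Tor\<close> of \<open>A/I\<close> in degree \<open>i + 1\<close>, or 0 for
  \<open>i = 0\<close>; hence no map between them. A colon ideal generated by \<open>s\<close>
  variables contributes \<open>s choose k\<close> in homological degree \<open>k + 1\<close>. If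
  \<open>v\<close> has \<open>u\<close> earlier vertices and \<open>w\<close> later non-neighbours,
  its non-edges meet colon ideals on \<open>u, ..., u + w - 1\<close> variables, and the
  hockey-stick sum is \<open>(u + w choose Suc k) - (u choose Suc k)\<close> with
  \<open>u + w = N - 1 - d\<close>. The subtracted terms add up over all \<open>v\<close> to a
  number depending on \<open>N\<close> and \<open>k\<close> only. Since classes are represented by
  vectors of polynomials, the maps of the long exact sequence are multivalued; dimensions are
  therefore compared along linear relations.\<close>

context vector_space
begin

lemma finite_basis_extend:
  assumes "subspace X0" "X0 \<subseteq> X" "finite S" "X \<subseteq> span S"
  obtains B0 B where "finite B" "independent B" "B0 \<subseteq> B" "B \<subseteq> X" "span B0 = X0" "X \<subseteq> span B"
    "dim X0 = card B0" "dim X = card B"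
proof -
  obtain B0 where B0: "B0 \<subseteq> X0" "independent B0" "X0 \<subseteq> span B0" "card B0 = dim X0"
    using basis_exists by blast
  have "B0 \<subseteq> X" using B0(1) assms(2) by blast
  then obtain B where B: "B0 \<subseteq> B" "B \<subseteq> X" "independent B" "X \<subseteq> span B"
    using maximal_independent_subset_extend[of B0 X] B0(2) by blast
  have "finite B"
    using independent_span_bound[OF assms(3) B(3)] B(2) assms(4) by blast
  moreover have "span B0 = X0"
    using B0 assms(1) by (simp add: span_subspace)
  moreover have "dim X = card B"
    using B basis_card_eq_dim by metis
  ultimately show thesis using that B B0 by metis
qed

text \<open>An infinite-dimensional set has \<open>dim\<close> equal to 0, so monotonicity is safe
  only inside a finite span; the same proviso accompanies the dimension counts below.\<close>

lemma dim_le_of_subset: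
  assumes "X0 \<subseteq> X" "finite S" "X \<subseteq> span S"
  shows "dim X0 \<le> dim X"
proof -
  obtain B where B: "B \<subseteq> X" "independent B" "X \<subseteq> span B" "card B = dim X"
    using basis_exists by blast
  have "finite B" using independent_span_bound[OF assms(2) B(2)] B(1) assms(3) by blast
  then show ?thesis using dim_le_card[of X0 B] B assms(1) by auto
qed

lemma subset_of_dim_le:
  assumes "subspace X0" "X0 \<subseteq> X" "finite S" "X \<subseteq> span S" "dim X \<le> dim X0"
  shows "X = X0"
proof -
  obtain B0 B where B: "finite B" "B0 \<subseteq> B" "span B0 = X0" "X \<subseteq> span B"
    "dim X0 = card B0" "dim X = card B"
    using finite_basis_extend[OF assms(1-4)] by metis
  have "B0 = B" using B assms(5) by (metis card_seteq)
  then show ?thesis using B assms(2) by blast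
qed

text \<open>Partners of a basis of a complement of \<open>X0\<close> in \<open>X\<close> stay
  independent modulo \<open>Y0\<close>: by linearity of \<open>P\<close>, a combination of them
  lying in \<open>Y0\<close> is a partner of a combination in \<open>X\<close>, which
  \<open>reflects\<close> puts into \<open>X0\<close>. A relation replaces a map because homological
  maps such as the connecting one involve choices.\<close>

lemma dim_quotient_le_of_relation:
  assumes X: "subspace X0" "X0 \<subseteq> X" "finite S" "X \<subseteq> span S"
    and Y: "subspace Y0" "Y0 \<subseteq> Y" "finite S'" "Y \<subseteq> span S'"
    and P0: "P 0 0"
    and Padd: "\<And>x y x' y'. P x y \<Longrightarrow> P x' y' \<Longrightarrow> P (x + x') (y + y')"
    and Pscale: "\<And>c x y. P x y \<Longrightarrow> P (scale c x) (scale c y)"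
    and total: "\<And>x. x \<in> X \<Longrightarrow> \<exists>y\<in>Y. P x y"
    and reflects: "\<And>x y. x \<in> X \<Longrightarrow> y \<in> Y0 \<Longrightarrow> P x y \<Longrightarrow> x \<in> X0"
    and "subspace X"
  shows "dim X - dim X0 \<le> dim Y - dim Y0"
proof -
  obtain B0 B where B: "finite B" "independent B" "B0 \<subseteq> B" "B \<subseteq> X" "span B0 = X0" "X \<subseteq> span B"
    "dim X0 = card B0" "dim X = card B"
    using finite_basis_extend[OF X] by metis
  obtain C0 C where C: "finite C" "independent C" "C0 \<subseteq> C" "C \<subseteq> Y" "span C0 = Y0" "Y \<subseteq> span C"
    "dim Y0 = card C0" "dim Y = card C"
    using finite_basis_extend[OF Y] by metis
  define f where "f x = (SOME y. y \<in> Y \<and> P x y)" for x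
  have f: "f x \<in> Y" "P x (f x)" if "x \<in> X" for x
  proof -
    have "\<exists>y. y \<in> Y \<and> P x y" using total[OF that] by blast
    from someI_ex[OF this] show "f x \<in> Y" "P x (f x)" unfolding f_def by auto
  qed
  \<comment> \<open>\<open>P\<close> need not be single-valued, so the chosen \<open>f\<close> need
    not be linear; still, each combination of chosen partners is a partner of some vector in the
    span of \<open>T\<close>.\<close>
  have lift: "\<exists>s\<in>span T. P s z" if "z \<in> span (f ` T)" "T \<subseteq> X" for z T
    using that(1)
  proof (induction rule: span_induct_alt)
    case base then show ?case using P0 span_zero by blast
  next
    case (step c x y)
    then obtain b s where "b \<in> T" "x = f b" "s \<in> span T" "P s y" by blast
    then have "P (scale c b + s) (scale c x + y)" using f(2) that(2) Pscale Padd by blast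
    moreover have "scale c b + s \<in> span T"
      using \<open>b \<in> T\<close> \<open>s \<in> span T\<close> by (simp add: span_add span_base span_scale)
    ultimately show ?case by blast
  qed
  \<comment> \<open>The partners are adjoined one at a time to the basis \<open>C0\<close> of
    \<open>Y0\<close>; a dependency of a new one would express \<open>b\<close> through the other
    vectors of \<open>B\<close>.\<close>
  have claim: "independent (C0 \<union> f ` T) \<and> card (C0 \<union> f ` T) = card C0 + card T"
    if "finite T" "T \<subseteq> B - B0" for T
    using that
  proof (induction T rule: finite_induct)
    case empty
    then show ?case using C independent_mono by auto
  next
    case (insert b T)
    have "f b \<notin> span (C0 \<union> f ` T)"
    proof
      assume "f b \<in> span (C0 \<union> f ` T)"
      then obtain y0 z where z: "f b = y0 + z" "y0 \<in> span C0" "z \<in> span (f ` T)"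
        unfolding span_Un by blast
      have TX: "T \<subseteq> X" using insert.prems B(4) by blast
      obtain s where s: "s \<in> span T" "P s z" using lift[OF z(3) TX] by blast
      have b: "b \<in> X" using insert.prems B(4) by blast
      have sX: "s \<in> X" using s(1) TX \<open>subspace X\<close> span_minimal by blast
      have "P (b + scale (-1) s) (f b + scale (-1) z)"
        using f(2)[OF b] s(2) Pscale Padd by blast
      then have "P (b - s) y0" using z(1) by simp
      then have "b - s \<in> X0"
        using reflects[of "b - s" y0] b sX \<open>subspace X\<close> subspace_diff z(2) C(5) by blast
      then have "b - s \<in> span (B - {b})"
        using B(5) insert.prems span_mono[of B0 "B - {b}"] B(3) by blast
      moreover have "s \<in> span (B - {b})"
        using s(1) insert span_mono[of T "B - {b}"] by blast
      ultimately have "b \<in> span (B - {b})" using span_add by fastforce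
      then show False using B(2) insert.prems unfolding dependent_def by blast
    qed
    moreover have "f b \<notin> C0 \<union> f ` T" using calculation span_base[of "f b"] by metis
    moreover have "finite (C0 \<union> f ` T)" using finite_subset[OF C(3,1)] insert(1) by simp
    moreover have "independent (C0 \<union> f ` T)" "card (C0 \<union> f ` T) = card C0 + card T"
      using insert by auto
    ultimately show ?case
      using insert(1,2) independent_insertI[of "f b" "C0 \<union> f ` T"] by simp
  qed
  have fin: "finite (B - B0)" using B(1) by simp
  have "C0 \<union> f ` (B - B0) \<subseteq> span C"
  proof -
    have "f ` (B - B0) \<subseteq> Y" using f B(4) by blast
    then show ?thesis using C(3,6) span_superset[of C] by auto
  qed
  then have "card C0 + card (B - B0) \<le> card C"
    using claim[OF fin subset_refl] independent_span_bound[OF C(1), of "C0 \<union> f ` (B - B0)"] by simp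
  moreover have "card (B - B0) = card B - card B0"
    by (rule card_Diff_subset[OF finite_subset[OF B(3,1)] B(3)])
  ultimately show ?thesis using B(7,8) C(7,8) by simp
qed

lemma dim_quotient_eq_of_relation:
  assumes X: "subspace X" "subspace X0" "X0 \<subseteq> X" "finite S" "X \<subseteq> span S"
    and Y: "subspace Y" "subspace Y0" "Y0 \<subseteq> Y" "finite S'" "Y \<subseteq> span S'"
    and P0: "P 0 0"
    and Padd: "\<And>x y x' y'. P x y \<Longrightarrow> P x' y' \<Longrightarrow> P (x + x') (y + y')"
    and Pscale: "\<And>c x y. P x y \<Longrightarrow> P (scale c x) (scale c y)"
    and left_total: "\<And>x. x \<in> X \<Longrightarrow> \<exists>y\<in>Y. P x y"
    and right_total: "\<And>y. y \<in> Y \<Longrightarrow> \<exists>x\<in>X. P x y"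
    and iff: "\<And>x y. x \<in> X \<Longrightarrow> y \<in> Y \<Longrightarrow> P x y \<Longrightarrow> x \<in> X0 \<longleftrightarrow> y \<in> Y0"
  shows "dim X - dim X0 = dim Y - dim Y0"
proof (rule antisym)
  show "dim X - dim X0 \<le> dim Y - dim Y0"
    by (rule dim_quotient_le_of_relation[OF X(2-5) Y(2-5), of P])
      (use assms in blast)+
  show "dim Y - dim Y0 \<le> dim X - dim X0"
    by (rule dim_quotient_le_of_relation[OF Y(2-5) X(2-5), of "\<lambda>y x. P x y"])
      (use assms in blast)+
qed

end

section \<open>Monomials\<close>

lemma keys_add_nat: "Poly_Mapping.keys (a + b) = Poly_Mapping.keys a \<union> Poly_Mapping.keys (b :: 'a \<Rightarrow>\<^sub>0 nat)"
  by (auto simp: in_keys_iff lookup_add)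

lemma mono_degree_superset:
  assumes "finite A" "Poly_Mapping.keys m \<subseteq> A"
  shows "mono_degree m = (\<Sum>i\<in>A. Poly_Mapping.lookup m i)"
  unfolding mono_degree_def using assms
  by (intro sum.mono_neutral_left) (auto simp: in_keys_iff)

lemma mono_degree_add: "mono_degree (a + b) = mono_degree a + mono_degree b"
proof -
  let ?A = "Poly_Mapping.keys a \<union> Poly_Mapping.keys b"
  have "mono_degree (a + b) = (\<Sum>i\<in>?A. Poly_Mapping.lookup (a + b) i)"
    by (intro mono_degree_superset) (auto simp: keys_add_nat)
  also have "\<dots> = mono_degree a + mono_degree b"
    by (simp add: lookup_add sum.distrib mono_degree_superset[of ?A])
  finally show ?thesis .
qed

lemma mono_degree_0 [simp]: "mono_degree 0 = 0"
  by (simp add: mono_degree_def)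

lemma mono_degree_single [simp]: "mono_degree (Poly_Mapping.single i n) = n"
  by (cases "n = 0") (auto simp: mono_degree_def)

lemma finite_monomials: "finite {m. Poly_Mapping.keys m \<subseteq> {1..N} \<and> mono_degree m = n}"
proof (rule inj_on_finite)
  let ?F = "{f. \<forall>i. (i \<in> {1..N} \<longrightarrow> f i \<in> {0..n}) \<and> (i \<notin> {1..N} \<longrightarrow> f i = (0::nat))}"
  show "inj_on Poly_Mapping.lookup {m. Poly_Mapping.keys m \<subseteq> {1..N} \<and> mono_degree m = n}"
    by (auto simp: inj_on_def intro: poly_mapping_eqI)
  show "Poly_Mapping.lookup ` {m. Poly_Mapping.keys m \<subseteq> {1..N} \<and> mono_degree m = n} \<subseteq> ?F"
  proof safe
    fix m i assume m: "Poly_Mapping.keys m \<subseteq> {1..N}" "n = mono_degree m"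
    show "Poly_Mapping.lookup m i = 0" if "i \<notin> {1..N}" using m that by (auto simp: in_keys_iff)
    assume "i \<in> {1..N}"
    then show "Poly_Mapping.lookup m i \<in> {0..mono_degree m}"
      using mono_degree_superset[OF _ m(1)] by (simp add: member_le_sum)
  qed
  show "finite ?F" by (rule finite_set_of_finite_funs) auto
qed

lemma sum_of_monomials: "p = (\<Sum>k\<in>Poly_Mapping.keys p. Poly_Mapping.single k (Poly_Mapping.lookup p k))"
  by (rule poly_mapping_eqI)
    (auto simp: lookup_sum lookup_single when_def in_keys_iff)

lemma monomial_mult:
  fixes a :: "(nat \<Rightarrow>\<^sub>0 nat) \<Rightarrow>\<^sub>0 'k::field"
  shows "Poly_Mapping.single m 1 * a =
    (\<Sum>k\<in>Poly_Mapping.keys a. Poly_Mapping.single (m + k) (Poly_Mapping.lookup a k))"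
  by (subst sum_of_monomials[of a]) (simp add: sum_distrib_left mult_single)

lemma lookup_monomial_mult:
  fixes a :: "(nat \<Rightarrow>\<^sub>0 nat) \<Rightarrow>\<^sub>0 'k::field"
  shows "Poly_Mapping.lookup (Poly_Mapping.single m 1 * a) (m + k) = Poly_Mapping.lookup a k"
  by (auto simp: monomial_mult lookup_sum lookup_single when_def in_keys_iff)

lemma keys_monomial_mult:
  fixes a :: "(nat \<Rightarrow>\<^sub>0 nat) \<Rightarrow>\<^sub>0 'k::field"
  shows "Poly_Mapping.keys (Poly_Mapping.single m 1 * a) = (+) m ` Poly_Mapping.keys a"
proof
  show "Poly_Mapping.keys (Poly_Mapping.single m 1 * a) \<subseteq> (+) m ` Poly_Mapping.keys a"
    using keys_mult[of "Poly_Mapping.single m (1::'k)" a] by auto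
  show "(+) m ` Poly_Mapping.keys a \<subseteq> Poly_Mapping.keys (Poly_Mapping.single m 1 * a)"
    by (auto simp: in_keys_iff lookup_monomial_mult)
qed

lemma keys_uminus: "Poly_Mapping.keys (- p) = Poly_Mapping.keys (p :: 'a \<Rightarrow>\<^sub>0 'b::ab_group_add)"
  by (auto simp: in_keys_iff)


section \<open>The polynomial ring and its grading\<close>

lemma poly_ring_0 [simp]: "0 \<in> poly_ring N"
  by (simp add: poly_ring_def)

lemma poly_ring_add: "p \<in> poly_ring N \<Longrightarrow> q \<in> poly_ring N \<Longrightarrow> p + q \<in> poly_ring N"
  using Poly_Mapping.keys_add[of p q] by (auto simp: poly_ring_def)

lemma poly_ring_uminus: "p \<in> poly_ring N \<Longrightarrow> - p \<in> poly_ring N"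
  by (auto simp: poly_ring_def keys_uminus)

lemma poly_ring_diff: "p \<in> poly_ring N \<Longrightarrow> q \<in> poly_ring N \<Longrightarrow> p - q \<in> poly_ring N"
  using poly_ring_add[of p N "- q"] poly_ring_uminus[of q N] by simp

lemma poly_ring_mult: "p \<in> poly_ring N \<Longrightarrow> q \<in> poly_ring N \<Longrightarrow> p * q \<in> poly_ring N"
  using keys_mult[of p q] by (fastforce simp: poly_ring_def keys_add_nat)

lemma poly_ring_sum: "(\<And>i. i \<in> A \<Longrightarrow> f i \<in> poly_ring N) \<Longrightarrow> sum f A \<in> poly_ring N"
  by (induction A rule: infinite_finite_induct) (auto intro: poly_ring_add)

lemma poly_ring_single: "Poly_Mapping.keys m \<subseteq> {1..N} \<Longrightarrow> Poly_Mapping.single m c \<in> poly_ring N"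
  by (simp add: poly_ring_def)

lemma poly_ring_const [simp]: "const c \<in> poly_ring N"
  by (simp add: poly_ring_def const_def)

lemma poly_ring_1 [simp]: "1 \<in> poly_ring N"
  by (simp add: poly_ring_def)

lemma homogeneous_0 [simp]: "homogeneous e 0"
  by (simp add: homogeneous_def)

lemma homogeneous_add: "homogeneous e p \<Longrightarrow> homogeneous e q \<Longrightarrow> homogeneous e (p + q)"
  using Poly_Mapping.keys_add[of p q] by (auto simp: homogeneous_def)

lemma homogeneous_uminus: "homogeneous e p \<Longrightarrow> homogeneous e (- p)"
  by (auto simp: homogeneous_def keys_uminus)

lemma homogeneous_diff: "homogeneous e p \<Longrightarrow> homogeneous e q \<Longrightarrow> homogeneous e (p - q)"
  using homogeneous_add[of e p "- q"] homogeneous_uminus[of e q] by simp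

lemma homogeneous_mult: "homogeneous d p \<Longrightarrow> homogeneous e q \<Longrightarrow> homogeneous (d + e) (p * q)"
  using keys_mult[of p q] by (fastforce simp: homogeneous_def mono_degree_add)

lemma homogeneous_sum: "(\<And>i. i \<in> A \<Longrightarrow> homogeneous e (f i)) \<Longrightarrow> homogeneous e (sum f A)"
  by (induction A rule: infinite_finite_induct) (auto intro: homogeneous_add)

lemma homogeneous_const [simp]: "homogeneous 0 (const c)"
  by (simp add: homogeneous_def const_def)

lemma homogeneous_1 [simp]: "homogeneous 0 1"
  by (simp add: homogeneous_def)

lemma homogeneous_single: "homogeneous (int (mono_degree m)) (Poly_Mapping.single m c)"
  by (simp add: homogeneous_def)

section \<open>Homogeneous components of polynomials\<close>

definition hcomp :: "int \<Rightarrow> 'k::field mpoly \<Rightarrow> 'k mpoly" where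
  "hcomp e p = (\<Sum>k\<in>{k \<in> Poly_Mapping.keys p. int (mono_degree k) = e}. Poly_Mapping.single k (Poly_Mapping.lookup p k))"

lemma lookup_hcomp:
  "Poly_Mapping.lookup (hcomp e p) k = (if int (mono_degree k) = e then Poly_Mapping.lookup p k else 0)"
  by (auto simp: hcomp_def lookup_sum lookup_single when_def in_keys_iff)

lemma keys_hcomp: "Poly_Mapping.keys (hcomp e p) = {k \<in> Poly_Mapping.keys p. int (mono_degree k) = e}"
  by (auto simp: in_keys_iff lookup_hcomp split: if_splits)

lemma homogeneous_hcomp: "homogeneous e (hcomp e p)"
  by (simp add: homogeneous_def keys_hcomp)

lemma poly_ring_hcomp: "p \<in> poly_ring N \<Longrightarrow> hcomp e p \<in> poly_ring N"
  by (simp add: poly_ring_def keys_hcomp)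

lemma hcomp_add: "hcomp e (p + q) = hcomp e p + hcomp e q"
  by (rule poly_mapping_eqI) (simp add: lookup_hcomp lookup_add)

lemma hcomp_0 [simp]: "hcomp e 0 = 0"
  by (rule poly_mapping_eqI) (simp add: lookup_hcomp)

lemma hcomp_sum: "hcomp e (sum f A) = (\<Sum>i\<in>A. hcomp e (f i))"
  by (induction A rule: infinite_finite_induct) (auto simp: hcomp_add)

lemma hcomp_homogeneous: "homogeneous e p \<Longrightarrow> hcomp e p = p"
  by (rule poly_mapping_eqI) (auto simp: lookup_hcomp homogeneous_def in_keys_iff)

lemma hcomp_homogeneous_other: "homogeneous d p \<Longrightarrow> d \<noteq> e \<Longrightarrow> hcomp e p = 0"
  by (rule poly_mapping_eqI) (auto simp: lookup_hcomp homogeneous_def in_keys_iff)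

text \<open>Both sides are additive in \<open>q\<close>, so \<open>q\<close> may be a single term;
  then the product is homogeneous and each component is either everything or 0.\<close>

lemma hcomp_mult:
  assumes "homogeneous d p"
  shows "hcomp e (p * q) = p * hcomp (e - d) q"
proof -
  have "hcomp e (p * Poly_Mapping.single k c) = p * hcomp (e - d) (Poly_Mapping.single k c)" for k c
  proof (cases "int (mono_degree k) = e - d")
    case True
    then have "homogeneous (e - d) (Poly_Mapping.single k c)" by (simp add: homogeneous_def)
    then show ?thesis
      using homogeneous_mult[OF assms, of "e - d"] by (simp add: hcomp_homogeneous)
  next
    case False
    then show ?thesis
      using homogeneous_mult[OF assms homogeneous_single[of k c]]
      by (simp add: hcomp_homogeneous_other[OF homogeneous_single] hcomp_homogeneous_other)
  qed
  then show ?thesis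
    by (subst (1 2) sum_of_monomials[of q]) (simp add: sum_distrib_left hcomp_sum)
qed


section \<open>Monomial ideals\<close>

text \<open>The polynomial ring in \<open>N\<close> variables is a subset of a type and not a type,
  so its ideals are described by closure conditions relative to \<open>poly_ring N\<close>.\<close>

definition ring_ideal :: "nat \<Rightarrow> 'k::field mpoly set \<Rightarrow> bool" where
  "ring_ideal N I \<longleftrightarrow> I \<subseteq> poly_ring N \<and> 0 \<in> I \<and> (\<forall>p\<in>I. \<forall>q\<in>I. p + q \<in> I) \<and>
     (\<forall>a\<in>poly_ring N. \<forall>p\<in>I. a * p \<in> I)"

lemma ring_idealD:
  assumes "ring_ideal N I"
  shows ring_ideal_0: "0 \<in> I"
    and ring_ideal_subset: "p \<in> I \<Longrightarrow> p \<in> poly_ring N"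
    and ring_ideal_add: "p \<in> I \<Longrightarrow> q \<in> I \<Longrightarrow> p + q \<in> I"
    and ring_ideal_mult: "a \<in> poly_ring N \<Longrightarrow> p \<in> I \<Longrightarrow> a * p \<in> I"
  using assms unfolding ring_ideal_def by blast+

lemma ring_ideal_uminus: "ring_ideal N I \<Longrightarrow> p \<in> I \<Longrightarrow> - p \<in> I"
  using ring_ideal_mult[of N I "- 1" p] poly_ring_uminus[of 1 N] by simp

lemma ring_ideal_diff: "ring_ideal N I \<Longrightarrow> p \<in> I \<Longrightarrow> q \<in> I \<Longrightarrow> p - q \<in> I"
  using ring_ideal_add[of N I p "- q"] ring_ideal_uminus[of N I q] by simp

lemma ring_ideal_sum:
  "ring_ideal N I \<Longrightarrow> (\<And>i. i \<in> A \<Longrightarrow> f i \<in> I) \<Longrightarrow> sum f A \<in> I"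
  by (induction A rule: infinite_finite_induct) (auto intro: ring_ideal_add ring_ideal_0)

text \<open>Membership is tested on each monomial separately, which turns colon ideals into
  conditions on exponents. \<open>U\<close> may contain exponents in further variables; these are
  cut off by \<open>poly_ring N\<close>.\<close>

definition mono_ideal :: "nat \<Rightarrow> (nat \<Rightarrow>\<^sub>0 nat) set \<Rightarrow> 'k::field mpoly set" where
  "mono_ideal N U = {p \<in> poly_ring N. Poly_Mapping.keys p \<subseteq> U}"

definition up_closed :: "(nat \<Rightarrow>\<^sub>0 nat) set \<Rightarrow> bool" where
  "up_closed U \<longleftrightarrow> (\<forall>u\<in>U. \<forall>h. u + h \<in> U)"

lemma ring_ideal_mono_ideal:
  assumes "up_closed U"
  shows "ring_ideal N (mono_ideal N U)"
proof -
  have "a * p \<in> mono_ideal N U" if "a \<in> poly_ring N" "p \<in> mono_ideal N U" for a p :: "'a mpoly"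
  proof -
    have "a * p \<in> poly_ring N" using that poly_ring_mult by (auto simp: mono_ideal_def)
    moreover have "Poly_Mapping.keys (a * p) \<subseteq> U"
    proof
      fix k assume "k \<in> Poly_Mapping.keys (a * p)"
      then obtain x y where "k = y + x" "y \<in> Poly_Mapping.keys p"
        using keys_mult[of a p] by (auto simp: add.commute)
      then show "k \<in> U" using that(2) assms by (auto simp: mono_ideal_def up_closed_def)
    qed
    ultimately show ?thesis by (simp add: mono_ideal_def)
  qed
  moreover have "p + q \<in> mono_ideal N U" if "p \<in> mono_ideal N U" "q \<in> mono_ideal N U" for p q :: "'a mpoly"
    using that Poly_Mapping.keys_add[of p q] poly_ring_add[of p N q] by (auto simp: mono_ideal_def)
  ultimately show ?thesis
    by (auto simp: ring_ideal_def mono_ideal_def)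
qed

definition generated_monomials :: "(nat \<Rightarrow>\<^sub>0 nat) set \<Rightarrow> (nat \<Rightarrow>\<^sub>0 nat) set" where
  "generated_monomials M = {g + h | g h. g \<in> M}"

lemma up_closed_generated: "up_closed (generated_monomials M)"
  unfolding up_closed_def generated_monomials_def by clarsimp (metis add.assoc)

lemma ideal_gen_add:
  assumes "p \<in> ideal_gen N S" "q \<in> ideal_gen N S"
  shows "p + q \<in> ideal_gen N S"
proof -
  obtain F a where F: "finite F" "F \<subseteq> S" "\<forall>s\<in>F. a s \<in> poly_ring N" "p = (\<Sum>s\<in>F. a s * s)"
    using assms(1) unfolding ideal_gen_def by blast
  obtain F' a' where F': "finite F'" "F' \<subseteq> S" "\<forall>s\<in>F'. a' s \<in> poly_ring N" "q = (\<Sum>s\<in>F'. a' s * s)"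
    using assms(2) unfolding ideal_gen_def by blast
  define b where "b s = (if s \<in> F then a s else 0) + (if s \<in> F' then a' s else 0)" for s
  have "(\<Sum>s\<in>F. a s * s) = (\<Sum>s\<in>F \<union> F'. (if s \<in> F then a s else 0) * s)"
    using F(1) F'(1) by (intro sum.mono_neutral_cong_left) auto
  moreover have "(\<Sum>s\<in>F'. a' s * s) = (\<Sum>s\<in>F \<union> F'. (if s \<in> F' then a' s else 0) * s)"
    using F(1) F'(1) by (intro sum.mono_neutral_cong_left) auto
  ultimately have "p + q = (\<Sum>s\<in>F \<union> F'. b s * s)"
    by (simp add: F(4) F'(4) b_def distrib_right sum.distrib)
  moreover have "\<forall>s\<in>F \<union> F'. b s \<in> poly_ring N"
    using F(3) F'(3) by (auto simp: b_def intro: poly_ring_add)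
  ultimately show ?thesis
    unfolding ideal_gen_def using F(1,2) F'(1,2) by blast
qed

lemma ideal_gen_mult_gen: "a \<in> poly_ring N \<Longrightarrow> s \<in> S \<Longrightarrow> a * s \<in> ideal_gen N S"
  unfolding ideal_gen_def by (rule CollectI, rule exI[of _ "{s}"], rule exI[of _ "\<lambda>_. a"]) simp

lemma ideal_gen_0: "0 \<in> ideal_gen N S"
  unfolding ideal_gen_def by (rule CollectI, rule exI[of _ "{}"]) simp

text \<open>A combination of monomial generators has only multiples of generators in its support;
  conversely, each term of a polynomial with such a support is by itself a multiple of one
  generator.\<close>

lemma ideal_gen_monomials:
  assumes M: "\<And>g. g \<in> M \<Longrightarrow> Poly_Mapping.keys g \<subseteq> {1..N}"
  shows "ideal_gen N ((\<lambda>g. Poly_Mapping.single g (1::'k::field)) ` M) =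
    mono_ideal N (generated_monomials M)" (is "?L = ?R")
proof
  have R: "ring_ideal N ?R"
    by (rule ring_ideal_mono_ideal[OF up_closed_generated])
  have gen: "Poly_Mapping.single g 1 \<in> ?R" if "g \<in> M" for g
  proof -
    have "g \<in> generated_monomials M"
      unfolding generated_monomials_def using that by (auto intro: exI[of _ g] exI[of _ 0])
    then show ?thesis using M[OF that] poly_ring_single by (auto simp: mono_ideal_def)
  qed
  show "?L \<subseteq> ?R"
  proof
    fix p assume "p \<in> ?L"
    then obtain F a where F: "F \<subseteq> (\<lambda>g. Poly_Mapping.single g 1) ` M" "\<forall>s\<in>F. a s \<in> poly_ring N"
      "p = (\<Sum>s\<in>F. a s * s)" unfolding ideal_gen_def by blast
    have "a s * s \<in> ?R" if "s \<in> F" for s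
    proof -
      obtain g where "g \<in> M" "s = Poly_Mapping.single g 1" using F(1) \<open>s \<in> F\<close> by auto
      then show ?thesis using ring_ideal_mult[OF R] gen F(2) \<open>s \<in> F\<close> by blast
    qed
    then show "p \<in> ?R" unfolding F(3) by (rule ring_ideal_sum[OF R])
  qed
  show "?R \<subseteq> ?L"
  proof
    fix p :: "'k mpoly" assume p: "p \<in> ?R"
    have single: "Poly_Mapping.single k (Poly_Mapping.lookup p k) \<in> ?L" if "k \<in> Poly_Mapping.keys p" for k
    proof -
      obtain g h where g: "g \<in> M" "k = g + h"
        using p \<open>k \<in> Poly_Mapping.keys p\<close> by (auto simp: mono_ideal_def generated_monomials_def)
      have "Poly_Mapping.keys k \<subseteq> {1..N}" using p that by (auto simp: mono_ideal_def poly_ring_def)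
      then have "Poly_Mapping.single h (Poly_Mapping.lookup p k) \<in> poly_ring N"
        using g by (intro poly_ring_single) (auto simp: keys_add_nat)
      then have "Poly_Mapping.single h (Poly_Mapping.lookup p k) * Poly_Mapping.single g 1 \<in> ?L"
        using g(1) by (intro ideal_gen_mult_gen) auto
      then show ?thesis using g(2) by (simp add: mult_single add.commute)
    qed
    have "(\<Sum>k\<in>A. Poly_Mapping.single k (Poly_Mapping.lookup p k)) \<in> ?L" if "A \<subseteq> Poly_Mapping.keys p" for A
      using finite_subset[OF that finite_keys] that
    proof (induction A rule: finite_induct)
      case (insert k A)
      then show ?case using ideal_gen_add[OF single] by simp
    qed (simp add: ideal_gen_0)
    then show "p \<in> ?L" by (subst sum_of_monomials) blast
  qed
qed

text \<open>The data of an exact sequence 0 -> A/J(-d) -> A/I -> A/I' -> 0 whose first map is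
  multiplication by \<open>x\<close>: \<open>J\<close> is the colon ideal of \<open>I\<close> by
  \<open>x\<close>, and \<open>I'\<close> is \<open>I + (x)\<close>. The last clause is the graded
  form of the one before it and keeps the diagram chases within one degree.\<close>

definition colon_step :: "nat \<Rightarrow> 'k::field mpoly set \<Rightarrow> 'k mpoly set \<Rightarrow> 'k mpoly \<Rightarrow> int \<Rightarrow> 'k mpoly set \<Rightarrow> bool" where
  "colon_step N I J x d I' \<longleftrightarrow> ring_ideal N I \<and> ring_ideal N J \<and> ring_ideal N I' \<and>
     x \<in> poly_ring N \<and> homogeneous d x \<and> x \<in> I' \<and> I \<subseteq> I' \<and>
     (\<forall>a\<in>poly_ring N. x * a \<in> I \<longleftrightarrow> a \<in> J) \<and>
     (\<forall>p\<in>I'. \<exists>a\<in>poly_ring N. p - x * a \<in> I) \<and>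
     (\<forall>p\<in>I'. \<forall>e. homogeneous e p \<longrightarrow> (\<exists>a\<in>poly_ring N. homogeneous (e - d) a \<and> p - x * a \<in> I))"

text \<open>Multiplication by a monomial translates exponents by \<open>g\<close>, so the colon
  condition concerns single exponents, and a monomial of the new ideal outside the old one is
  divisible by \<open>g\<close>.\<close>

lemma colon_step_mono_ideal:
  assumes U: "up_closed U" and V: "up_closed V" and g: "Poly_Mapping.keys g \<subseteq> {1..N}"
    and colon: "\<And>k. Poly_Mapping.keys k \<subseteq> {1..N} \<Longrightarrow> g + k \<in> U \<longleftrightarrow> k \<in> V"
    and deg: "d = int (mono_degree g)"
    and U': "U' = U \<union> generated_monomials {g}"
  shows "colon_step N (mono_ideal N U) (mono_ideal N V) (Poly_Mapping.single g (1::'k::field)) d (mono_ideal N U')"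
proof -
  let ?x = "Poly_Mapping.single g (1::'k)"
  have x: "?x \<in> poly_ring N" by (rule poly_ring_single[OF g])
  have upU': "up_closed U'"
    using U up_closed_generated[of "{g}"] by (auto simp: U' up_closed_def)
  have "g \<in> U'" unfolding U' generated_monomials_def by (auto intro: exI[of _ 0])
  then have "?x \<in> mono_ideal N U'" using x by (simp add: mono_ideal_def)
  moreover have "?x * a \<in> mono_ideal N U \<longleftrightarrow> a \<in> mono_ideal N V" if a: "a \<in> poly_ring N" for a
  proof -
    have "Poly_Mapping.keys (?x * a) \<subseteq> U \<longleftrightarrow> Poly_Mapping.keys a \<subseteq> V"
      using a colon by (auto simp: keys_monomial_mult poly_ring_def image_subset_iff)
    then show ?thesis using poly_ring_mult[OF x a] a by (simp add: mono_ideal_def)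
  qed
  \<comment> \<open>One coefficient \<open>a\<close> serves both decomposition clauses, since
    division by \<open>g\<close> lowers every degree by \<open>d\<close>.\<close>
  moreover have dec: "\<exists>a\<in>poly_ring N. (\<forall>e. homogeneous e p \<longrightarrow> homogeneous (e - d) a) \<and> p - ?x * a \<in> mono_ideal N U"
    if p: "p \<in> mono_ideal N U'" for p
  proof -
    let ?K = "{k \<in> Poly_Mapping.keys p. k \<notin> U}"
    \<comment> \<open>Only the terms outside \<open>U\<close> are divided. The difference
      \<open>k - g\<close> is truncated pointwise, but \<open>g\<close> divides these
      \<open>k\<close>, so it is a true quotient.\<close>
    define a where "a = (\<Sum>k\<in>?K. Poly_Mapping.single (k - g) (Poly_Mapping.lookup p k))"
    have K: "g + (k - g) = k" "Poly_Mapping.keys (k - g) \<subseteq> {1..N}"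
      "mono_degree k = mono_degree g + mono_degree (k - g)" if k: "k \<in> ?K" for k
    proof -
      obtain h where h: "k = g + h"
        using p k unfolding mono_ideal_def U' generated_monomials_def by fast
      then show "g + (k - g) = k" by simp
      then show "mono_degree k = mono_degree g + mono_degree (k - g)" by (metis mono_degree_add)
      have "Poly_Mapping.keys k \<subseteq> {1..N}"
        using k p by (auto simp: mono_ideal_def poly_ring_def)
      then show "Poly_Mapping.keys (k - g) \<subseteq> {1..N}" by (simp add: h keys_add_nat)
    qed
    have "a \<in> poly_ring N" unfolding a_def by (intro poly_ring_sum poly_ring_single K)
    moreover have "homogeneous (e - d) a" if "homogeneous e p" for e
      unfolding a_def
    proof (rule homogeneous_sum)
      fix k assume k: "k \<in> ?K"
      then have "e - d = int (mono_degree (k - g))"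
        using K(3)[OF k] that by (auto simp: deg homogeneous_def)
      then show "homogeneous (e - d) (Poly_Mapping.single (k - g) (Poly_Mapping.lookup p k))"
        using homogeneous_single by metis
    qed
    moreover have "p - ?x * a \<in> mono_ideal N U"
    proof -
      have xa: "?x * a = (\<Sum>k\<in>?K. Poly_Mapping.single k (Poly_Mapping.lookup p k))"
        unfolding a_def sum_distrib_left using K(1) by (intro sum.cong) (auto simp: mult_single)
      have "Poly_Mapping.lookup (p - ?x * a) k = 0" if "k \<notin> U" for k
        using that by (auto simp: xa lookup_minus lookup_sum lookup_single when_def in_keys_iff)
      then have "Poly_Mapping.keys (p - ?x * a) \<subseteq> U" by (auto simp: in_keys_iff)
      moreover have "p - ?x * a \<in> poly_ring N"
        using p \<open>a \<in> poly_ring N\<close> x by (auto simp: mono_ideal_def intro: poly_ring_diff poly_ring_mult)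
      ultimately show ?thesis by (simp add: mono_ideal_def)
    qed
    ultimately show ?thesis by blast
  qed
  moreover have "homogeneous d ?x" unfolding deg by (rule homogeneous_single)
  moreover have "mono_ideal N U \<subseteq> (mono_ideal N U' :: 'k mpoly set)" by (auto simp: mono_ideal_def U')
  ultimately show ?thesis
    unfolding colon_step_def
    using ring_ideal_mono_ideal[OF U] ring_ideal_mono_ideal[OF V] ring_ideal_mono_ideal[OF upU'] x
    by blast
qed

text \<open>The ideal generated by the variables with index in \<open>S\<close>.\<close>

definition linear_ideal :: "nat \<Rightarrow> nat set \<Rightarrow> 'k::field mpoly set" where
  "linear_ideal N S = mono_ideal N {m. Poly_Mapping.keys m \<inter> S \<noteq> {}}"

lemma up_closed_linear: "up_closed {m. Poly_Mapping.keys m \<inter> S \<noteq> {}}"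
  by (auto simp: up_closed_def keys_add_nat)

lemma generated_single_var:
  "generated_monomials {Poly_Mapping.single i 1} = {m. i \<in> Poly_Mapping.keys m}"
proof safe
  fix m :: "nat \<Rightarrow>\<^sub>0 nat"
  assume "i \<in> Poly_Mapping.keys m"
  then have "m = Poly_Mapping.single i 1 + (m - Poly_Mapping.single i 1)"
    by (intro poly_mapping_eqI) (auto simp: lookup_add lookup_minus lookup_single when_def in_keys_iff)
  then show "m \<in> generated_monomials {Poly_Mapping.single i 1}"
    unfolding generated_monomials_def by blast
qed (auto simp: generated_monomials_def keys_add_nat)

text \<open>A variable outside \<open>S\<close> is a nonzerodivisor modulo those in
  \<open>S\<close>, so the colon ideal is the old ideal again. This step drives both the Koszul
  resolution and the Betti numbers of linear ideals.\<close>

lemma colon_step_linear_ideal: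
  assumes "i \<in> {1..N}" "i \<notin> S"
  shows "colon_step N (linear_ideal N S) (linear_ideal N S) (var i :: 'k::field mpoly) 1 (linear_ideal N (insert i S))"
  unfolding linear_ideal_def var_def
proof (rule colon_step_mono_ideal[OF up_closed_linear up_closed_linear])
  show "{m. Poly_Mapping.keys m \<inter> insert i S \<noteq> {}} =
    {m. Poly_Mapping.keys m \<inter> S \<noteq> {}} \<union> generated_monomials {Poly_Mapping.single i 1}"
    unfolding generated_single_var by auto
qed (use assms in \<open>auto simp: keys_add_nat\<close>)

lemma irrelevant_ideal_eq: "irrelevant_ideal N = (linear_ideal N {1..N} :: 'k::field mpoly set)"
proof -
  have "generated_monomials ((\<lambda>i. Poly_Mapping.single i 1) ` {1..N}) = (\<Union>i\<in>{1..N}. generated_monomials {Poly_Mapping.single i 1})"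
    by (auto simp: generated_monomials_def)
  also have "\<dots> = {m. Poly_Mapping.keys m \<inter> {1..N} \<noteq> {}}"
    unfolding generated_single_var by auto
  finally have gen: "generated_monomials ((\<lambda>i. Poly_Mapping.single i 1) ` {1..N}) =
    {m. Poly_Mapping.keys m \<inter> {1..N} \<noteq> {}}" .
  have "irrelevant_ideal N =
      ideal_gen N ((\<lambda>g. Poly_Mapping.single g (1::'k)) ` (\<lambda>i. Poly_Mapping.single i 1) ` {1..N})"
    unfolding irrelevant_ideal_def var_def image_image ..
  also have "\<dots> = mono_ideal N (generated_monomials ((\<lambda>i. Poly_Mapping.single i 1) ` {1..N}))"
    by (rule ideal_gen_monomials) auto
  finally show ?thesis unfolding gen linear_ideal_def .
qed

lemma linear_ideal_empty: "linear_ideal N {} = {0}"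
  by (auto simp: linear_ideal_def mono_ideal_def)

lemma ring_ideal_linear_ideal: "ring_ideal N (linear_ideal N S)"
  unfolding linear_ideal_def by (rule ring_ideal_mono_ideal[OF up_closed_linear])

section \<open>Additivity of Betti numbers along colon ideals\<close>

interpretation vs: vector_space "scale :: 'k::field \<Rightarrow> (nat \<Rightarrow> 'k mpoly) \<Rightarrow> _"
  by (rule vector_space_scale)

section \<open>Vectors of polynomials and their graded pieces\<close>

lemma boundary_add: "boundary F i (v + w) = boundary F i v + boundary F i w"
  by (cases i) (auto simp: fun_eq_iff distrib_left sum.distrib)

lemma boundary_mult: "boundary F i (\<lambda>p. a * v p) = (\<lambda>q. a * boundary F i v q)"
  by (cases i) (auto simp: fun_eq_iff sum_distrib_left mult.left_commute)

lemma boundary_diff: "boundary F i (v - w) = boundary F i v - boundary F i w"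
  by (cases i) (auto simp: fun_eq_iff right_diff_distrib sum_subtractf)

lemma boundary_zero: "boundary F i 0 = 0"
  by (cases i) (auto simp: fun_eq_iff)

lemma boundary_scale: "boundary F i (scale c v) = scale c (boundary F i v)"
  unfolding scale_def by (rule boundary_mult)

lemma free_module_add: "v \<in> free_module N F i \<Longrightarrow> w \<in> free_module N F i \<Longrightarrow> v + w \<in> free_module N F i"
  by (auto simp: free_module_def poly_ring_add)

lemma free_module_diff: "v \<in> free_module N F i \<Longrightarrow> w \<in> free_module N F i \<Longrightarrow> v - w \<in> free_module N F i"
  by (auto simp: free_module_def poly_ring_diff)

lemma free_module_mult:
  "a \<in> poly_ring N \<Longrightarrow> v \<in> free_module N F i \<Longrightarrow> (\<lambda>p. a * v p) \<in> free_module N F i"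
  by (auto simp: free_module_def poly_ring_mult)

lemma free_module_0: "0 \<in> free_module N F i"
  by (auto simp: free_module_def)

lemma free_module_poly_ring: "v \<in> free_module N F i \<Longrightarrow> v p \<in> poly_ring N"
  by (cases "p < rank F i") (auto simp: free_module_def)

lemma graded_piece_free_module: "v \<in> graded_piece N F i j \<Longrightarrow> v \<in> free_module N F i"
  by (simp add: graded_piece_def)

lemma graded_piece_add: "v \<in> graded_piece N F i j \<Longrightarrow> w \<in> graded_piece N F i j \<Longrightarrow> v + w \<in> graded_piece N F i j"
  by (auto simp: graded_piece_def free_module_add homogeneous_add)

lemma graded_piece_diff: "v \<in> graded_piece N F i j \<Longrightarrow> w \<in> graded_piece N F i j \<Longrightarrow> v - w \<in> graded_piece N F i j"
  by (auto simp: graded_piece_def free_module_diff homogeneous_diff)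

lemma graded_piece_0: "0 \<in> graded_piece N F i j"
  by (auto simp: graded_piece_def free_module_0)

lemma graded_piece_mult:
  assumes "a \<in> poly_ring N" "homogeneous d a" "v \<in> graded_piece N F i (j - d)"
  shows "(\<lambda>p. a * v p) \<in> graded_piece N F i j"
proof -
  have "homogeneous (j - shift F i p) (a * v p)" if "p < rank F i" for p
  proof -
    have "homogeneous (d + (j - d - shift F i p)) (a * v p)"
      using assms that by (intro homogeneous_mult) (auto simp: graded_piece_def)
    then show ?thesis by (simp add: algebra_simps)
  qed
  then show ?thesis using assms free_module_mult by (auto simp: graded_piece_def)
qed

lemma graded_piece_scale: "v \<in> graded_piece N F i j \<Longrightarrow> scale c v \<in> graded_piece N F i j"
  unfolding scale_def by (rule graded_piece_mult[of _ _ 0]) auto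

lemma sum_fun_apply: "(sum f A) q = (\<Sum>x\<in>A. f x q)" for f :: "'a \<Rightarrow> 'b \<Rightarrow> 'c::comm_monoid_add"
  by (induction A rule: infinite_finite_induct) auto

lemma graded_piece_finite_span:
  obtains S where "finite S" "graded_piece N F i j \<subseteq> vs.span S"
proof -
  \<comment> \<open>For a negative degree \<open>nat\<close> gives 0 and \<open>?M p\<close>
    contains the monomial 1; this only enlarges the spanning set.\<close>
  let ?M = "\<lambda>p. {m. Poly_Mapping.keys m \<subseteq> {1..N} \<and> mono_degree m = nat (j - shift F i p)}"
  define e :: "nat \<Rightarrow> _ \<Rightarrow> nat \<Rightarrow> 'a mpoly"
    where "e p m = (\<lambda>q. if q = p then Poly_Mapping.single m 1 else 0)" for p m
  define S where "S = (\<Union>p<rank F i. e p ` ?M p)"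
  have "finite S" unfolding S_def by (auto intro: finite_monomials[simplified])
  moreover have "graded_piece N F i j \<subseteq> vs.span S"
  proof
    fix v assume v: "v \<in> graded_piece N F i j"
    have "v = (\<Sum>p<rank F i. \<Sum>m\<in>Poly_Mapping.keys (v p). scale (Poly_Mapping.lookup (v p) m) (e p m))"
    proof
      fix q
      have "(\<Sum>p<rank F i. \<Sum>m\<in>Poly_Mapping.keys (v p). scale (Poly_Mapping.lookup (v p) m) (e p m)) q
        = (\<Sum>p<rank F i. if q = p then \<Sum>m\<in>Poly_Mapping.keys (v p). Poly_Mapping.single m (Poly_Mapping.lookup (v p) m) else 0)"
        unfolding sum_fun_apply scale_def const_def e_def
        by (intro sum.cong refl) (simp add: mult_single)
      also have "\<dots> = (if q < rank F i then v q else 0)"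
        by (auto simp flip: sum_of_monomials)
      finally show "v q = (\<Sum>p<rank F i. \<Sum>m\<in>Poly_Mapping.keys (v p). scale (Poly_Mapping.lookup (v p) m) (e p m)) q"
        using v by (auto simp: graded_piece_def free_module_def)
    qed
    moreover have "scale (Poly_Mapping.lookup (v p) m) (e p m) \<in> vs.span S"
      if "p < rank F i" "m \<in> Poly_Mapping.keys (v p)" for p m
    proof -
      have "int (mono_degree m) = j - shift F i p" "Poly_Mapping.keys m \<subseteq> {1..N}"
        using v that by (auto simp: graded_piece_def free_module_def homogeneous_def poly_ring_def)
      then have "m \<in> ?M p" by simp
      then have "e p m \<in> S" unfolding S_def using that(1) by blast
      then show ?thesis by (intro vs.span_scale vs.span_base)
    qed
    ultimately show "v \<in> vs.span S"
      by (metis (no_types, lifting) vs.span_sum lessThan_iff)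
  qed
  ultimately show thesis using that by blast
qed

text \<open>One resolution \<open>F\<close> of \<open>A/M\<close> is fixed while the ideal
  \<open>I\<close> of the tensor factor \<open>A/I\<close> varies, so a whole long exact sequence
  can be written with vectors of the same free modules.\<close>

locale free_resolution =
  fixes N :: nat and M :: "'k::field mpoly set" and F :: "'k free_complex"
  assumes res: "graded_free_resolution N M F"
begin

abbreviation "Z I i j \<equiv> tor_cycles N I F i j"
abbreviation "B I i j \<equiv> tor_boundaries N I F i j"

lemma dmat:
  assumes "q < rank F n" "p < rank F (Suc n)"
  shows "dmat F n q p \<in> poly_ring N" "homogeneous (shift F (Suc n) p - shift F n q) (dmat F n q p)"
  using res[unfolded graded_free_resolution_def, THEN conjunct1, rule_format, OF assms] by simp_all

lemma boundary_in_free_module: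
  "v \<in> free_module N F (Suc n) \<Longrightarrow> boundary F (Suc n) v \<in> free_module N F n"
  by (auto simp: free_module_def dmat intro!: poly_ring_sum poly_ring_mult)

lemma boundary_in_graded_piece:
  assumes "v \<in> graded_piece N F (Suc n) j"
  shows "boundary F (Suc n) v \<in> graded_piece N F n j"
proof -
  have "homogeneous (j - shift F n q) (dmat F n q p * v p)"
    if "q < rank F n" "p < rank F (Suc n)" for p q
  proof -
    have "homogeneous ((shift F (Suc n) p - shift F n q) + (j - shift F (Suc n) p)) (dmat F n q p * v p)"
      using assms that by (intro homogeneous_mult dmat) (auto simp: graded_piece_def)
    then show ?thesis by (simp add: algebra_simps)
  qed
  then have "homogeneous (j - shift F n q) (boundary F (Suc n) v q)" if "q < rank F n" for q
    using that by (auto intro: homogeneous_sum)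
  then show ?thesis
    using assms boundary_in_free_module[of v n] by (simp add: graded_piece_def del: boundary.simps)
qed

lemma boundary_boundary: "v \<in> free_module N F (Suc n) \<Longrightarrow> boundary F n (boundary F (Suc n) v) = 0"
proof (cases n)
  case (Suc m)
  assume "v \<in> free_module N F (Suc n)"
  moreover have "{v \<in> free_module N F (Suc m). boundary F (Suc m) v = 0} =
      boundary F (Suc (Suc m)) ` free_module N F (Suc (Suc m))"
    using res by (simp only: graded_free_resolution_def)
  ultimately show ?thesis unfolding Suc by blast
qed simp

lemma boundary_ideal:
  assumes "ring_ideal N I" "\<And>p. v p \<in> I"
  shows "boundary F i v q \<in> I"
proof (cases i)
  case (Suc n)
  have "dmat F n q p * v p \<in> I" if "q < rank F n" "p < rank F (Suc n)" for p
    by (rule ring_ideal_mult[OF assms(1) dmat(1)[OF that] assms(2)])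
  then show ?thesis
    using ring_ideal_0[OF assms(1)] by (auto simp: Suc intro: ring_ideal_sum[OF assms(1)])
qed (simp add: ring_ideal_0[OF assms(1)])

declare boundary.simps(2) [simp del]

lemma cyclesI: "v \<in> graded_piece N F i j \<Longrightarrow> (\<And>q. boundary F i v q \<in> I) \<Longrightarrow> v \<in> Z I i j"
  by (auto simp: tor_cycles_def)

lemma cyclesD: "v \<in> Z I i j \<Longrightarrow> v \<in> graded_piece N F i j" "v \<in> Z I i j \<Longrightarrow> boundary F i v q \<in> I"
  by (auto simp: tor_cycles_def)

lemma boundariesI: "v \<in> graded_piece N F i j \<Longrightarrow> w \<in> graded_piece N F (Suc i) j \<Longrightarrow>
    (\<And>p. v p - boundary F (Suc i) w p \<in> I) \<Longrightarrow> v \<in> B I i j"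
  by (auto simp: tor_boundaries_def)

lemma boundariesE:
  assumes "v \<in> B I i j"
  obtains w where "v \<in> graded_piece N F i j" "w \<in> graded_piece N F (Suc i) j"
    "\<And>p. v p - boundary F (Suc i) w p \<in> I"
  using assms by (auto simp: tor_boundaries_def)

lemma boundaries_subset_cycles:
  assumes I: "ring_ideal N I"
  shows "B I i j \<subseteq> Z I i j"
proof
  fix v assume "v \<in> B I i j"
  then obtain w where w: "v \<in> graded_piece N F i j" "w \<in> graded_piece N F (Suc i) j"
    "\<And>p. (v - boundary F (Suc i) w) p \<in> I" by (rule boundariesE) auto
  have "boundary F i v = boundary F i (v - boundary F (Suc i) w)"
    using boundary_boundary[OF graded_piece_free_module[OF w(2)]] by (simp add: boundary_diff)
  then have "boundary F i v q \<in> I" for q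
    using boundary_ideal[where v = "v - boundary F (Suc i) w", OF I w(3)] by simp
  then show "v \<in> Z I i j" using w(1) by (rule cyclesI[rotated])
qed

lemma subspace_cycles:
  assumes I: "ring_ideal N I"
  shows "vs.subspace (Z I i j)"
  unfolding vs.subspace_def
proof (intro conjI ballI allI)
  show "0 \<in> Z I i j"
    by (intro cyclesI) (auto simp: graded_piece_0 boundary_zero ring_ideal_0[OF I])
next
  fix v w assume "v \<in> Z I i j" "w \<in> Z I i j"
  then show "v + w \<in> Z I i j"
    by (intro cyclesI) (auto simp: boundary_add dest: cyclesD intro: ring_ideal_add[OF I] graded_piece_add)
next
  fix c v assume "v \<in> Z I i j"
  then show "scale c v \<in> Z I i j"
    by (intro cyclesI)
      (auto simp: boundary_scale scale_def[of c "boundary F i v"] dest: cyclesD intro: graded_piece_scale ring_ideal_mult[OF I])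
qed

lemma subspace_boundaries:
  assumes I: "ring_ideal N I"
  shows "vs.subspace (B I i j)"
  unfolding vs.subspace_def
proof (intro conjI ballI allI)
  show "0 \<in> B I i j"
    by (intro boundariesI[of _ _ _ 0]) (auto simp: graded_piece_0 boundary_zero ring_ideal_0[OF I] simp del: boundary.simps)
next
  fix v v' assume "v \<in> B I i j" "v' \<in> B I i j"
  then obtain w w' where w: "v \<in> graded_piece N F i j" "w \<in> graded_piece N F (Suc i) j"
    "\<And>p. v p - boundary F (Suc i) w p \<in> I"
    "v' \<in> graded_piece N F i j" "w' \<in> graded_piece N F (Suc i) j"
    "\<And>p. v' p - boundary F (Suc i) w' p \<in> I" by (elim boundariesE) blast
  show "v + v' \<in> B I i j"
  proof (rule boundariesI[of _ _ _ "w + w'"])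
    fix p show "(v + v') p - boundary F (Suc i) (w + w') p \<in> I"
      using ring_ideal_add[OF I w(3)[of p] w(6)[of p]]
      by (simp add: boundary_add algebra_simps)
  qed (intro graded_piece_add w)+
next
  fix c v assume "v \<in> B I i j"
  then obtain w where w: "v \<in> graded_piece N F i j" "w \<in> graded_piece N F (Suc i) j"
    "\<And>p. v p - boundary F (Suc i) w p \<in> I" by (elim boundariesE) blast
  show "scale c v \<in> B I i j"
  proof (rule boundariesI[of _ _ _ "scale c w"])
    fix p show "scale c v p - boundary F (Suc i) (scale c w) p \<in> I"
      using ring_ideal_mult[OF I poly_ring_const w(3)[of p], of c]
      by (simp only: boundary_scale) (simp add: scale_def right_diff_distrib)
  qed (intro graded_piece_scale w)+
qed

text \<open>Multiplication by \<open>x\<close> carries \<open>J\<close> into \<open>I\<close>, hence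
  induces a chain map between the tensor products that raises degrees by \<open>d\<close>.\<close>

lemma boundaries_multiple:
  assumes x: "x \<in> poly_ring N" "homogeneous d x" and "a \<in> B J i (j - d)"
    and "\<And>b. b \<in> J \<Longrightarrow> x * b \<in> I"
  shows "(\<lambda>p. x * a p) \<in> B I i j"
proof -
  obtain w where w: "a \<in> graded_piece N F i (j - d)" "w \<in> graded_piece N F (Suc i) (j - d)"
    "\<And>p. a p - boundary F (Suc i) w p \<in> J" using assms(3) by (elim boundariesE) blast
  show ?thesis
  proof (rule boundariesI[of _ _ _ "\<lambda>p. x * w p"])
    fix p show "x * a p - boundary F (Suc i) (\<lambda>p. x * w p) p \<in> I"
      using assms(4)[OF w(3)[of p]] by (simp only: boundary_mult) (simp add: right_diff_distrib)
  qed (intro graded_piece_mult[OF x] w)+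
qed

text \<open>Injectivity of multiplication by \<open>x\<close> from \<open>A/J\<close> to
  \<open>A/I\<close>, applied to each coordinate of the boundary.\<close>

lemma colon_cycles:
  assumes "colon_step N I J x d I'" "a \<in> graded_piece N F i (j - d)"
    and "\<And>q. x * boundary F i a q \<in> I"
  shows "a \<in> Z J i (j - d)"
proof (rule cyclesI[OF assms(2)])
  fix q
  have "boundary F i a q \<in> poly_ring N"
  proof (cases i)
    case (Suc n)
    then show ?thesis
      using free_module_poly_ring boundary_in_free_module graded_piece_free_module assms(2) by blast
  qed simp
  then show "boundary F i a q \<in> J" using assms(1,3) unfolding colon_step_def by blast
qed

text \<open>Exactness of A/J(-d) -> A/I -> A/I' in the middle, applied to each coordinate with its
  own shift.\<close>

lemma graded_piece_decompose:
  assumes cs: "colon_step N I J x d I'" and v: "v \<in> graded_piece N F i j" "\<And>p. v p \<in> I'"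
  obtains a where "a \<in> graded_piece N F i (j - d)" "\<And>p. v p - x * a p \<in> I"
proof -
  have "\<exists>b. b \<in> poly_ring N \<and> homogeneous (j - d - shift F i p) b \<and> v p - x * b \<in> I"
    if "p < rank F i" for p
  proof -
    have "homogeneous (j - shift F i p) (v p)" using v(1) that by (simp add: graded_piece_def)
    then obtain b where "b \<in> poly_ring N" "homogeneous (j - shift F i p - d) b" "v p - x * b \<in> I"
      using cs v(2)[of p] unfolding colon_step_def by metis
    moreover have "j - shift F i p - d = j - d - shift F i p" by simp
    ultimately show ?thesis by metis
  qed
  then obtain b where b: "b p \<in> poly_ring N" "homogeneous (j - d - shift F i p) (b p)" "v p - x * b p \<in> I"
    if "p < rank F i" for p by metis
  define a where "a p = (if p < rank F i then b p else 0)" for p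
  have "a \<in> graded_piece N F i (j - d)"
    using b by (auto simp: a_def graded_piece_def free_module_def)
  moreover have "v p - x * a p \<in> I" for p
  proof (cases "p < rank F i")
    case False
    then have "v p = 0" using v(1) by (simp add: graded_piece_def free_module_def)
    then show ?thesis using False cs ring_ideal_0[of N I] by (simp add: a_def colon_step_def)
  qed (simp add: a_def b)
  ultimately show thesis by (rule that)
qed

definition betti :: "'k mpoly set \<Rightarrow> nat \<Rightarrow> int \<Rightarrow> nat" where
  "betti I i j = vs.dim (Z I i j) - vs.dim (B I i j)"

text \<open>Vanishing of the truncated difference says that the cycles have no larger dimension than
  the boundaries they contain. Equality of the two sets is the form in which the vanishing of
  \<open>Tor\<close> enters diagram chases.\<close>

lemma betti_eq_0D:
  assumes I: "ring_ideal N I" and "betti I i j = 0"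
  shows "Z I i j = B I i j"
proof -
  obtain S where S: "finite S" "graded_piece N F i j \<subseteq> vs.span S"
    using graded_piece_finite_span by blast
  show ?thesis
  proof (rule vs.subset_of_dim_le[OF subspace_boundaries[OF I] boundaries_subset_cycles[OF I] S(1)])
    show "Z I i j \<subseteq> vs.span S" using S(2) by (auto simp: tor_cycles_def)
    show "vs.dim (Z I i j) \<le> vs.dim (B I i j)" using assms(2) by (simp add: betti_def)
  qed
qed

section \<open>The long exact sequence of Tor along a colon step\<close>

context
  fixes I J I' :: "'k mpoly set" and x :: "'k mpoly" and d :: int
  assumes cs: "colon_step N I J x d I'"
    and disj: "\<And>i j. betti J i (j - d) = 0 \<or> betti I i j = 0"
begin

lemma ideals: "ring_ideal N I" "ring_ideal N J" "ring_ideal N I'"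
  and x: "x \<in> poly_ring N" "homogeneous d x" "x \<in> I'"
  and sub: "p \<in> I \<Longrightarrow> p \<in> I'"
  and colon: "b \<in> poly_ring N \<Longrightarrow> x * b \<in> I \<longleftrightarrow> b \<in> J"
  using cs by (auto simp: colon_step_def)

lemma colonJ: "b \<in> J \<Longrightarrow> x * b \<in> I"
  by (rule colon[THEN iffD2, OF ring_ideal_subset[OF ideals(2)]])

text \<open>The map from \<open>Tor\<close> of \<open>A/J(-d)\<close> to \<open>Tor\<close> of
  \<open>A/I\<close> is multiplication by \<open>x\<close>. By \<open>disj\<close> its source or its
  target is zero in each bidegree, so the multiple of a cycle always bounds.\<close>

lemma multiple_cycle_is_boundary:
  assumes "a \<in> Z J i (j - d)"
  shows "(\<lambda>p. x * a p) \<in> B I i j"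
proof (cases "betti J i (j - d) = 0")
  case True
  then have "a \<in> B J i (j - d)" using betti_eq_0D[OF ideals(2) True] assms by simp
  then show ?thesis by (rule boundaries_multiple[OF x(1,2) _ colonJ])
next
  case False
  then have "Z I i j = B I i j" using disj[of i j] by (intro betti_eq_0D[OF ideals(1)]) simp
  moreover have "(\<lambda>p. x * a p) \<in> Z I i j"
  proof (rule cyclesI)
    fix q show "boundary F i (\<lambda>p. x * a p) q \<in> I"
      using colonJ[OF cyclesD(2)[OF assms]] by (simp only: boundary_mult)
  qed (rule graded_piece_mult[OF x(1,2) cyclesD(1)[OF assms]])
  ultimately show ?thesis by simp
qed

lemma cycles_mono: "Z I i j \<subseteq> Z I' i j"
  by (auto simp: tor_cycles_def sub)

lemma boundaries_mono: "B I i j \<subseteq> B I' i j"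
  by (auto simp: tor_boundaries_def intro: sub)

text \<open>Injectivity of \<open>Tor\<close> of \<open>A/I\<close> into \<open>Tor\<close> of
  \<open>A/I'\<close>: if \<open>v\<close> bounds modulo \<open>I'\<close>, the error is
  \<open>x * a\<close> modulo \<open>I\<close>; as \<open>v\<close> is a cycle, \<open>a\<close> is
  a cycle modulo \<open>J\<close>, so the error itself bounds modulo \<open>I\<close>.\<close>

lemma cycles_Int_boundaries: "Z I i j \<inter> B I' i j = B I i j"
proof
  show "B I i j \<subseteq> Z I i j \<inter> B I' i j"
    using boundaries_subset_cycles[OF ideals(1)] boundaries_mono by blast
  show "Z I i j \<inter> B I' i j \<subseteq> B I i j"
  proof
    fix v assume v: "v \<in> Z I i j \<inter> B I' i j"
    then obtain w where w: "v \<in> graded_piece N F i j" "w \<in> graded_piece N F (Suc i) j"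
      "\<And>p. v p - boundary F (Suc i) w p \<in> I'" by (auto elim: boundariesE)
    let ?u = "v - boundary F (Suc i) w"
    have "?u \<in> graded_piece N F i j" using w by (intro graded_piece_diff boundary_in_graded_piece)
    moreover have "?u p \<in> I'" for p using w(3)[of p] by simp
    ultimately obtain a where a: "a \<in> graded_piece N F i (j - d)" "\<And>p. ?u p - x * a p \<in> I"
      by (rule graded_piece_decompose[OF cs]) blast
    let ?xa = "\<lambda>p. x * a p"
    have "x * boundary F i a q \<in> I" for q
    proof -
      have bu: "boundary F i ?u = boundary F i v"
        using boundary_boundary[OF graded_piece_free_module[OF w(2)]] by (simp add: boundary_diff)
      have "boundary F i ((?u - ?xa)) q \<in> I"
        by (rule boundary_ideal[OF ideals(1)]) (use a(2) in simp)
      then have "boundary F i v q - x * boundary F i a q \<in> I"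
        by (simp only: boundary_diff[of F i ?u] bu boundary_mult) (simp only: minus_apply)
      then show ?thesis
        using ring_ideal_diff[OF ideals(1), of "boundary F i v q" "boundary F i v q - x * boundary F i a q"]
          cyclesD(2)[of v I i j q] v by simp
    qed
    then have "a \<in> Z J i (j - d)" by (rule colon_cycles[OF cs a(1)])
    then have "?xa \<in> B I i j" by (rule multiple_cycle_is_boundary)
    then obtain w' where w': "w' \<in> graded_piece N F (Suc i) j" "\<And>p. ?xa p - boundary F (Suc i) w' p \<in> I"
      by (elim boundariesE) blast
    show "v \<in> B I i j"
    proof (rule boundariesI[OF w(1) graded_piece_add[OF w(2) w'(1)]])
      fix p
      have "(?u p - x * a p) + (x * a p - boundary F (Suc i) w' p) \<in> I"
        by (rule ring_ideal_add[OF ideals(1) a(2) w'(2)])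
      then show "v p - boundary F (Suc i) (w + w') p \<in> I"
        by (simp only: boundary_add plus_fun_apply minus_apply) (simp add: algebra_simps)
    qed
  qed
qed

text \<open>The cycles modulo \<open>I'\<close> whose class comes from \<open>Tor\<close> of
  \<open>A/I\<close>.\<close>

definition middle :: "nat \<Rightarrow> int \<Rightarrow> (nat \<Rightarrow> 'k mpoly) set" where
  "middle i j = {z + b | z b. z \<in> Z I i j \<and> b \<in> B I' i j}"

lemma subspace_middle: "vs.subspace (middle i j)"
  unfolding middle_def by (intro vs.subspace_sums subspace_cycles subspace_boundaries ideals)

lemma middle_bounds: "B I' i j \<subseteq> middle i j" "Z I i j \<subseteq> middle i j" "middle i j \<subseteq> Z I' i j"
proof -
  have "0 \<in> Z I i j" "0 \<in> B I' i j"
    using vs.subspace_0 subspace_cycles[OF ideals(1)] subspace_boundaries[OF ideals(3)] by blast+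
  then show "B I' i j \<subseteq> middle i j" "Z I i j \<subseteq> middle i j"
    unfolding middle_def by (metis (mono_tags, lifting) add_0_left add_0_right mem_Collect_eq subsetI)+
  show "middle i j \<subseteq> Z I' i j"
    unfolding middle_def using cycles_mono boundaries_subset_cycles[OF ideals(3)]
      vs.subspace_add[OF subspace_cycles[OF ideals(3)]] by blast
qed

text \<open>Second isomorphism theorem: (Z + B')/B' is Z/(Z \<inter> B'), and the intersection
  consists of the boundaries modulo \<open>I\<close>. Congruence modulo \<open>B I' i j\<close> is
  the linear relation.\<close>

lemma dim_middle_boundaries: "vs.dim (middle i j) - vs.dim (B I' i j) = betti I i j"
proof -
  obtain S where S: "finite S" "graded_piece N F i j \<subseteq> vs.span S"
    using graded_piece_finite_span by blast
  have Zg: "Z H i j \<subseteq> vs.span S" for H using S(2) by (auto simp: tor_cycles_def)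
  have B': "vs.subspace (B I' i j)" by (rule subspace_boundaries[OF ideals(3)])
  show ?thesis
    unfolding betti_def
  proof (rule vs.dim_quotient_eq_of_relation[of _ _ S _ _ S "\<lambda>v z. v - z \<in> B I' i j"])
    show "\<exists>z\<in>Z I i j. v - z \<in> B I' i j" if "v \<in> middle i j" for v
      using that unfolding middle_def by force
    show "\<exists>v\<in>middle i j. v - z \<in> B I' i j" if "z \<in> Z I i j" for z
      using that middle_bounds(2) vs.subspace_0[OF B'] by (intro bexI[of _ z]) auto
    show "v \<in> B I' i j \<longleftrightarrow> z \<in> B I i j" if "v \<in> middle i j" "z \<in> Z I i j" "v - z \<in> B I' i j" for v z
    proof -
      have "v \<in> B I' i j \<longleftrightarrow> z \<in> B I' i j"
        using vs.subspace_diff[OF B' _ that(3), of v] vs.subspace_add[OF B' _ that(3), of z] by auto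
      then show ?thesis using that(2) cycles_Int_boundaries by blast
    qed
    show "x + x' - (y + y') \<in> B I' i j" if "x - y \<in> B I' i j" "x' - y' \<in> B I' i j" for x y x' y'
      using vs.subspace_add[OF B' that] by (simp add: algebra_simps)
    show "scale c x - scale c y \<in> B I' i j" if "x - y \<in> B I' i j" for c x y
      using vs.subspace_scale[OF B' that, of c] by (simp add: vs.scale_right_diff_distrib)
    show "finite S" "finite S" by fact+
    show "middle i j \<subseteq> vs.span S" using middle_bounds(3) Zg by blast
    show "0 - 0 \<in> B I' i j" using vs.subspace_0[OF B'] by simp
  qed (intro Zg middle_bounds(1) subspace_middle subspace_cycles subspace_boundaries boundaries_subset_cycles ideals)+
qed

text \<open>The relation \<open>?P\<close> is the connecting homomorphism: the boundary of a cycle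
  modulo \<open>I'\<close> equals \<open>x * a\<close> modulo \<open>I\<close>, and its class is
  that of \<open>a\<close>. It is onto because multiplication by \<open>x\<close> is zero on
  \<open>Tor\<close>, and its kernel is the image of \<open>Tor\<close> of
  \<open>A/I\<close>.\<close>

lemma dim_cycles_middle:
  "vs.dim (Z I' (Suc i) j) - vs.dim (middle (Suc i) j) = betti J i (j - d)"
proof -
  obtain S where S: "finite S" "graded_piece N F (Suc i) j \<subseteq> vs.span S"
    using graded_piece_finite_span by blast
  obtain S' where S': "finite S'" "graded_piece N F i (j - d) \<subseteq> vs.span S'"
    using graded_piece_finite_span by blast
  have Zg: "Z H i j \<subseteq> graded_piece N F i j" for H i j by (auto simp: tor_cycles_def)
  let ?P = "\<lambda>v a. \<forall>q. boundary F (Suc i) v q - x * a q \<in> I"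
  show ?thesis
    unfolding betti_def
  proof (rule vs.dim_quotient_eq_of_relation[of _ _ S _ _ S' ?P])
    show "\<exists>a\<in>Z J i (j - d). ?P v a" if v: "v \<in> Z I' (Suc i) j" for v
    proof -
      have "boundary F (Suc i) v \<in> graded_piece N F i j"
        using v cyclesD boundary_in_graded_piece by blast
      then obtain a where a: "a \<in> graded_piece N F i (j - d)" "\<And>q. boundary F (Suc i) v q - x * a q \<in> I"
        using cyclesD(2)[OF v] by (rule graded_piece_decompose[OF cs]) blast
      have "x * boundary F i a q \<in> I" for q
      proof -
        have "boundary F i (boundary F (Suc i) v - (\<lambda>q. x * a q)) q \<in> I"
          by (rule boundary_ideal[OF ideals(1)]) (use a(2) in \<open>simp only: minus_apply\<close>)
        moreover have "boundary F i (boundary F (Suc i) v) = 0"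
          using v cyclesD graded_piece_free_module boundary_boundary by blast
        ultimately have "- (x * boundary F i a q) \<in> I"
          by (simp only: boundary_diff boundary_mult) (simp add: minus_apply)
        then show ?thesis using ring_ideal_uminus[OF ideals(1)] by fastforce
      qed
      then have "a \<in> Z J i (j - d)" by (rule colon_cycles[OF cs a(1)])
      then show ?thesis using a(2) by blast
    qed
    \<comment> \<open>As \<open>x * a\<close> bounds modulo \<open>I\<close>, some \<open>w\<close>
      has it as boundary there; since \<open>x\<close> lies in \<open>I'\<close>, this
      \<open>w\<close> is a cycle modulo \<open>I'\<close>.\<close>
    show "\<exists>v\<in>Z I' (Suc i) j. ?P v a" if a: "a \<in> Z J i (j - d)" for a
    proof -
      obtain w where w: "w \<in> graded_piece N F (Suc i) j" "\<And>p. x * a p - boundary F (Suc i) w p \<in> I"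
        using multiple_cycle_is_boundary[OF a] by (elim boundariesE) blast
      have P: "?P w a"
        using ring_ideal_uminus[OF ideals(1) w(2)] by simp
      moreover have "boundary F (Suc i) w q \<in> I'" for q
      proof -
        have "a q \<in> poly_ring N"
          using a cyclesD graded_piece_free_module free_module_poly_ring by blast
        then have "a q * x \<in> I'" by (rule ring_ideal_mult[OF ideals(3) _ x(3)])
        then have "(boundary F (Suc i) w q - x * a q) + a q * x \<in> I'"
          using P sub ring_ideal_add[OF ideals(3)] by blast
        then show ?thesis by (simp add: mult.commute)
      qed
      then have "w \<in> Z I' (Suc i) j" by (rule cyclesI[OF w(1)])
      ultimately show ?thesis by blast
    qed
    show "v \<in> middle (Suc i) j \<longleftrightarrow> a \<in> B J i (j - d)"
      if v: "v \<in> Z I' (Suc i) j" and a: "a \<in> Z J i (j - d)" and P: "?P v a" for v a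
    proof
      assume "a \<in> B J i (j - d)"
      then obtain b where b: "b \<in> graded_piece N F (Suc i) (j - d)" "\<And>p. a p - boundary F (Suc i) b p \<in> J"
        by (elim boundariesE) blast
      let ?xb = "\<lambda>p. x * b p"
      have xb: "?xb \<in> graded_piece N F (Suc i) j" using b(1) x by (intro graded_piece_mult)
      have "v - ?xb \<in> Z I (Suc i) j"
      proof (rule cyclesI)
        show "v - ?xb \<in> graded_piece N F (Suc i) j" using v xb cyclesD by (intro graded_piece_diff)
        fix q
        have "(boundary F (Suc i) v q - x * a q) + x * (a q - boundary F (Suc i) b q) \<in> I"
          using P b(2) colonJ by (intro ring_ideal_add[OF ideals(1)]) auto
        then show "boundary F (Suc i) (v - ?xb) q \<in> I"
          by (simp add: boundary_diff boundary_mult algebra_simps)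
      qed
      \<comment> \<open>The entries of \<open>x * b\<close> lie in \<open>I'\<close>, so it vanishes
        in the tensor product with \<open>A/I'\<close> and bounds with witness 0.\<close>
      moreover have "?xb \<in> B I' (Suc i) j"
      proof (rule boundariesI[OF xb graded_piece_0])
        fix p
        have "b p \<in> poly_ring N" using b(1) graded_piece_free_module free_module_poly_ring by blast
        then have "b p * x \<in> I'" by (rule ring_ideal_mult[OF ideals(3) _ x(3)])
        then show "x * b p - boundary F (Suc (Suc i)) 0 p \<in> I'"
          by (simp only: boundary_zero) (simp add: mult.commute)
      qed
      ultimately have "(v - ?xb) + ?xb \<in> middle (Suc i) j" unfolding middle_def by blast
      then show "v \<in> middle (Suc i) j" by simp
    next
      assume "v \<in> middle (Suc i) j"
      then obtain z b where zb: "v = z + b" "z \<in> Z I (Suc i) j" "b \<in> B I' (Suc i) j"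
        unfolding middle_def by blast
      obtain w where w: "b \<in> graded_piece N F (Suc i) j" "w \<in> graded_piece N F (Suc (Suc i)) j"
        "\<And>p. b p - boundary F (Suc (Suc i)) w p \<in> I'" using zb(3) by (elim boundariesE) blast
      \<comment> \<open>Subtracting a boundary from \<open>b\<close> moves its entries into
        \<open>I'\<close> without changing \<open>boundary F (Suc i) b\<close>; dividing by
        \<open>x\<close> modulo \<open>I\<close> gives the \<open>c\<close> whose boundary is
        \<open>a\<close> modulo \<open>J\<close>.\<close>
      let ?u = "b - boundary F (Suc (Suc i)) w"
      have "?u \<in> graded_piece N F (Suc i) j" using w by (intro graded_piece_diff boundary_in_graded_piece)
      moreover have "?u p \<in> I'" for p using w(3)[of p] by (simp only: minus_apply)
      ultimately obtain c where c: "c \<in> graded_piece N F (Suc i) (j - d)" "\<And>p. ?u p - x * c p \<in> I"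
        by (rule graded_piece_decompose[OF cs]) blast
      show "a \<in> B J i (j - d)"
      proof (rule boundariesI[OF _ c(1)])
        show ag: "a \<in> graded_piece N F i (j - d)" using a cyclesD by blast
        fix q
        have bu: "boundary F (Suc i) ?u = boundary F (Suc i) b"
          using boundary_boundary[OF graded_piece_free_module[OF w(2)]] by (simp only: boundary_diff) simp
        have "boundary F (Suc i) (?u - (\<lambda>p. x * c p)) q \<in> I"
          by (rule boundary_ideal[OF ideals(1)]) (use c(2) in \<open>simp only: minus_apply\<close>)
        then have 1: "boundary F (Suc i) b q - x * boundary F (Suc i) c q \<in> I"
          by (simp only: boundary_diff[of F "Suc i" ?u] bu boundary_mult) (simp only: minus_apply)
        have 2: "boundary F (Suc i) z q \<in> I" by (rule cyclesD(2)[OF zb(2)])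
        have 3: "boundary F (Suc i) z q + boundary F (Suc i) b q - x * a q \<in> I"
          using P unfolding zb(1) boundary_add plus_fun_apply by blast
        have "x * (a q - boundary F (Suc i) c q) =
            boundary F (Suc i) z q + (boundary F (Suc i) b q - x * boundary F (Suc i) c q)
            - (boundary F (Suc i) z q + boundary F (Suc i) b q - x * a q)"
          by (simp only: right_diff_distrib) (simp only: algebra_simps)
        also have "\<dots> \<in> I"
          by (rule ring_ideal_diff[OF ideals(1) ring_ideal_add[OF ideals(1) 2 1] 3])
        finally have "x * (a q - boundary F (Suc i) c q) \<in> I" .
        moreover have "a q - boundary F (Suc i) c q \<in> poly_ring N"
          using ag c(1) boundary_in_graded_piece
          by (intro poly_ring_diff free_module_poly_ring graded_piece_free_module)
        ultimately show "a q - boundary F (Suc i) c q \<in> J" using colon by blast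
      qed
    qed
    show "?P 0 0" by (simp only: boundary_zero) (simp add: ring_ideal_0[OF ideals(1)])
    show "?P (v + v') (a + a')" if "?P v a" "?P v' a'" for v a v' a'
    proof
      fix q
      have "(boundary F (Suc i) v q - x * a q) + (boundary F (Suc i) v' q - x * a' q) \<in> I"
        using that by (intro ring_ideal_add[OF ideals(1)]) blast+
      then show "boundary F (Suc i) (v + v') q - x * (a + a') q \<in> I"
        by (simp only: boundary_add plus_fun_apply) (simp only: algebra_simps)
    qed
    show "?P (scale c v) (scale c a)" if "?P v a" for c v a
    proof
      fix q
      have "const c * (boundary F (Suc i) v q - x * a q) \<in> I"
        using that by (intro ring_ideal_mult[OF ideals(1)]) auto
      then show "boundary F (Suc i) (scale c v) q - x * scale c a q \<in> I"
        by (simp only: boundary_scale) (simp only: scale_def algebra_simps)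
    qed
    show "finite S" "finite S'" by fact+
    show "Z I' (Suc i) j \<subseteq> vs.span S" "Z J i (j - d) \<subseteq> vs.span S'" using S(2) S'(2) Zg by blast+
    show "middle (Suc i) j \<subseteq> Z I' (Suc i) j" by (rule middle_bounds(3))
  qed (intro subspace_middle subspace_cycles subspace_boundaries boundaries_subset_cycles ideals)+
qed

text \<open>The long exact sequence falls apart into short ones, from \<open>Tor\<close> of
  \<open>A/I\<close> in homological degree \<open>Suc i\<close> through \<open>Tor\<close> of
  \<open>A/I'\<close> to \<open>Tor\<close> of \<open>A/J(-d)\<close> in degree \<open>i\<close>;
  \<open>middle\<close> splits the dimension count into the two ends.\<close>

lemma betti_colon_step:
  shows betti_colon_step_0: "betti I' 0 j = betti I 0 j"
    and betti_colon_step_Suc: "betti I' (Suc i) j = betti I (Suc i) j + betti J i (j - d)"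
proof -
  \<comment> \<open>These inequalities allow the truncated differences to be added.\<close>
  have mono: "vs.dim (B I' i j) \<le> vs.dim (middle i j)" "vs.dim (middle i j) \<le> vs.dim (Z I' i j)" for i
  proof -
    obtain S where S: "finite S" "graded_piece N F i j \<subseteq> vs.span S"
      using graded_piece_finite_span by blast
    have "Z I' i j \<subseteq> vs.span S" using S(2) by (auto simp: tor_cycles_def)
    then show "vs.dim (B I' i j) \<le> vs.dim (middle i j)" "vs.dim (middle i j) \<le> vs.dim (Z I' i j)"
      using middle_bounds[of i j] vs.dim_le_of_subset[OF _ S(1)] by (meson order_trans)+
  qed
  \<comment> \<open>In homological degree 0 every vector is a cycle for either ideal, so there is no
    room for a connecting map.\<close>
  have "middle 0 j = Z I' 0 j"
  proof
    have "Z I' 0 j = Z I 0 j" by (simp add: tor_cycles_def ring_ideal_0[OF ideals(1)] ring_ideal_0[OF ideals(3)])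
    then show "Z I' 0 j \<subseteq> middle 0 j" using middle_bounds by blast
  qed (rule middle_bounds)
  then show "betti I' 0 j = betti I 0 j"
    using dim_middle_boundaries[of 0 j] by (simp add: betti_def)
  show "betti I' (Suc i) j = betti I (Suc i) j + betti J i (j - d)"
    using dim_middle_boundaries[of "Suc i" j] dim_cycles_middle[of i j] mono[of "Suc i"]
    by (simp add: betti_def)
qed

end

end

section \<open>Resolutions of ideals generated by variables\<close>

lemma sum_lessThan_add: "(\<Sum>p<a + b. f p) = (\<Sum>p<a. f p) + (\<Sum>p<b. f (p + a))" for a b :: nat
  by (induction b) (auto simp: add_ac)

lemma augmentation_diff: "augmentation F (v - w) = augmentation F v - augmentation F w"
  by (simp add: augmentation_def right_diff_distrib sum_subtractf)

lemma augmentation_add: "augmentation F (v + w) = augmentation F v + augmentation F w"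
  by (simp add: augmentation_def distrib_left sum.distrib)

lemma augmentation_mult: "augmentation F (\<lambda>p. a * v p) = a * augmentation F v"
  by (simp add: augmentation_def sum_distrib_left mult.left_commute)

context free_resolution
begin

lemma aug: "p < rank F 0 \<Longrightarrow> aug F p \<in> poly_ring N" "p < rank F 0 \<Longrightarrow> homogeneous (shift F 0 p) (aug F p)"
  using res by (auto simp: graded_free_resolution_def)

lemma augmentation_surj: "a \<in> poly_ring N \<Longrightarrow> \<exists>v\<in>free_module N F 0. a - augmentation F v \<in> M"
  using res by (simp add: graded_free_resolution_def)

lemma exact_0: "{v \<in> free_module N F 0. augmentation F v \<in> M} = boundary F 1 ` free_module N F 1"
  using res by (simp add: graded_free_resolution_def)

lemma exact_Suc: "{v \<in> free_module N F (Suc n). boundary F (Suc n) v = 0} =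
    boundary F (Suc (Suc n)) ` free_module N F (Suc (Suc n))"
  using res by (simp only: graded_free_resolution_def)

lemma augmentation_poly_ring: "v \<in> free_module N F 0 \<Longrightarrow> augmentation F v \<in> poly_ring N"
  unfolding augmentation_def by (auto intro!: poly_ring_sum poly_ring_mult aug intro: free_module_poly_ring[of v N F 0])

text \<open>The degree \<open>j\<close> part of a vector. Exactness of a resolution is stated for
  ungraded modules; as this projection commutes with the maps, preimages of homogeneous vectors can
  be made homogeneous.\<close>

definition hcomps :: "nat \<Rightarrow> int \<Rightarrow> (nat \<Rightarrow> 'k mpoly) \<Rightarrow> nat \<Rightarrow> 'k mpoly" where
  "hcomps i j v = (\<lambda>p. hcomp (j - shift F i p) (v p))"

lemma hcomps_graded_piece: "v \<in> free_module N F i \<Longrightarrow> hcomps i j v \<in> graded_piece N F i j"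
  by (auto simp: graded_piece_def free_module_def hcomps_def homogeneous_hcomp poly_ring_hcomp)

lemma hcomps_eq: "v \<in> graded_piece N F i j \<Longrightarrow> hcomps i j v = v"
proof
  fix p assume "v \<in> graded_piece N F i j"
  then show "hcomps i j v p = v p"
    by (cases "p < rank F i") (auto simp: graded_piece_def free_module_def hcomps_def hcomp_homogeneous)
qed

lemma boundary_hcomps:
  shows "boundary F (Suc i) (hcomps (Suc i) j v) = hcomps i j (boundary F (Suc i) v)"
proof
  fix q
  have "dmat F i q p * hcomp (j - shift F (Suc i) p) (v p) = hcomp (j - shift F i q) (dmat F i q p * v p)"
    if "q < rank F i" "p < rank F (Suc i)" for p
    using hcomp_mult[OF dmat(2)[OF that], of "j - shift F i q"] by (simp add: algebra_simps)
  then show "boundary F (Suc i) (hcomps (Suc i) j v) q = hcomps i j (boundary F (Suc i) v) q"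
    by (simp add: hcomps_def boundary.simps hcomp_sum)
qed

lemma augmentation_hcomps: "augmentation F (hcomps 0 j v) = hcomp j (augmentation F v)"
proof -
  have "aug F p * hcomp (j - shift F 0 p) (v p) = hcomp j (aug F p * v p)" if "p < rank F 0" for p
    using hcomp_mult[OF aug(2)[OF that], of j] by simp
  then show ?thesis by (simp add: hcomps_def augmentation_def hcomp_sum)
qed

end


section \<open>The mapping cone\<close>

text \<open>The mapping cone of multiplication by \<open>x\<close> on \<open>F\<close>: in degree
  \<open>n\<close> it is the sum of \<open>F n\<close> and a copy of \<open>F (n - 1)\<close>
  shifted by \<open>d\<close>, with differential (u, w) \<mapsto> (\<partial>u + x w, - \<partial>w)
  and the coordinates of \<open>F n\<close> in front. In degree 0 the second summand is empty, so
  within the ranks \<open>n - 1\<close> is read only for \<open>n > 0\<close>.\<close>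

definition cone :: "'k::field mpoly \<Rightarrow> int \<Rightarrow> 'k free_complex \<Rightarrow> 'k free_complex" where
  "cone x d F = \<lparr>
     rank = (\<lambda>n. rank F n + (case n of 0 \<Rightarrow> 0 | Suc m \<Rightarrow> rank F m)),
     shift = (\<lambda>n p. if p < rank F n then shift F n p else shift F (n - 1) (p - rank F n) + d),
     dmat = (\<lambda>n q p.
       if p < rank F (Suc n) then if q < rank F n then dmat F n q p else 0
       else if q < rank F n then if q = p - rank F (Suc n) then x else 0
       else - dmat F (n - 1) (q - rank F n) (p - rank F (Suc n))),
     aug = aug F\<rparr>"

text \<open>Direct sums are concatenations of coordinates. Entries of \<open>u\<close> from
  \<open>r\<close> on are ignored, so \<open>u\<close> is recovered only if it lies in a module of
  rank \<open>r\<close>.\<close>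

definition join :: "nat \<Rightarrow> (nat \<Rightarrow> 'a) \<Rightarrow> (nat \<Rightarrow> 'a) \<Rightarrow> nat \<Rightarrow> 'a" where
  "join r u w = (\<lambda>p. if p < r then u p else w (p - r))"

lemma free_module_cone_0: "free_module N (cone x d F) 0 = free_module N F 0"
  by (simp add: free_module_def cone_def)

lemma free_module_cone_Suc:
  "free_module N (cone x d F) (Suc n) =
    {join (rank F (Suc n)) u w | u w. u \<in> free_module N F (Suc n) \<and> w \<in> free_module N F n}"
    (is "?L = ?R")
proof
  show "?R \<subseteq> ?L"
    by (auto simp: free_module_def cone_def join_def)
  show "?L \<subseteq> ?R"
  proof
    fix v assume v: "v \<in> ?L"
    let ?r = "rank F (Suc n)"
    have "v = join ?r (\<lambda>p. if p < ?r then v p else 0) (\<lambda>p. v (p + ?r))"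
      by (auto simp: join_def)
    moreover have "(\<lambda>p. if p < ?r then v p else 0) \<in> free_module N F (Suc n)"
      "(\<lambda>p. v (p + ?r)) \<in> free_module N F n"
      using v by (auto simp: free_module_def cone_def)
    ultimately show "v \<in> ?R" by blast
  qed
qed

lemma join_eq_iff:
  assumes "u \<in> free_module N F n" "u' \<in> free_module N F n"
  shows "join (rank F n) u w = join (rank F n) u' w' \<longleftrightarrow> u = u' \<and> w = w'"
proof
  assume eq: "join (rank F n) u w = join (rank F n) u' w'"
  have "u p = u' p" for p
    using fun_cong[OF eq, of p] assms by (cases "p < rank F n") (auto simp: join_def free_module_def)
  moreover have "w p = w' p" for p
    using fun_cong[OF eq, of "p + rank F n"] by (simp add: join_def)
  ultimately show "u = u' \<and> w = w'" by auto
qed simp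

lemma join_0: "join r 0 0 = 0"
  by (auto simp: join_def)

lemma boundary_cone:
  assumes "w \<in> free_module N F n"
  shows "boundary (cone x d F) (Suc n) (join (rank F (Suc n)) u w) =
    join (rank F n) (boundary F (Suc n) u + (\<lambda>p. x * w p)) (- boundary F n w)"
proof
  fix q
  let ?r = "rank F (Suc n)"
  have r: "rank (cone x d F) (Suc n) = ?r + rank F n" by (simp add: cone_def)
  have split: "(\<Sum>p < ?r + rank F n. dmat (cone x d F) n q p * join ?r u w p) =
      (\<Sum>p < ?r. dmat (cone x d F) n q p * u p) + (\<Sum>p < rank F n. dmat (cone x d F) n q (p + ?r) * w p)"
    unfolding sum_lessThan_add by (simp add: join_def)
  show "boundary (cone x d F) (Suc n) (join ?r u w) q =
    join (rank F n) (boundary F (Suc n) u + (\<lambda>p. x * w p)) (- boundary F n w) q"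
  proof (cases "q < rank F n")
    case True
    have "(\<Sum>p < rank F n. dmat (cone x d F) n q (p + ?r) * w p) = (\<Sum>p < rank F n. if q = p then x * w p else 0)"
      by (intro sum.cong) (auto simp: cone_def True)
    also have "\<dots> = x * w q" using True by simp
    finally have "(\<Sum>p < rank F n. dmat (cone x d F) n q (p + ?r) * w p) = x * w q" .
    moreover have "(\<Sum>p < ?r. dmat (cone x d F) n q p * u p) = (\<Sum>p < ?r. dmat F n q p * u p)"
      by (intro sum.cong) (auto simp: cone_def True)
    moreover have "q < rank (cone x d F) n" using True by (simp add: cone_def)
    ultimately show ?thesis unfolding boundary.simps r split using True by (simp add: join_def boundary.simps)
  next
    case False
    have 1: "(\<Sum>p < ?r. dmat (cone x d F) n q p * u p) = 0"
      by (intro sum.neutral) (auto simp: cone_def False)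
    have 2: "(\<Sum>p < rank F n. dmat (cone x d F) n q (p + ?r) * w p) =
        - (\<Sum>p < rank F n. dmat F (n - 1) (q - rank F n) p * w p)"
      unfolding sum_negf[symmetric] by (intro sum.cong) (auto simp: cone_def False)
    show ?thesis
    proof (cases n)
      case 0
      then show ?thesis using False by (simp add: boundary.simps join_def cone_def)
    next
      case (Suc m)
      show ?thesis
        using False unfolding boundary.simps r split 1 2 by (simp add: Suc join_def boundary.simps cone_def)
    qed
  qed
qed

lemma augmentation_cone: "augmentation (cone x d F) = augmentation F"
  by (rule ext) (simp add: augmentation_def cone_def)

text \<open>The colon ideal is \<open>M\<close> itself, so multiplication by \<open>x\<close> is
  injective on \<open>A/M\<close>, with cokernel \<open>A/M'\<close>; the cone of a lift of an
  injection resolves its cokernel.\<close>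

lemma (in free_resolution) free_resolution_cone:
  assumes cs: "colon_step N M M x d M'"
  shows "graded_free_resolution N M' (cone x d F)"
proof -
  have M: "ring_ideal N M" "ring_ideal N M'" and x: "x \<in> poly_ring N" "homogeneous d x" "x \<in> M'"
    and sub: "\<And>p. p \<in> M \<Longrightarrow> p \<in> M'" and colon: "\<And>b. b \<in> poly_ring N \<Longrightarrow> x * b \<in> M \<longleftrightarrow> b \<in> M"
    and dec: "\<And>p. p \<in> M' \<Longrightarrow> \<exists>a\<in>poly_ring N. p - x * a \<in> M"
    using cs by (auto simp: colon_step_def)
  let ?C = "cone x d F"
  let ?F = "free_module N F"
  let ?J = "\<lambda>n. join (rank F n)"
  note fm = free_module_add free_module_mult free_module_0 boundary_in_free_module
  have neg: "- v \<in> ?F n" if "v \<in> ?F n" for v n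
    using free_module_diff[OF free_module_0 that] by simp
  have bneg: "boundary F n (- v) = - boundary F n v" for n v
    using boundary_diff[of F n 0 v] by (simp add: boundary_zero)
  have "dmat ?C n q p \<in> poly_ring N \<and> homogeneous (shift ?C (Suc n) p - shift ?C n q) (dmat ?C n q p)"
    if qp: "q < rank ?C n" "p < rank ?C (Suc n)" for n q p
  proof (cases "p < rank F (Suc n)")
    case True
    then show ?thesis using dmat[of q n p] by (auto simp: cone_def)
  next
    case p: False
    show ?thesis
    proof (cases "q < rank F n")
      case True
      then show ?thesis using p x by (auto simp: cone_def)
    next
      case False
      then obtain m where m: "n = Suc m" using qp by (cases n) (auto simp: cone_def)
      have "q - rank F n < rank F m" "p - rank F (Suc n) < rank F (Suc m)"
        using qp False p by (auto simp: cone_def m)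
      from dmat[OF this] show ?thesis
        using False p by (auto simp: cone_def m poly_ring_uminus homogeneous_uminus)
    qed
  qed
  moreover have "aug ?C p \<in> poly_ring N \<and> homogeneous (shift ?C 0 p) (aug ?C p)" if "p < rank ?C 0" for p
    using that aug by (simp add: cone_def)
  moreover have "\<exists>v\<in>free_module N ?C 0. a - augmentation ?C v \<in> M'" if "a \<in> poly_ring N" for a
    using augmentation_surj[OF that] sub unfolding free_module_cone_0 augmentation_cone by blast
  moreover have "{v \<in> free_module N ?C 0. augmentation ?C v \<in> M'} = boundary ?C 1 ` free_module N ?C 1"
  proof -
    have b1: "boundary ?C 1 (?J 1 u w) = boundary F 1 u + (\<lambda>p. x * w p)"
      if "u \<in> ?F 1" "w \<in> ?F 0" for u w
    proof -
      have "boundary F 1 u + (\<lambda>p. x * w p) \<in> ?F 0" using that boundary_in_free_module[of u 0] x(1)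
        by (intro free_module_add free_module_mult) simp_all
      then show ?thesis
        using boundary_cone[OF that(2), of x d u] by (auto simp: join_def free_module_def fun_eq_iff)
    qed
    show ?thesis
      unfolding free_module_cone_0 augmentation_cone
    proof safe
      fix v assume v: "v \<in> ?F 0" "augmentation F v \<in> M'"
      obtain a where a: "a \<in> poly_ring N" "augmentation F v - x * a \<in> M" using dec[OF v(2)] by blast
      obtain w where w: "w \<in> ?F 0" "a - augmentation F w \<in> M" using augmentation_surj[OF a(1)] by blast
      have "(augmentation F v - x * a) + x * (a - augmentation F w) \<in> M"
        by (rule ring_ideal_add[OF M(1) a(2) ring_ideal_mult[OF M(1) x(1) w(2)]])
      then have "augmentation F (v - (\<lambda>p. x * w p)) \<in> M"
        by (simp add: augmentation_diff augmentation_mult algebra_simps)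
      then have "v - (\<lambda>p. x * w p) \<in> boundary F 1 ` ?F 1"
        using exact_0 free_module_diff[OF v(1) free_module_mult[OF x(1) w(1)]] by blast
      then obtain u where u: "u \<in> ?F 1" "v - (\<lambda>p. x * w p) = boundary F 1 u" by blast
      then have "v = boundary F 1 u + (\<lambda>p. x * w p)" by (simp add: algebra_simps flip: u(2))
      then have "v = boundary ?C 1 (?J 1 u w)" using b1[OF u(1) w(1)] by simp
      moreover have "?J 1 u w \<in> free_module N ?C 1"
        using free_module_cone_Suc[of N x d F 0] u w by auto
      ultimately show "v \<in> boundary ?C 1 ` free_module N ?C 1" by blast
    next
      fix v assume "v \<in> free_module N ?C 1"
      then obtain u w where uw: "v = ?J 1 u w" "u \<in> ?F 1" "w \<in> ?F 0"
        using free_module_cone_Suc[of N x d F 0] by auto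
      have bv: "boundary ?C 1 v = boundary F 1 u + (\<lambda>p. x * w p)"
        unfolding uw(1) by (rule b1[OF uw(2,3)])
      have u: "boundary F 1 u \<in> ?F 0" "augmentation F (boundary F 1 u) \<in> M"
        using exact_0 uw(2) by blast+
      show "boundary ?C 1 v \<in> ?F 0"
        unfolding bv by (rule free_module_add[OF u(1) free_module_mult[OF x(1) uw(3)]])
      have "augmentation F w * x \<in> M'"
        by (rule ring_ideal_mult[OF M(2) augmentation_poly_ring[OF uw(3)] x(3)])
      then show "augmentation F (boundary ?C 1 v) \<in> M'"
        using ring_ideal_add[OF M(2) sub[OF u(2)]]
        unfolding bv augmentation_add augmentation_mult by (simp add: mult.commute)
    qed
  qed
  moreover have "{v \<in> free_module N ?C (Suc n). boundary ?C (Suc n) v = 0} =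
      boundary ?C (Suc (Suc n)) ` free_module N ?C (Suc (Suc n))" for n
  proof (intro equalityI subsetI)
    fix v assume "v \<in> {v \<in> free_module N ?C (Suc n). boundary ?C (Suc n) v = 0}"
    then obtain u w where uw: "v = ?J (Suc n) u w" "u \<in> ?F (Suc n)" "w \<in> ?F n"
      and bv: "boundary ?C (Suc n) v = 0" unfolding free_module_cone_Suc by blast
    have xw: "(\<lambda>p. x * w p) \<in> ?F n" by (rule free_module_mult[OF x(1) uw(3)])
    have "?J n (boundary F (Suc n) u + (\<lambda>p. x * w p)) (- boundary F n w) = ?J n 0 0"
      using bv unfolding uw(1) boundary_cone[OF uw(3)] join_0 .
    then have "boundary F (Suc n) u + (\<lambda>p. x * w p) = 0 \<and> - boundary F n w = 0"
      by (subst (asm) join_eq_iff) (auto intro: free_module_add boundary_in_free_module uw xw free_module_0)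
    then have 1: "boundary F (Suc n) u + (\<lambda>p. x * w p) = 0" and 2: "boundary F n w = 0" by auto
    \<comment> \<open>For \<open>n > 0\<close> this is exactness of \<open>F\<close>. For
      \<open>n = 0\<close> the equation on \<open>w\<close> alone is empty, and injectivity of
      \<open>x\<close> on \<open>A/M\<close> makes \<open>w\<close> a boundary.\<close>
    have "w \<in> boundary F (Suc n) ` ?F (Suc n)"
    proof (cases n)
      case 0
      have "augmentation F (boundary F 1 u) \<in> M" using exact_0 uw(2) 0 by auto
      moreover have "boundary F 1 u = - (\<lambda>p. x * w p)" using 1 0 by (simp add: eq_neg_iff_add_eq_0)
      moreover have "augmentation F (- (\<lambda>p. x * w p)) = - (x * augmentation F w)"
        using augmentation_diff[of F 0 "\<lambda>p. x * w p"] by (simp add: augmentation_mult) (simp add: augmentation_def)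
      ultimately have "x * augmentation F w \<in> M" using ring_ideal_uminus[OF M(1)] by fastforce
      then have "augmentation F w \<in> M" using colon augmentation_poly_ring uw(3) 0 by blast
      then show ?thesis using exact_0 uw(3) 0 by auto
    next
      case (Suc m)
      then show ?thesis using exact_Suc[of m] uw(3) 2 by auto
    qed
    then obtain w2 where w2: "w2 \<in> ?F (Suc n)" "w = boundary F (Suc n) w2" by blast
    have "boundary F (Suc n) (u + (\<lambda>p. x * w2 p)) = 0"
      using 1 by (simp add: boundary_add boundary_mult flip: w2(2))
    moreover have "u + (\<lambda>p. x * w2 p) \<in> ?F (Suc n)"
      by (rule free_module_add[OF uw(2) free_module_mult[OF x(1) w2(1)]])
    ultimately obtain u2 where u2: "u2 \<in> ?F (Suc (Suc n))" "u + (\<lambda>p. x * w2 p) = boundary F (Suc (Suc n)) u2"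
      using exact_Suc[of n] by blast
    \<comment> \<open>The preimage uses \<open>- w2\<close>, which offsets the sign in the second
      component of the cone differential.\<close>
    have "boundary F (Suc (Suc n)) u2 + (\<lambda>p. x * (- w2) p) = u"
      by (simp add: fun_eq_iff flip: u2(2))
    then have "boundary ?C (Suc (Suc n)) (?J (Suc (Suc n)) u2 (- w2)) = v"
      unfolding boundary_cone[OF neg[OF w2(1)]] uw(1) bneg w2(2) by simp
    moreover have "?J (Suc (Suc n)) u2 (- w2) \<in> free_module N ?C (Suc (Suc n))"
      unfolding free_module_cone_Suc using u2(1) neg[OF w2(1)] by blast
    ultimately show "v \<in> boundary ?C (Suc (Suc n)) ` free_module N ?C (Suc (Suc n))" by blast
  next
    fix v assume "v \<in> boundary ?C (Suc (Suc n)) ` free_module N ?C (Suc (Suc n))"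
    then obtain u w where uw: "v = boundary ?C (Suc (Suc n)) (?J (Suc (Suc n)) u w)"
      "u \<in> ?F (Suc (Suc n))" "w \<in> ?F (Suc n)" unfolding free_module_cone_Suc by blast
    let ?u = "boundary F (Suc (Suc n)) u + (\<lambda>p. x * w p)" and ?w = "- boundary F (Suc n) w"
    have v: "v = ?J (Suc n) ?u ?w" unfolding uw(1) by (rule boundary_cone[OF uw(3)])
    have w: "?w \<in> ?F n" using neg boundary_in_free_module uw(3) by blast
    have "?u \<in> ?F (Suc n)"
      by (intro free_module_add boundary_in_free_module free_module_mult x uw)
    then have "v \<in> free_module N ?C (Suc n)" unfolding free_module_cone_Suc v using w by blast
    moreover have "boundary F (Suc n) ?u + (\<lambda>p. x * ?w p) = 0"
      using boundary_boundary[OF uw(2)] by (simp add: boundary_add boundary_mult fun_eq_iff)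
    then have "boundary ?C (Suc n) v = 0"
      unfolding v boundary_cone[OF w] using boundary_boundary[OF uw(3)] by (simp add: bneg join_0)
    ultimately show "v \<in> {v \<in> free_module N ?C (Suc n). boundary ?C (Suc n) v = 0}" by blast
  qed
  ultimately show ?thesis unfolding graded_free_resolution_def by blast
qed

text \<open>Starting from \<open>A\<close> in degree 0, which resolves \<open>A/0\<close>, one cone
  per variable produces the Koszul complex.\<close>

lemma free_resolution_linear_ideal:
  assumes "finite S" "S \<subseteq> {1..N}"
  shows "\<exists>F. graded_free_resolution N (linear_ideal N S :: 'k::field mpoly set) F"
  using assms
proof (induction S rule: finite_induct)
  case empty
  define F :: "'k free_complex"
    where "F = \<lparr>rank = (\<lambda>n. if n = 0 then 1 else 0), shift = (\<lambda>_ _. 0), dmat = (\<lambda>_ _ _. 0), aug = (\<lambda>_. 1)\<rparr>"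
  have F: "dmat F n q p = 0" "aug F p = 1" "shift F n p = 0" for n p q by (simp_all add: F_def)
  have b: "boundary F n v = 0" for n v by (cases n) (auto simp: F_def)
  have z: "free_module N F (Suc n) = {0}" for n by (auto simp: F_def free_module_def)
  have a: "augmentation F v = v 0" for v by (simp add: F_def augmentation_def)
  have "\<exists>v\<in>free_module N F 0. a - augmentation F v \<in> {0}" if "a \<in> poly_ring N" for a
  proof (rule bexI[of _ "\<lambda>p. if p = 0 then a else 0"])
    show "(\<lambda>p. if p = 0 then a else 0) \<in> free_module N F 0"
      using that by (auto simp: F_def free_module_def)
  qed (simp add: a)
  moreover have "{v \<in> free_module N F 0. augmentation F v \<in> {0}} = boundary F 1 ` free_module N F 1"
  proof -
    have "v = 0" if "v \<in> free_module N F 0" "v 0 = 0" for v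
    proof
      fix p show "v p = 0 p" using that by (cases "p = 0") (auto simp: F_def free_module_def)
    qed
    moreover have "boundary F 1 ` free_module N F 1 = {0}" unfolding b using z[of 0] by auto
    ultimately show ?thesis by (auto simp: a free_module_0)
  qed
  moreover have "{v \<in> free_module N F (Suc n). boundary F (Suc n) v = 0} =
      boundary F (Suc (Suc n)) ` free_module N F (Suc (Suc n))" for n
    unfolding b z by auto
  ultimately have "graded_free_resolution N {0} F"
    unfolding graded_free_resolution_def using F by simp
  then show ?case unfolding linear_ideal_empty by blast
next
  case (insert i S)
  then obtain F where "graded_free_resolution N (linear_ideal N S :: 'k mpoly set) F" by blast
  then interpret free_resolution N "linear_ideal N S :: 'k mpoly set" F by unfold_locales
  show ?case
    using free_resolution_cone[OF colon_step_linear_ideal] insert by blast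
qed


section \<open>Betti numbers of ideals generated by variables\<close>

text \<open>\<open>F\<close> is an arbitrary resolution of the residue field, so the results apply
  to the one picked by \<open>SOME\<close> in \<open>tor_dim\<close>.\<close>

locale residue_field_resolution = free_resolution N "irrelevant_ideal N" F
  for N :: nat and F :: "'k::field free_complex"
begin

lemma irrelevant_ideal_iff:
  "p \<in> irrelevant_ideal N \<longleftrightarrow> p \<in> poly_ring N \<and> Poly_Mapping.lookup p 0 = 0" for p :: "'k mpoly"
proof -
  have "Poly_Mapping.keys m \<inter> {1..N} \<noteq> {} \<longleftrightarrow> m \<noteq> 0" if "Poly_Mapping.keys m \<subseteq> {1..N}" for m :: "nat \<Rightarrow>\<^sub>0 nat"
    using that by (metis Int_absorb2 keys_eq_empty)
  then show ?thesis
    unfolding irrelevant_ideal_eq linear_ideal_def mono_ideal_def poly_ring_def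
    by (auto simp: in_keys_iff)
qed

lemma boundaries_zero_0: "B {0} 0 j = {v \<in> graded_piece N F 0 j. augmentation F v \<in> irrelevant_ideal N}"
proof (intro equalityI subsetI)
  fix v assume "v \<in> B {0} 0 j"
  then obtain w where w: "v \<in> graded_piece N F 0 j" "w \<in> graded_piece N F 1 j" "v = boundary F 1 w"
    by (elim boundariesE) (metis One_nat_def eq_iff_diff_eq_0 ext singletonD)
  then show "v \<in> {v \<in> graded_piece N F 0 j. augmentation F v \<in> irrelevant_ideal N}"
    using exact_0 graded_piece_free_module by blast
next
  fix v assume v: "v \<in> {v \<in> graded_piece N F 0 j. augmentation F v \<in> irrelevant_ideal N}"
  then obtain w where w: "w \<in> free_module N F 1" "v = boundary F 1 w"
    using exact_0 graded_piece_free_module by blast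
  have "boundary F (Suc 0) (hcomps (Suc 0) j w) = v"
    using boundary_hcomps[of 0 j w] hcomps_eq v w(2) by simp
  then show "v \<in> B {0} 0 j"
    using v w(1) by (intro boundariesI[of _ _ _ "hcomps (Suc 0) j w"]) (auto intro: hcomps_graded_piece)
qed

text \<open>For the zero ideal the tensor product is \<open>F\<close> itself, which is exact in
  positive homological degree; \<open>hcomps\<close> makes the preimage homogeneous.\<close>

lemma cycles_zero_Suc: "Z {0} (Suc i) j = B {0} (Suc i) j"
proof (rule antisym)
  show "B {0} (Suc i) j \<subseteq> Z {0} (Suc i) j"
    by (rule boundaries_subset_cycles) (use ring_ideal_linear_ideal[of N "{}"] linear_ideal_empty in metis)
  show "Z {0} (Suc i) j \<subseteq> B {0} (Suc i) j"
  proof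
    fix v assume "v \<in> Z {0} (Suc i) j"
    then have v: "v \<in> graded_piece N F (Suc i) j" "boundary F (Suc i) v = 0"
      by (auto simp: tor_cycles_def)
    then obtain w where w: "w \<in> free_module N F (Suc (Suc i))" "v = boundary F (Suc (Suc i)) w"
      using exact_Suc[of i] graded_piece_free_module by blast
    have "boundary F (Suc (Suc i)) (hcomps (Suc (Suc i)) j w) = v"
      using boundary_hcomps[of "Suc i" j w] hcomps_eq v w(2) by simp
    then show "v \<in> B {0} (Suc i) j"
      using v w(1) by (intro boundariesI[of _ _ _ "hcomps (Suc (Suc i)) j w"]) (auto intro: hcomps_graded_piece)
  qed
qed

lemma augmentation_homogeneous:
  assumes "v \<in> graded_piece N F 0 j"
  shows "homogeneous j (augmentation F v)"
  using augmentation_hcomps[of j v] hcomps_eq[OF assms] homogeneous_hcomp by metis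

text \<open>The base of both inductions on ideals: \<open>Tor\<close> of \<open>A\<close> and the
  residue field is the field in bidegree (0, 0). The isomorphism takes the constant term of the
  augmentation.\<close>

lemma betti_zero: "betti {0} i j = (if i = 0 \<and> j = 0 then 1 else 0)"
proof (cases i)
  case (Suc n)
  then show ?thesis by (simp add: betti_def cycles_zero_Suc)
next
  case 0
  have Z0: "Z {0} 0 j = graded_piece N F 0 j" by (auto simp: tor_cycles_def)
  show ?thesis
  proof (cases "j = 0")
    case False
    have "Poly_Mapping.lookup (augmentation F v) 0 = 0" if "v \<in> graded_piece N F 0 j" for v
      using augmentation_homogeneous[OF that] False by (force simp: homogeneous_def in_keys_iff)
    then have "Z {0} 0 j = B {0} 0 j"
      unfolding Z0 boundaries_zero_0 irrelevant_ideal_iff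
      using augmentation_poly_ring graded_piece_free_module by blast
    then show ?thesis using False 0 by (simp add: betti_def)
  next
    case j: True
    \<comment> \<open>The constants in coordinate 0: a one-dimensional model inside the same vector
      space, as the comparison along a relation requires.\<close>
    define e :: "'k \<Rightarrow> nat \<Rightarrow> 'k mpoly" where "e c = (\<lambda>p. if p = 0 then const c else 0)" for c
    have const0: "const c = 0 \<longleftrightarrow> c = 0" for c :: 'k
      by (auto simp: const_def) (metis lookup_single_eq lookup_zero)
    have sc: "scale c (e c') = e (c * c')" for c c'
      by (auto simp: scale_def e_def const_def mult_single)
    have span: "vs.span {e 1} = range e"
      unfolding vs.span_singleton by (auto simp: sc)
    have "e 1 \<noteq> 0" using const0[of 1] by (auto simp: e_def fun_eq_iff)
    then have "vs.independent {e 1}" by (simp add: vs.dependent_single)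
    then have dim1: "vs.dim (range e) = 1"
      using vs.dim_span_eq_card_independent[of "{e 1}"] unfolding span by simp
    obtain S where S: "finite S" "graded_piece N F 0 j \<subseteq> vs.span S"
      using graded_piece_finite_span by blast
    have z: "ring_ideal N {0 :: 'k mpoly}" using ring_ideal_linear_ideal[of N "{}"] linear_ideal_empty by metis
    have I: "ring_ideal N (irrelevant_ideal N :: 'k mpoly set)"
      unfolding irrelevant_ideal_eq by (rule ring_ideal_linear_ideal)
    have lookup_const: "Poly_Mapping.lookup (const c) 0 = c" for c :: 'k by (simp add: const_def)
    have e_irr: "e c 0 \<in> irrelevant_ideal N \<longleftrightarrow> c = 0" for c
      unfolding irrelevant_ideal_iff by (simp add: e_def lookup_const)
    let ?P = "\<lambda>v y. augmentation F v - y 0 \<in> irrelevant_ideal N"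
    have "vs.dim (Z {0} 0 j) - vs.dim (B {0} 0 j) = vs.dim (range e) - vs.dim {0 :: nat \<Rightarrow> 'k mpoly}"
    proof (rule vs.dim_quotient_eq_of_relation[of _ _ S _ _ "{e 1}" ?P])
      show "\<exists>y\<in>range e. ?P v y" if "v \<in> Z {0} 0 j" for v
      proof (intro bexI[of _ "e (Poly_Mapping.lookup (augmentation F v) 0)"])
        have "augmentation F v \<in> poly_ring N"
          using that Z0 augmentation_poly_ring graded_piece_free_module by blast
        then show "?P v (e (Poly_Mapping.lookup (augmentation F v) 0))"
          unfolding irrelevant_ideal_iff by (auto simp: e_def lookup_minus lookup_const intro: poly_ring_diff)
      qed simp
      show "\<exists>v\<in>Z {0} 0 j. ?P v y" if "y \<in> range e" for y
      proof -
        obtain c where y: "y = e c" using \<open>y \<in> range e\<close> by blast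
        obtain v where v: "v \<in> free_module N F 0" "const c - augmentation F v \<in> irrelevant_ideal N"
          using augmentation_surj poly_ring_const by blast
        have "augmentation F v \<in> poly_ring N" by (rule augmentation_poly_ring[OF v(1)])
        then have "?P (hcomps 0 0 v) y"
          using v(2) unfolding irrelevant_ideal_iff augmentation_hcomps y
          by (auto simp: e_def lookup_minus lookup_hcomp lookup_const intro!: poly_ring_diff poly_ring_hcomp)
        then show ?thesis using hcomps_graded_piece[OF v(1)] Z0 j by blast
      qed
      show "v \<in> B {0} 0 j \<longleftrightarrow> y \<in> {0}" if "v \<in> Z {0} 0 j" "y \<in> range e" "?P v y" for v y
      proof -
        obtain c where y: "y = e c" using \<open>y \<in> range e\<close> by blast
        have "v \<in> B {0} 0 j \<longleftrightarrow> augmentation F v \<in> irrelevant_ideal N"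
          using that(1) unfolding boundaries_zero_0 Z0 by blast
        also have "\<dots> \<longleftrightarrow> y 0 \<in> irrelevant_ideal N"
          using ring_ideal_diff[OF I _ that(3), of "augmentation F v"] ring_ideal_add[OF I _ that(3), of "y 0"] by auto
        also have "\<dots> \<longleftrightarrow> c = 0" unfolding y by (rule e_irr)
        also have "\<dots> \<longleftrightarrow> y \<in> {0}" unfolding y using const0 by (auto simp: e_def fun_eq_iff)
        finally show ?thesis .
      qed
      show "?P (v + v') (y + y')" if "?P v y" "?P v' y'" for v y v' y'
        using ring_ideal_add[OF I that] by (simp add: augmentation_add algebra_simps)
      show "?P (scale c v) (scale c y)" if "?P v y" for c v y
        using ring_ideal_mult[OF I poly_ring_const that, of c]
        by (simp add: scale_def augmentation_mult right_diff_distrib)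
      show "?P 0 0" using ring_ideal_0[OF I] by (simp add: augmentation_def)
      show "vs.subspace (range e)" using vs.subspace_span[of "{e 1}"] span by simp
      show "{0} \<subseteq> range e" using vs.span_zero[of "{e 1}"] span by simp
      show "range e \<subseteq> vs.span {e 1}" using span by simp
      show "Z {0} 0 j \<subseteq> vs.span S" using S(2) Z0 by simp
    qed (use S(1) z in \<open>auto intro: subspace_cycles subspace_boundaries subsetD[OF boundaries_subset_cycles] vs.subspace_single_0\<close>)
    moreover have "vs.dim {0 :: nat \<Rightarrow> 'k mpoly} = 0"
      using vs.dim_le_card[of "{0}" "{}"] vs.span_empty by simp
    ultimately show ?thesis using dim1 0 j by (simp add: betti_def)
  qed
qed

text \<open>For a new variable the colon ideal is the old ideal and \<open>d = 1\<close>. All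
  \<open>Tor\<close> sits on the diagonal \<open>j = i\<close>, so the shifted copy never meets the
  unshifted one, and the recursion is Pascal's rule.\<close>

lemma betti_linear_ideal:
  assumes "finite S" "S \<subseteq> {1..N}"
  shows "betti (linear_ideal N S) i j = (if j = int i then card S choose i else 0)"
  using assms
proof (induction S arbitrary: i j rule: finite_induct)
  case empty
  then show ?case by (cases i) (simp_all add: linear_ideal_empty betti_zero)
next
  case (insert s S)
  let ?L = "linear_ideal N S :: 'k mpoly set"
  have IH: "betti ?L i j = (if j = int i then card S choose i else 0)" for i j
    using insert by simp
  have cs: "colon_step N ?L ?L (var s) 1 (linear_ideal N (insert s S))"
    using insert by (intro colon_step_linear_ideal) auto
  have disj: "betti ?L i (j - 1) = 0 \<or> betti ?L i j = 0" for i j by (simp add: IH)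
  show ?case
  proof (cases i)
    case 0
    then show ?thesis using betti_colon_step_0[OF cs disj] by (simp add: IH)
  next
    case (Suc n)
    then show ?thesis using betti_colon_step_Suc[OF cs disj] insert(1,2) by (simp add: IH)
  qed
qed

end

lemma residue_field_resolution_exists:
  "\<exists>F. residue_field_resolution N (F :: 'k::field free_complex)"
  using free_resolution_linear_ideal[of "{1..N}" N, where ?'k = 'k]
  by (simp add: residue_field_resolution_def free_resolution_def irrelevant_ideal_eq)

section \<open>Perfect elimination orderings\<close>

text \<open>The ordering is built from its end: the inserted \<open>v\<close> is eliminated before
  all of \<open>V\<close>, and \<open>K\<close> is its set of later neighbours. \<open>E\<close>
  stays fixed while \<open>V\<close> grows, so no induced subgraphs have to be formed.\<close>

inductive peo :: "'v set set \<Rightarrow> 'v set \<Rightarrow> nat multiset \<Rightarrow> bool" for E where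
  peo_empty: "peo E {} {#}"
| peo_insert: "peo E V D \<Longrightarrow> v \<notin> V \<Longrightarrow> K = {u \<in> V. {u, v} \<in> E} \<Longrightarrow>
    (\<And>a b. a \<in> K \<Longrightarrow> b \<in> K \<Longrightarrow> a \<noteq> b \<Longrightarrow> {a, b} \<in> E) \<Longrightarrow>
    peo E (insert v V) (add_mset (card K) D)"

lemma peo_finite: "peo E V D \<Longrightarrow> finite V"
  by (induction rule: peo.induct) auto

lemma peo_size: "peo E V D \<Longrightarrow> size D = card V"
  by (induction rule: peo.induct) (auto dest: peo_finite)

lemma peo_less_card: "peo E V D \<Longrightarrow> d \<in># D \<Longrightarrow> d < card V"
proof (induction rule: peo.induct)
  case (peo_insert V D v K)
  have "card K \<le> card V"
    using peo_finite[OF peo_insert.hyps(1)] peo_insert.hyps(3) by (auto intro: card_mono)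
  moreover have "card (insert v V) = Suc (card V)"
    using peo_finite[OF peo_insert.hyps(1)] peo_insert.hyps(2) by simp
  ultimately show ?case using peo_insert.IH peo_insert.prems by auto
qed simp

text \<open>The dominating vertex goes to the end of the ordering, where it has no later neighbours;
  it joins every clique \<open>K\<close> and so raises each earlier count by one.\<close>

lemma peo_dominating:
  assumes "peo E V D" "v \<notin> V" "\<And>a b. a \<in> V \<Longrightarrow> b \<in> V \<Longrightarrow> {a, b} \<in> E' \<longleftrightarrow> {a, b} \<in> E"
    "\<And>a. a \<in> V \<Longrightarrow> {a, v} \<in> E'"
  shows "peo E' (insert v V) (add_mset 0 (image_mset Suc D))"
  using assms
proof (induction rule: peo.induct)
  case peo_empty
  show ?case using peo.peo_insert[OF peo.peo_empty, of v "{}" E'] by simp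
next
  case (peo_insert V D w K)
  have "peo E' (insert w (insert v V)) (add_mset (card (insert v K)) (add_mset 0 (image_mset Suc D)))"
  proof (rule peo.peo_insert)
    show "peo E' (insert v V) (add_mset 0 (image_mset Suc D))"
      using peo_insert by simp
    show "w \<notin> insert v V" using peo_insert.hyps(2) peo_insert.prems(1) by blast
    have "{v, w} \<in> E'" using peo_insert.prems(3)[of w] by (simp add: insert_commute)
    then show "insert v K = {u \<in> insert v V. {u, w} \<in> E'}"
      using peo_insert.hyps(3) peo_insert.prems(2,3) by (auto simp: insert_commute)
    show "{a, b} \<in> E'" if "a \<in> insert v K" "b \<in> insert v K" "a \<noteq> b" for a b
    proof -
      have "a \<in> K \<Longrightarrow> b \<in> K \<Longrightarrow> {a, b} \<in> E'"
        using peo_insert.hyps(3) peo_insert.hyps(4)[of a b] peo_insert.prems(2)[of a b] that(3) by auto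
      moreover have "{u, v} \<in> E'" "{v, u} \<in> E'" if "u \<in> K" for u
        using peo_insert.prems(3)[of u] that peo_insert.hyps(3) by (auto simp: insert_commute)
      ultimately show ?thesis using that by (elim insertE) simp_all
    qed
  qed
  moreover have "card (insert v K) = Suc (card K)"
    using peo_insert.hyps(3) peo_insert.prems(1) peo_finite[OF peo_insert.hyps(1)] by simp
  ultimately show ?case by (simp add: insert_commute add_mset_commute)
qed

text \<open>The member of \<open>C\<close> that is eliminated first has all the others among its
  later neighbours.\<close>

lemma peo_clique:
  assumes "peo E V D" "C \<subseteq> V" "C \<noteq> {}" "\<And>a b. a \<in> C \<Longrightarrow> b \<in> C \<Longrightarrow> a \<noteq> b \<Longrightarrow> {a, b} \<in> E"
  shows "\<exists>d\<in>#D. card C \<le> Suc d"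
  using assms
proof (induction rule: peo.induct)
  case (peo_insert V D v K)
  show ?case
  proof (cases "v \<in> C")
    case False
    then show ?thesis using peo_insert by fastforce
  next
    case True
    have fin: "finite K" using peo_insert.hyps(3) peo_finite[OF peo_insert.hyps(1)] by simp
    have "C - {v} \<subseteq> K" using peo_insert.prems True peo_insert.hyps(3) by blast
    then have "card (C - {v}) \<le> card K" by (rule card_mono[OF fin])
    moreover have "finite C" using peo_insert.prems(1) peo_finite[OF peo_insert.hyps(1)] finite_subset by blast
    ultimately show ?thesis using True by (auto simp: card_Diff_singleton)
  qed
qed simp

text \<open>The first vertex of the clique \<open>K\<close> of later neighbours of \<open>v\<close> has at least \<open>card K - 1\<close> later
  neighbours, so going down from a vertex the values cannot skip.\<close>

lemma peo_downward_closed: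
  assumes "peo E V D" "d \<in># D" "e < d"
  shows "e \<in># D"
  using assms
proof (induction arbitrary: d e rule: peo.induct)
  case (peo_insert V D v K)
  show ?case
  proof (cases "d \<in># D")
    case True
    then show ?thesis using peo_insert.IH peo_insert.prems(2) by auto
  next
    case False
    then have d: "d = card K" using peo_insert.prems by simp
    then have "K \<noteq> {}" using peo_insert.prems by auto
    moreover have "K \<subseteq> V" using peo_insert.hyps(3) by simp
    ultimately have "\<exists>d\<in>#D. card K \<le> Suc d"
      by (intro peo_clique[OF peo_insert.hyps(1)] peo_insert.hyps(4))
    then obtain d' where d': "d' \<in># D" "card K \<le> Suc d'" by blast
    have "e \<in># D"
    proof (cases "e = d'")
      case False
      then show ?thesis using peo_insert.IH[OF d'(1), of e] d' d peo_insert.prems(2) by linarith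
    qed (use d' in simp)
    then show ?thesis by simp
  qed
qed simp


section \<open>Chordal graphs have perfect elimination orderings\<close>

definition simplicial :: "'v set set \<Rightarrow> 'v set \<Rightarrow> 'v \<Rightarrow> bool" where
  "simplicial E V v \<longleftrightarrow> v \<in> V \<and>
     (\<forall>a\<in>V. \<forall>b\<in>V. {a, v} \<in> E \<longrightarrow> {b, v} \<in> E \<longrightarrow> a \<noteq> b \<longrightarrow> {a, b} \<in> E)"

lemma chordal_subset: "chordal V E \<Longrightarrow> W \<subseteq> V \<Longrightarrow> chordal W E"
  unfolding chordal_def induced_cycle_def by (meson subset_trans)

section \<open>Shortest walks and induced paths\<close>

definition walk :: "'v set set \<Rightarrow> 'v set \<Rightarrow> 'v \<Rightarrow> 'v \<Rightarrow> 'v list \<Rightarrow> bool" where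
  "walk E X s t p \<longleftrightarrow> p \<noteq> [] \<and> hd p = s \<and> last p = t \<and> successively (\<lambda>a b. {a, b} \<in> E) p \<and> set p \<subseteq> X"

lemma walk_shortcut:
  assumes "walk E X s t p" "i < j" "j < length p" "{p ! i, p ! j} \<in> E"
  shows "walk E X s t (take (Suc i) p @ drop j p)"
proof -
  let ?P = "\<lambda>a b. {a, b} \<in> E"
  have "successively ?P (take (Suc i) p @ drop (Suc i) p)" "successively ?P (take j p @ drop j p)"
    using assms(1) by (simp_all add: walk_def)
  then have "successively ?P (take (Suc i) p)" "successively ?P (drop j p)"
    by (simp_all only: successively_append_iff)
  moreover have "last (take (Suc i) p) = p ! i" using assms by (simp add: take_Suc_conv_app_nth)
  ultimately show ?thesis
    using assms set_take_subset[of "Suc i" p] set_drop_subset[of j p]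
    unfolding walk_def by (auto simp: successively_append_iff hd_drop_conv_nth)
qed

lemma walk_remove_loop:
  assumes "walk E X s t p" "\<not> distinct p"
  shows "\<exists>q. walk E X s t q \<and> length q < length p"
proof -
  obtain xs ys zs a where p: "p = xs @ [a] @ ys @ [a] @ zs"
    using not_distinct_decomp[OF assms(2)] by blast
  let ?P = "\<lambda>a b. {a, b} \<in> E"
  have "successively ?P ((xs @ [a]) @ ys @ [a] @ zs)" "successively ?P ((xs @ [a] @ ys) @ [a] @ zs)"
    using assms(1) by (simp_all add: walk_def p)
  then have "successively ?P (xs @ [a])" "successively ?P ([a] @ zs)"
    by (simp_all only: successively_append_iff)
  then have "successively ?P ((xs @ [a]) @ zs)"
    unfolding successively_append_iff by auto
  moreover have "hd (xs @ [a] @ zs) = hd p" by (cases xs) (auto simp: p)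
  moreover have "last (xs @ [a] @ zs) = last p" by (simp add: p)
  ultimately have "walk E X s t (xs @ [a] @ zs)"
    using assms(1) by (auto simp: walk_def p)
  then show ?thesis unfolding p by (intro exI[of _ "xs @ [a] @ zs"]) simp
qed

text \<open>In a walk of least length, a repeated vertex or an edge between non-consecutive vertices
  would give a shorter one.\<close>

lemma shortest_walk:
  assumes "walk E X s t p"
  obtains q where "walk E X s t q" "distinct q"
    "\<And>i j. i < j \<Longrightarrow> j < length q \<Longrightarrow> {q ! i, q ! j} \<in> E \<longleftrightarrow> j = Suc i"
proof -
  obtain q where q: "walk E X s t q" and min: "\<And>r. walk E X s t r \<Longrightarrow> length q \<le> length r"
    using ex_has_least_nat[of "walk E X s t" p length] assms by blast
  show thesis
  proof (rule that[OF q])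
    show "distinct q" using walk_remove_loop[OF q] min by (meson not_less)
    fix i j assume ij: "i < j" "j < length q"
    show "{q ! i, q ! j} \<in> E \<longleftrightarrow> j = Suc i"
    proof
      assume "{q ! i, q ! j} \<in> E"
      from min[OF walk_shortcut[OF q ij this]] ij show "j = Suc i" by simp
    next
      assume "j = Suc i"
      then show "{q ! i, q ! j} \<in> E"
        using q ij by (simp add: walk_def successively_conv_nth)
    qed
  qed
qed

text \<open>The walk is confined to what is reachable from \<open>s\<close>, since the separator
  argument needs a path inside one component.\<close>

lemma rtrancl_walk:
  assumes "(s, t) \<in> {(a, b). a \<in> A \<and> b \<in> A \<and> {a, b} \<in> E}\<^sup>*"
  shows "\<exists>p. walk E {c. (s, c) \<in> {(a, b). a \<in> A \<and> b \<in> A \<and> {a, b} \<in> E}\<^sup>*} s t p"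
  using assms
proof (induction rule: rtrancl_induct)
  case base
  show ?case by (intro exI[of _ "[s]"]) (simp add: walk_def)
next
  case (step y z)
  then obtain p where "walk E {c. (s, c) \<in> {(a, b). a \<in> A \<and> b \<in> A \<and> {a, b} \<in> E}\<^sup>*} s y p" by blast
  then show ?case
    using step by (intro exI[of _ "p @ [z]"])
      (auto simp: walk_def successively_append_iff intro: rtrancl_into_rtrancl)
qed

text \<open>Dirac's theorem, in a form suited to induction: unless \<open>v\<close> dominates the graph, some simplicial
  vertex lies outside its closed neighbourhood.\<close>

lemma chordal_simplicial:
  assumes "finite V" "chordal V E" "\<And>u. {u} \<notin> E" "v \<in> V" "u \<in> V" "u \<noteq> v" "{u, v} \<notin> E"
  shows "\<exists>w. w \<noteq> v \<and> {w, v} \<notin> E \<and> simplicial E V w"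
  using assms
proof (induction V arbitrary: u v rule: finite_psubset_induct)
  case (psubset V)
  note chordal = psubset.prems(1) and loopfree = psubset.prems(2)
  \<comment> \<open>\<open>A\<close> consists of the non-neighbours of \<open>v\<close>,
    \<open>C\<close> is the component of \<open>u\<close> in \<open>A\<close>, and \<open>S\<close>
    is the set of outside neighbours of \<open>C\<close>. All of \<open>S\<close> is adjacent to
    \<open>v\<close>, so \<open>S\<close> separates \<open>C\<close> from \<open>v\<close>.\<close>
  define A where "A = {w \<in> V. w \<noteq> v \<and> {w, v} \<notin> E}"
  define R where "R = {(a, b). a \<in> A \<and> b \<in> A \<and> {a, b} \<in> E}"
  define C where "C = {c. (u, c) \<in> R\<^sup>*}"
  define S where "S = {s \<in> V - C. \<exists>c\<in>C. {s, c} \<in> E}"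
  have "sym R" unfolding R_def sym_def by (auto simp: insert_commute)
  then have symR: "sym (R\<^sup>*)" by (rule sym_rtrancl)
  have uA: "u \<in> A" using psubset.prems by (simp add: A_def)
  have CA: "C \<subseteq> A"
  proof
    fix c assume "c \<in> C"
    then have "(u, c) \<in> R\<^sup>*" by (simp add: C_def)
    then show "c \<in> A" using uA by (induction rule: rtrancl_induct) (auto simp: R_def)
  qed
  have AV: "A \<subseteq> V" by (auto simp: A_def)
  have Sv: "s \<noteq> v" "{s, v} \<in> E" if "s \<in> S" for s
  proof -
    obtain c where c: "c \<in> C" "{s, c} \<in> E" "s \<in> V" "s \<notin> C" using \<open>s \<in> S\<close> by (auto simp: S_def)
    have "s \<notin> A"
    proof
      assume "s \<in> A"
      then have "(c, s) \<in> R" using c CA by (auto simp: R_def insert_commute)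
      then show False using c by (auto simp: C_def intro: rtrancl_into_rtrancl)
    qed
    moreover show "s \<noteq> v" using c CA by (auto simp: A_def insert_commute)
    ultimately show "{s, v} \<in> E" using c by (auto simp: A_def)
  qed
  \<comment> \<open>Two non-adjacent members of \<open>S\<close> would be joined by an induced path
    through \<open>C\<close>; as \<open>C\<close> contains no neighbour of \<open>v\<close>, closing
    the path at \<open>v\<close> gives an induced cycle on at least four vertices.\<close>
  have clique: "{s, t} \<in> E" if st: "s \<in> S" "t \<in> S" "s \<noteq> t" for s t
  proof (rule ccontr)
    assume nadj: "{s, t} \<notin> E"
    obtain c1 c2 where c: "c1 \<in> C" "{s, c1} \<in> E" "c2 \<in> C" "{t, c2} \<in> E" using st by (auto simp: S_def)
    have reach: "(c1, x) \<in> R\<^sup>* \<longleftrightarrow> x \<in> C" for x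
      using c(1) symR by (auto simp: C_def dest: symD intro: rtrancl_trans)
    then have "walk E C c1 c2 p \<longleftrightarrow> walk E {c. (c1, c) \<in> R\<^sup>*} c1 c2 p" for p
      by (simp add: Collect_mem_eq)
    moreover have "(c1, c2) \<in> R\<^sup>*" using reach c by simp
    ultimately obtain p where p: "walk E C c1 c2 p"
      using rtrancl_walk[of c1 c2 A E] unfolding R_def by blast
    let ?X = "C \<union> {s, t}"
    have "walk E ?X s t (s # p @ [t])"
      using p c unfolding walk_def
      by (auto simp: successively_append_iff successively_Cons insert_commute)
    then obtain q where q: "walk E ?X s t q" "distinct q"
      and adj: "\<And>i j. i < j \<Longrightarrow> j < length q \<Longrightarrow> {q ! i, q ! j} \<in> E \<longleftrightarrow> j = Suc i"
      by (rule shortest_walk) blast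
    have q0: "q ! 0 = s" and ql: "q ! (length q - 1) = t" and q1: "q \<noteq> []" and qX: "set q \<subseteq> ?X"
      using q(1) by (auto simp: walk_def hd_conv_nth last_conv_nth)
    have len: "length q \<ge> 3"
    proof (rule ccontr)
      assume "\<not> length q \<ge> 3"
      moreover have "length q \<noteq> 0" using q1 by simp
      ultimately consider "length q = 1" | "length q = 2" by linarith
      then show False
      proof cases
        case 1
        then show False using q0 ql st(3) by simp
      next
        case 2
        then show False using adj[of 0 1] q0 ql nadj by simp
      qed
    qed
    have vq: "{v, q ! i} \<in> E \<longleftrightarrow> i = 0 \<or> Suc i = length q" if i: "i < length q" for i
    proof
      assume "{v, q ! i} \<in> E"
      then have "q ! i \<notin> C" using CA by (auto simp: A_def insert_commute)
      moreover have "q ! i \<in> ?X" using qX nth_mem[OF i] by blast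
      ultimately have "q ! i = q ! 0 \<or> q ! i = q ! (length q - 1)" unfolding q0 ql by blast
      moreover have "q ! i = q ! 0 \<longleftrightarrow> i = 0" "q ! i = q ! (length q - 1) \<longleftrightarrow> i = length q - 1"
        using q1 by (simp_all add: nth_eq_iff_index_eq[OF q(2) i])
      ultimately have "i = 0 \<or> i = length q - 1" by simp
      then show "i = 0 \<or> Suc i = length q" using len by linarith
    next
      assume "i = 0 \<or> Suc i = length q"
      then have "i = 0 \<or> i = length q - 1" by linarith
      then have "q ! i = s \<or> q ! i = t" using q0 ql by blast
      then have "{q ! i, v} \<in> E" using Sv(2) st(1,2) by blast
      then show "{v, q ! i} \<in> E" by (simp add: insert_commute)
    qed
    have "induced_cycle V E (v # q)"
      unfolding induced_cycle_def
    proof (intro conjI allI impI)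
      show "3 \<le> length (v # q)" using len by simp
      have "v \<notin> ?X" using CA Sv(1)[OF st(1)] Sv(1)[OF st(2)] by (auto simp: A_def)
      then have "v \<notin> set q" using qX by blast
      then show "distinct (v # q)" using q(2) by simp
      have "?X \<subseteq> V" using CA AV st(1,2) unfolding S_def by blast
      then show "set (v # q) \<subseteq> V" using subset_trans[OF qX] psubset.prems(3) by simp
      fix i j assume ij: "i < j" "j < length (v # q)"
      show "{(v # q) ! i, (v # q) ! j} \<in> E \<longleftrightarrow> j = Suc i \<or> i = 0 \<and> Suc j = length (v # q)"
      proof (cases i)
        case 0
        then show ?thesis using vq[of "j - 1"] ij by (cases j) auto
      next
        case (Suc i')
        then show ?thesis using adj[of i' "j - 1"] ij by (cases j) auto
      qed
    qed
    then show False using chordal len by (auto simp: chordal_def)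
  qed
  define H where "H = C \<union> S"
  have "H \<subset> V"
  proof
    show "H \<subseteq> V" using CA AV unfolding H_def S_def by blast
    have "v \<notin> H" using CA Sv(1) unfolding H_def A_def by blast
    then show "H \<noteq> V" using psubset.prems(3) by blast
  qed
  have "chordal H E" by (rule chordal_subset[OF chordal]) (use \<open>H \<subset> V\<close> in blast)
  note IH = psubset.IH[OF \<open>H \<subset> V\<close> this loopfree]
  \<comment> \<open>The induction hypothesis is applied to \<open>H\<close> at a vertex that does
    not dominate it, taken in \<open>S\<close> if possible. The vertex found is not in
    \<open>S\<close>, because \<open>S\<close> is a clique in the one case and dominates
    \<open>H\<close> in the other. If there is no such vertex, \<open>H\<close> is complete.\<close>
  have "\<exists>w\<in>C. simplicial E H w"
  proof (cases "\<exists>s\<in>S. \<exists>y\<in>H. y \<noteq> s \<and> {y, s} \<notin> E")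
    case True
    then obtain s y where sy: "s \<in> S" "y \<in> H" "y \<noteq> s" "{y, s} \<notin> E" by blast
    then obtain w where w: "w \<noteq> s" "{w, s} \<notin> E" "simplicial E H w"
      using IH[of s y] unfolding H_def by blast
    then have "w \<notin> S" using clique sy(1) by blast
    then show ?thesis using w by (auto simp: simplicial_def H_def)
  next
    case S_univ: False
    show ?thesis
    proof (cases "\<exists>c\<in>C. \<exists>y\<in>H. y \<noteq> c \<and> {y, c} \<notin> E")
      case True
      then obtain c y where cy: "c \<in> C" "y \<in> H" "y \<noteq> c" "{y, c} \<notin> E" by blast
      then obtain w where w: "w \<noteq> c" "{w, c} \<notin> E" "simplicial E H w"
        using IH[of c y] unfolding H_def by blast
      have "w \<notin> S"
      proof
        assume "w \<in> S"
        then have "{c, w} \<in> E" using S_univ cy(1) w(1) by (auto simp: H_def)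
        then show False using w(2) by (simp add: insert_commute)
      qed
      then show ?thesis using w by (auto simp: simplicial_def H_def)
    next
      case False
      then have "{a, b} \<in> E" if "a \<in> H" "b \<in> H" "a \<noteq> b" for a b
        using S_univ that by (auto simp: H_def)
      moreover have "u \<in> C" by (simp add: C_def)
      ultimately show ?thesis by (auto simp: simplicial_def H_def)
    qed
  qed
  then obtain w where w: "w \<in> C" "simplicial E H w" by blast
  \<comment> \<open>All neighbours of a vertex of \<open>C\<close> lie in \<open>C\<close> or
    \<open>S\<close>, so being simplicial carries over from \<open>H\<close> to
    \<open>V\<close>.\<close>
  have "a \<in> H" if "a \<in> V" "{a, w} \<in> E" for a
    using that w(1) by (auto simp: H_def S_def)
  then have "simplicial E V w" using w CA AV by (auto simp: simplicial_def)
  moreover have "w \<noteq> v" "{w, v} \<notin> E" using w(1) CA by (auto simp: A_def)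
  ultimately show ?case by blast
qed

text \<open>Dirac's theorem supplies a simplicial vertex unless the graph is complete, and then
  every vertex is simplicial.\<close>

lemma chordal_peo:
  assumes "finite V" "chordal V E" "\<And>u. {u} \<notin> E"
  shows "\<exists>D. peo E V D"
  using assms
proof (induction V rule: finite_psubset_induct)
  case (psubset V)
  show ?case
  proof (cases "V = {}")
    case True
    then show ?thesis using peo_empty by blast
  next
    case False
    have "\<exists>w. simplicial E V w"
    proof (cases "\<exists>v\<in>V. \<exists>u\<in>V. u \<noteq> v \<and> {u, v} \<notin> E")
      case True
      then show ?thesis using chordal_simplicial[OF psubset.hyps psubset.prems] by blast
    next
      case complete: False
      obtain v where "v \<in> V" using False by blast
      then show ?thesis using complete unfolding simplicial_def by blast
    qed
    then obtain w where w: "simplicial E V w" by blast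
    then have wV: "w \<in> V" by (simp add: simplicial_def)
    then have "V - {w} \<subset> V" by blast
    then obtain D where "peo E (V - {w}) D"
      using psubset.IH chordal_subset[OF psubset.prems(1)] psubset.prems(2) by (metis psubset_imp_subset)
    then have "peo E (insert w (V - {w})) (add_mset (card {u \<in> V - {w}. {u, w} \<in> E}) D)"
      using w by (intro peo_insert) (auto simp: simplicial_def)
    then show ?thesis using wV by (auto simp: insert_absorb)
  qed
qed


section \<open>Threshold graphs are classified by the multiset of later degrees\<close>

text \<open>The multiset is carried along so that the construction can be undone operation by
  operation; \<open>threshold_with_peo\<close> shows that it counts later neighbours.\<close>

inductive threshold_with :: "'v set \<Rightarrow> 'v set set \<Rightarrow> nat multiset \<Rightarrow> bool" where
  single: "threshold_with {v} {} {#0#}"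
| isolated: "threshold_with V E D \<Longrightarrow> v \<notin> V \<Longrightarrow> threshold_with (insert v V) E (add_mset 0 D)"
| dominating: "threshold_with V E D \<Longrightarrow> v \<notin> V \<Longrightarrow>
    threshold_with (insert v V) (E \<union> {{u, v} | u. u \<in> V}) (add_mset 0 (image_mset Suc D))"

lemma threshold_with_imp_threshold: "threshold_with V E D \<Longrightarrow> threshold V E"
  by (induction rule: threshold_with.induct) (auto intro: threshold.intros)

lemma threshold_imp_threshold_with: "threshold V E \<Longrightarrow> \<exists>D. threshold_with V E D"
  by (induction rule: threshold.induct) (auto intro: threshold_with.intros)

lemma threshold_with_edges: "threshold_with V E D \<Longrightarrow> e \<in> E \<Longrightarrow> e \<subseteq> V \<and> card e = 2"
  by (induction arbitrary: e rule: threshold_with.induct) (auto simp: card_insert_if)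

text \<open>An isolated vertex is eliminated at the start of the ordering, a dominating one at its
  end.\<close>

lemma threshold_with_peo: "threshold_with V E D \<Longrightarrow> peo E V D"
proof (induction rule: threshold_with.induct)
  case (single v)
  show ?case using peo_insert[OF peo_empty, of v "{}" "{}"] by simp
next
  case (isolated V E D v)
  have "{u, v} \<notin> E" for u using threshold_with_edges[OF isolated.hyps(1)] isolated.hyps(2) by blast
  then show ?case using peo_insert[OF isolated.IH isolated.hyps(2), of "{}"] by simp
next
  case (dominating V E D v)
  show ?case
  proof (rule peo_dominating[OF dominating.IH dominating.hyps(2)])
    show "{a, b} \<in> E \<union> {{u, v} | u. u \<in> V} \<longleftrightarrow> {a, b} \<in> E" if "a \<in> V" "b \<in> V" for a b
      using that dominating.hyps(2) by (auto simp: doubleton_eq_iff)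
  qed blast
qed

text \<open>This separates the constructors: an isolated vertex leaves at least two zeros, a
  dominating one exactly one zero among several elements, a single vertex just
  \<open>{#0#}\<close>.\<close>

lemma threshold_with_zero: "threshold_with V E D \<Longrightarrow> 0 \<in># D"
  by (induction rule: threshold_with.induct) auto

text \<open>\<open>P\<close> says whether the two new vertices are both dominating or both isolated;
  in either case the isomorphism is extended by sending \<open>v\<close> to
  \<open>v'\<close>.\<close>

lemma graph_iso_insert:
  assumes "graph_iso V E V' E'" "v \<notin> V" "v' \<notin> V'"
    and F: "\<And>a b. a \<in> V \<Longrightarrow> b \<in> V \<Longrightarrow> {a, b} \<in> F \<longleftrightarrow> {a, b} \<in> E"
    and F': "\<And>a b. a \<in> V' \<Longrightarrow> b \<in> V' \<Longrightarrow> {a, b} \<in> F' \<longleftrightarrow> {a, b} \<in> E'"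
    and nbrs: "\<And>a. a \<in> V \<Longrightarrow> {a, v} \<in> F \<longleftrightarrow> P" "\<And>a. a \<in> V' \<Longrightarrow> {a, v'} \<in> F' \<longleftrightarrow> P"
    and loop: "{v} \<notin> F" "{v'} \<notin> F'"
  shows "graph_iso (insert v V) F (insert v' V') F'"
proof -
  obtain f where f: "bij_betw f V V'" "\<forall>a\<in>V. \<forall>b\<in>V. {a, b} \<in> E \<longleftrightarrow> {f a, f b} \<in> E'"
    using assms(1) by (auto simp: graph_iso_def)
  let ?g = "f(v := v')"
  have fV: "f a \<in> V'" if "a \<in> V" for a using f(1) that by (auto simp: bij_betw_def)
  have "bij_betw ?g V V'" using f(1) assms(2) by (subst bij_betw_cong[of _ _ f]) auto
  then have "bij_betw ?g (insert v V) (insert v' V')"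
    using assms(2,3) notIn_Un_bij_betw[of v V ?g V'] by simp
  moreover have "{a, b} \<in> F \<longleftrightarrow> {?g a, ?g b} \<in> F'" if "a \<in> insert v V" "b \<in> insert v V" for a b
  proof -
    from that consider "a = v" "b = v" | "a = v" "b \<in> V" | "a \<in> V" "b = v" | "a \<in> V" "b \<in> V" by blast
    then show ?thesis
    proof cases
      case 1 then show ?thesis using loop by simp
    next
      case 2
      then have "b \<noteq> v" using assms(2) by blast
      then show ?thesis using 2 nbrs(1)[of b] nbrs(2)[of "f b"] fV by (simp add: insert_commute)
    next
      case 3 then show ?thesis using assms(2) nbrs fV by auto
    next
      case 4 then show ?thesis using assms(2) F F' f(2) fV by auto
    qed
  qed
  ultimately show ?thesis unfolding graph_iso_def by blast
qed

text \<open>The multiset reveals the last operation and the multiset before it, so the two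
  constructions are undone in parallel.\<close>

lemma threshold_with_unique:
  assumes "threshold_with V E D" "threshold_with V' E' D"
  shows "graph_iso V E V' E'"
  using assms
proof (induction arbitrary: V' E' rule: threshold_with.induct)
  case (single v)
  from single.prems show ?case
  proof cases
    case (single v')
    then show ?thesis unfolding graph_iso_def by (intro exI[of _ "\<lambda>_. v'"]) (auto simp: bij_betw_def)
  qed (auto dest: threshold_with_zero)
next
  case (isolated V E D v)
  have nE: "{u, v} \<notin> E" for u using threshold_with_edges[OF isolated.hyps(1)] isolated.hyps(2) by blast
  have D: "0 \<in># D" by (rule threshold_with_zero[OF isolated.hyps(1)])
  from isolated.prems show ?case
  proof cases
    case (isolated W D' w)
    have nE': "{u, w} \<notin> E'" for u using threshold_with_edges[OF isolated(3)] isolated(4) by blast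
    have "D' = D" using isolated(2) by simp
    then have "graph_iso V E W E'" using isolated.IH isolated(3) by blast
    then show ?thesis
      unfolding isolated(1)
      using graph_iso_insert[of V E W E' v w E E' False] isolated.hyps(2) isolated(4) nE nE'[of w] nE' nE[of v]
      by simp
  qed (use D in auto)
next
  case (dominating V E D v)
  have D: "D \<noteq> {#}" using threshold_with_zero[OF dominating.hyps(1)] by auto
  have nE: "{v} \<notin> E" using threshold_with_edges[OF dominating.hyps(1)] dominating.hyps(2) by blast
  from dominating.prems show ?case
  proof cases
    case (isolated W D' w)
    then show ?thesis using threshold_with_zero[OF isolated(3)] by auto
  next
    case (dominating W E2 D' w)
    have nE': "{w} \<notin> E2" using threshold_with_edges[OF dominating(4)] dominating(5) by blast
    have "image_mset Suc D' = image_mset Suc D" using dominating(3) by simp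
    then have "image_mset (\<lambda>d. d - 1) (image_mset Suc D') = image_mset (\<lambda>d. d - 1) (image_mset Suc D)" by simp
    then have "D' = D" by (simp add: multiset.map_comp o_def)
    then have iso: "graph_iso V E W E2" using dominating.IH dominating(4) by blast
    show ?thesis
      unfolding dominating(1,2)
      by (rule graph_iso_insert[OF iso dominating.hyps(2) dominating(5), of _ _ True])
        (use dominating.hyps(2) dominating(5) nE nE' in \<open>auto simp: doubleton_eq_iff\<close>)
  qed (use D in auto)
qed

text \<open>One zero is removed. If another zero remains, an isolated vertex was added last;
  otherwise the remaining values are positive and can all be lowered by one. Downward closedness
  survives either way.\<close>

lemma threshold_with_exists:
  assumes "D \<noteq> {#}" "\<And>d e. d \<in># D \<Longrightarrow> e < d \<Longrightarrow> e \<in># D" "finite V" "card V = size D"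
  shows "\<exists>E. threshold_with V E D"
  using assms
proof (induction "size D" arbitrary: D V rule: less_induct)
  case less
  have "0 \<in># D" using less.prems(1,2) by (metis gr0I multiset_nonemptyE)
  then obtain D0 where D0: "D = add_mset 0 D0" by (meson multi_member_split)
  obtain v where v: "v \<in> V" using less.prems(1,3,4) by fastforce
  define W where "W = V - {v}"
  have W: "V = insert v W" "v \<notin> W" "finite W" "card W = size D0"
    using v less.prems(3,4) D0 by (auto simp: W_def)
  show ?case
  proof (cases "D0 = {#}")
    case True
    then have "W = {}" using W by simp
    then show ?thesis using W(1) D0 True threshold_with.single[of v] by auto
  next
    case nonempty: False
    show ?thesis
    proof (cases "0 \<in># D0")
      case True
      have "e \<in># D0" if "d \<in># D0" "e < d" for d e
        using less.prems(2)[of d e] that True D0 by (cases "e = 0") auto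
      then obtain E where "threshold_with W E D0"
        using less.hyps[of D0 W] nonempty W(3,4) unfolding D0 by auto
      then show ?thesis unfolding W(1) D0 using threshold_with.isolated[OF _ W(2)] by blast
    next
      case False
      define D1 where "D1 = image_mset (\<lambda>d. d - 1) D0"
      have "image_mset Suc D1 = image_mset (\<lambda>d. d) D0"
        unfolding D1_def multiset.map_comp
      proof (rule image_mset_cong)
        fix d assume "d \<in># D0"
        then have "d \<noteq> 0" using False by metis
        then show "(Suc \<circ> (\<lambda>d. d - 1)) d = d" by simp
      qed
      then have D1: "D0 = image_mset Suc D1" by simp
      have "e \<in># D1" if "d \<in># D1" "e < d" for d e
      proof -
        have "Suc d \<in># D" unfolding D0 D1 using that(1) by simp
        then have "Suc e \<in># D" by (rule less.prems(2)) (use that(2) in simp)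
        then show ?thesis unfolding D0 D1 by auto
      qed
      then obtain E where "threshold_with W E D1"
        using less.hyps[of D1 W] nonempty W(3,4) unfolding D0 D1 by auto
      then show ?thesis unfolding W(1) D0 D1 using threshold_with.dominating[OF _ W(2)] by blast
    qed
  qed
qed

text \<open>The system is triangular: for the overall maximum \<open>m\<close> the terms
  \<open>e choose m\<close> with \<open>e < m\<close> vanish, so the sum at \<open>k = m\<close>
  detects whether \<open>m\<close> occurs, and \<open>m\<close> can be removed from both
  sides.\<close>

lemma multiset_eq_of_binomial_sums:
  assumes "\<And>k. (\<Sum>e\<in>#A. e choose k) = (\<Sum>e\<in>#B. e choose k)"
  shows "A = (B :: nat multiset)"
  using assms
proof (induction "size A" arbitrary: A B)
  case 0
  then show ?case using "0.prems"[of 0] by simp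
next
  case (Suc n)
  define m where "m = Max (set_mset (A + B))"
  have A: "A \<noteq> {#}" using Suc.hyps(2) by auto
  have le: "e \<le> m" if "e \<in># A + B" for e using that unfolding m_def by simp
  have pos: "m \<in># X \<longleftrightarrow> (\<Sum>e\<in>#X. e choose m) \<noteq> 0" if "set_mset X \<subseteq> set_mset (A + B)" for X
  proof -
    have "(e choose m \<noteq> 0) = (e = m)" if "e \<in># X" for e
      using le \<open>set_mset X \<subseteq> _\<close> that by (metis binomial_eq_0_iff le_neq_implies_less less_irrefl subsetD)
    then show ?thesis by auto
  qed
  have "m \<in># A + B" using Max_in[of "set_mset (A + B)"] A unfolding m_def by simp
  moreover have "m \<in># A \<longleftrightarrow> m \<in># B" using pos[of A] pos[of B] Suc.prems by simp
  ultimately obtain A' B' where AB: "A = add_mset m A'" "B = add_mset m B'"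
    by (metis mset_add union_iff)
  have "A' = B'"
  proof (rule Suc.hyps(1))
    show "n = size A'" using Suc.hyps(2) AB by simp
    show "(\<Sum>e\<in>#A'. e choose k) = (\<Sum>e\<in>#B'. e choose k)" for k using Suc.prems[of k] AB by simp
  qed
  then show ?case using AB by simp
qed

section \<open>Linear quotients for chordal graphs\<close>

text \<open>\<open>Q\<close> is arbitrary, so the intermediate ideals between adding two non-edges
  are covered.\<close>

definition edge_ideal :: "nat \<Rightarrow> nat set set \<Rightarrow> 'k::field mpoly set" where
  "edge_ideal N Q = mono_ideal N {m. \<exists>e\<in>Q. e \<subseteq> Poly_Mapping.keys m}"

definition nonedges :: "nat set \<Rightarrow> nat set set \<Rightarrow> nat set set" where
  "nonedges V E = {{a, b} | a b. a \<in> V \<and> b \<in> V \<and> a \<noteq> b \<and> {a, b} \<notin> E}"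

lemma up_closed_edges: "up_closed {m. \<exists>e\<in>Q. e \<subseteq> Poly_Mapping.keys m}"
  unfolding up_closed_def keys_add_nat mem_Collect_eq by (blast intro: le_supI1)

lemma generated_edge:
  assumes "a \<noteq> b"
  shows "generated_monomials {Poly_Mapping.single a 1 + Poly_Mapping.single b 1} =
    {m. {a, b} \<subseteq> Poly_Mapping.keys m}"
proof safe
  fix m :: "nat \<Rightarrow>\<^sub>0 nat" assume m: "{a, b} \<subseteq> Poly_Mapping.keys m"
  let ?g = "Poly_Mapping.single a (1::nat) + Poly_Mapping.single b 1"
  have "m = ?g + (m - ?g)"
    using m assms
    by (intro poly_mapping_eqI) (auto simp: lookup_add lookup_minus lookup_single when_def in_keys_iff)
  then show "m \<in> generated_monomials {?g}" unfolding generated_monomials_def by blast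
qed (auto simp: generated_monomials_def keys_add_nat)

lemma nonedge_ideal_eq: "nonedge_ideal N E = (edge_ideal N (nonedges {1..N} E) :: 'k::field mpoly set)"
proof -
  let ?pm = "\<lambda>a b. Poly_Mapping.single a (1::nat) + Poly_Mapping.single b 1"
  define M where "M = {?pm a b | a b. a \<in> {1..N} \<and> b \<in> {1..N} \<and> a \<noteq> b \<and> {a, b} \<notin> E}"
  have "{var a * var b | a b. a \<in> {1..N} \<and> b \<in> {1..N} \<and> a \<noteq> b \<and> {a, b} \<notin> E} =
      (\<lambda>g. Poly_Mapping.single g (1::'k)) ` M"
    unfolding M_def var_def mult_single by (simp only: mult_1) blast
  then have "nonedge_ideal N E = ideal_gen N ((\<lambda>g. Poly_Mapping.single g (1::'k)) ` M)"
    by (simp only: nonedge_ideal_def)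
  also have "\<dots> = mono_ideal N (generated_monomials M)"
    by (rule ideal_gen_monomials) (auto simp: M_def keys_add_nat)
  also have "generated_monomials M = (\<Union>g\<in>M. generated_monomials {g})"
    by (auto simp: generated_monomials_def)
  also have "\<dots> = {m. \<exists>e\<in>nonedges {1..N} E. e \<subseteq> Poly_Mapping.keys m}"
  proof -
    have "(\<Union>g\<in>M. generated_monomials {g}) =
        (\<Union>(a, b)\<in>{(a, b). a \<in> {1..N} \<and> b \<in> {1..N} \<and> a \<noteq> b \<and> {a, b} \<notin> E}. generated_monomials {?pm a b})"
      unfolding M_def by blast
    also have "\<dots> = (\<Union>(a, b)\<in>{(a, b). a \<in> {1..N} \<and> b \<in> {1..N} \<and> a \<noteq> b \<and> {a, b} \<notin> E}.
        {m. {a, b} \<subseteq> Poly_Mapping.keys m})"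
      by (rule SUP_cong) (use generated_edge in auto)
    also have "\<dots> = {m. \<exists>e\<in>nonedges {1..N} E. e \<subseteq> Poly_Mapping.keys m}"
      unfolding nonedges_def by blast
    finally show ?thesis .
  qed
  finally show ?thesis unfolding edge_ideal_def .
qed

text \<open>By \<open>lower\<close> each variable of \<open>S\<close> lies in the colon ideal.
  Conversely, a generator dividing \<open>x_v x_w m\<close> involves a variable of \<open>S\<close>
  by \<open>upper\<close>; this is neither \<open>x_v\<close> nor \<open>x_w\<close>, so it divides
  \<open>m\<close>.\<close>

lemma colon_step_edge_ideal:
  assumes vw: "v \<in> {1..N}" "w \<in> {1..N}" "v \<noteq> w" and S: "v \<notin> S" "w \<notin> S"
    and lower: "\<And>s. s \<in> S \<Longrightarrow> \<exists>e\<in>Q. e \<subseteq> {v, w, s}" and upper: "\<And>e. e \<in> Q \<Longrightarrow> e \<inter> S \<noteq> {}"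
  shows "colon_step N (edge_ideal N Q) (linear_ideal N S)
    (Poly_Mapping.single (Poly_Mapping.single v 1 + Poly_Mapping.single w 1) (1::'k::field)) 2
    (edge_ideal N (insert {v, w} Q))"
  unfolding edge_ideal_def linear_ideal_def
proof (rule colon_step_mono_ideal[OF up_closed_edges up_closed_linear])
  let ?g = "Poly_Mapping.single v (1::nat) + Poly_Mapping.single w 1"
  show "?g + k \<in> {m. \<exists>e\<in>Q. e \<subseteq> Poly_Mapping.keys m} \<longleftrightarrow> k \<in> {m. Poly_Mapping.keys m \<inter> S \<noteq> {}}" for k
  proof -
    have keys: "Poly_Mapping.keys (?g + k) = {v, w} \<union> Poly_Mapping.keys k"
      by (auto simp: keys_add_nat)
    have "(\<exists>e\<in>Q. e \<subseteq> {v, w} \<union> Poly_Mapping.keys k) \<longleftrightarrow> Poly_Mapping.keys k \<inter> S \<noteq> {}"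
    proof
      assume "\<exists>e\<in>Q. e \<subseteq> {v, w} \<union> Poly_Mapping.keys k"
      then show "Poly_Mapping.keys k \<inter> S \<noteq> {}" using upper S by blast
    next
      assume "Poly_Mapping.keys k \<inter> S \<noteq> {}"
      then obtain s where "s \<in> Poly_Mapping.keys k" "s \<in> S" by blast
      then show "\<exists>e\<in>Q. e \<subseteq> {v, w} \<union> Poly_Mapping.keys k" using lower[of s] by blast
    qed
    then show ?thesis by (simp only: keys mem_Collect_eq)
  qed
  show "{m. \<exists>e\<in>insert {v, w} Q. e \<subseteq> Poly_Mapping.keys m} =
      {m. \<exists>e\<in>Q. e \<subseteq> Poly_Mapping.keys m} \<union> generated_monomials {?g}"
    unfolding generated_edge[OF vw(3)] by auto
  show "2 = int (mono_degree ?g)" by (simp add: mono_degree_add)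
qed (use vw in \<open>auto simp: keys_add_nat\<close>)

lemma nonedges_insert:
  assumes "v \<notin> V"
  shows "nonedges (insert v V) E = (\<lambda>w. {v, w}) ` {w \<in> V. {w, v} \<notin> E} \<union> nonedges V E"
proof (intro equalityI subsetI)
  fix e assume "e \<in> nonedges (insert v V) E"
  then obtain a b where e: "e = {a, b}" "a \<in> insert v V" "b \<in> insert v V" "a \<noteq> b" "{a, b} \<notin> E"
    by (auto simp: nonedges_def)
  then consider "a = v" "b \<in> V" | "b = v" "a \<in> V" | "a \<in> V" "b \<in> V" by blast
  then show "e \<in> (\<lambda>w. {v, w}) ` {w \<in> V. {w, v} \<notin> E} \<union> nonedges V E"
  proof cases
    case 3
    then show ?thesis using e by (auto simp: nonedges_def)
  qed (use e in \<open>auto simp: insert_commute\<close>)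
next
  fix e assume "e \<in> (\<lambda>w. {v, w}) ` {w \<in> V. {w, v} \<notin> E} \<union> nonedges V E"
  then show "e \<in> nonedges (insert v V) E"
  proof
    assume "e \<in> (\<lambda>w. {v, w}) ` {w \<in> V. {w, v} \<notin> E}"
    then obtain w where "w \<in> V" "{w, v} \<notin> E" "e = {w, v}" by (auto simp: insert_commute)
    then show ?thesis using assms unfolding nonedges_def by blast
  qed (auto simp: nonedges_def)
qed

text \<open>The hockey-stick identity, in additive form because subtraction of natural numbers is
  truncated.\<close>

lemma sum_choose_consecutive: "(\<Sum>l<r. (n + l) choose k) + (n choose Suc k) = (n + r) choose Suc k"
  by (induction r) auto

section \<open>Betti numbers along a perfect elimination ordering\<close>

context residue_field_resolution
begin

text \<open>A 2-linear resolution: apart from bidegree (0, 0) the Betti numbers of the quotient sit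
  at \<open>j = i + 1\<close>, and \<open>c k\<close> is the one in homological degree
  \<open>k + 1\<close>.\<close>

definition linear_strand :: "nat set set \<Rightarrow> (nat \<Rightarrow> nat) \<Rightarrow> bool" where
  "linear_strand Q c \<longleftrightarrow> (\<forall>i j. betti (edge_ideal N Q) i j =
     (case i of 0 \<Rightarrow> if j = 0 then 1 else 0 | Suc k \<Rightarrow> if j = int k + 2 then c k else 0))"

lemma linear_strand_empty: "linear_strand {} (\<lambda>_. 0)"
proof -
  have "edge_ideal N {} = ({0} :: 'k mpoly set)" by (auto simp: edge_ideal_def mono_ideal_def)
  then show ?thesis by (auto simp: linear_strand_def betti_zero split: nat.split)
qed

text \<open>After the shift by 2, \<open>Tor\<close> of the linear quotient sits at
  \<open>j = i + 2\<close>, which misses both \<open>j = i + 1\<close> and the corner (0, 0); hence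
  the colon step is additive.\<close>

lemma linear_strand_insert:
  assumes c: "linear_strand Q c" and SN: "S \<subseteq> {1..N}"
    and vw: "v \<in> {1..N}" "w \<in> {1..N}" "v \<noteq> w" and S: "v \<notin> S" "w \<notin> S"
    and lower: "\<And>s. s \<in> S \<Longrightarrow> \<exists>e\<in>Q. e \<subseteq> {v, w, s}" and upper: "\<And>e. e \<in> Q \<Longrightarrow> e \<inter> S \<noteq> {}"
  shows "linear_strand (insert {v, w} Q) (\<lambda>k. c k + (card S choose k))"
proof -
  have fin: "finite S" using SN finite_subset by blast
  note L = betti_linear_ideal[OF fin SN]
  note I = c[unfolded linear_strand_def, rule_format]
  have cs: "colon_step N (edge_ideal N Q) (linear_ideal N S)
    (Poly_Mapping.single (Poly_Mapping.single v 1 + Poly_Mapping.single w 1) (1::'k)) 2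
    (edge_ideal N (insert {v, w} Q))"
    by (rule colon_step_edge_ideal[OF vw S lower upper])
  have disj: "betti (linear_ideal N S) i (j - 2) = 0 \<or> betti (edge_ideal N Q) i j = 0" for i j
    by (cases i) (auto simp: L I)
  show ?thesis
    unfolding linear_strand_def
  proof (intro allI)
    fix i j
    show "betti (edge_ideal N (insert {v, w} Q)) i j =
      (case i of 0 \<Rightarrow> if j = 0 then 1 else 0 | Suc k \<Rightarrow> if j = int k + 2 then c k + (card S choose k) else 0)"
    proof (cases i)
      case 0
      then show ?thesis using betti_colon_step_0[OF cs disj] I[of 0 j] by simp
    next
      case (Suc k)
      have "betti (edge_ideal N (insert {v, w} Q)) (Suc k) j =
          betti (edge_ideal N Q) (Suc k) j + betti (linear_ideal N S) k (j - 2)"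
        by (rule betti_colon_step_Suc[OF cs disj])
      then show ?thesis using I[of "Suc k" j] L[of k "j - 2"] Suc by auto
    qed
  qed
qed

text \<open>\<open>U\<close> stands for the vertices eliminated before \<open>v\<close>,
  \<open>W\<close> for its later non-neighbours. Once \<open>l\<close> non-edges at \<open>v\<close>
  are in, the colon ideal of the next one is generated by the variables of \<open>U\<close> and of
  these \<open>l\<close> endpoints.\<close>

lemma linear_strand_vertex:
  assumes c: "linear_strand Q c" and U: "U \<subseteq> {1..N}" and v: "v \<in> {1..N}" "v \<notin> U"
    and W: "finite W" "W \<subseteq> {1..N}" "W \<inter> U = {}" "v \<notin> W"
    and lower: "\<And>s w. s \<in> U \<Longrightarrow> w \<in> W \<Longrightarrow> {s, v} \<in> Q \<or> {s, w} \<in> Q"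
    and upper: "\<And>e. e \<in> Q \<Longrightarrow> e \<inter> U \<noteq> {}"
  shows "linear_strand ((\<lambda>w. {v, w}) ` W \<union> Q) (\<lambda>k. c k + (\<Sum>l<card W. (card U + l) choose k))"
  using W lower
proof (induction W rule: finite_induct)
  case empty
  then show ?case using c by simp
next
  case (insert w W)
  let ?Q = "(\<lambda>w. {v, w}) ` W \<union> Q"
  have IH: "linear_strand ?Q (\<lambda>k. c k + (\<Sum>l<card W. (card U + l) choose k))"
  proof (rule insert.IH)
    show "{s, v} \<in> Q \<or> {s, w'} \<in> Q" if "s \<in> U" "w' \<in> W" for s w'
      using insert.prems(4)[of s w'] that by simp
    show "W \<subseteq> {1..N}" "W \<inter> U = {}" "v \<notin> W" using insert.prems(1-3) by auto
  qed
  have "linear_strand (insert {v, w} ?Q)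
      (\<lambda>k. c k + (\<Sum>l<card W. (card U + l) choose k) + (card (U \<union> W) choose k))"
  proof (rule linear_strand_insert[OF IH])
    show "\<exists>e\<in>?Q. e \<subseteq> {v, w, s}" if "s \<in> U \<union> W" for s
      using that
    proof
      assume "s \<in> U"
      then have "{s, v} \<in> Q \<or> {s, w} \<in> Q" using insert.prems(4)[of s w] by simp
      then show ?thesis
      proof
        assume "{s, v} \<in> Q"
        then show ?thesis by (intro bexI[of _ "{s, v}"]) auto
      next
        assume "{s, w} \<in> Q"
        then show ?thesis by (intro bexI[of _ "{s, w}"]) auto
      qed
    next
      assume "s \<in> W"
      then show ?thesis by (intro bexI[of _ "{v, s}"]) auto
    qed
    show "e \<inter> (U \<union> W) \<noteq> {}" if "e \<in> ?Q" for e
      using that upper[of e] by auto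
    show "U \<union> W \<subseteq> {1..N}" using U insert.prems(1) by blast
    show "w \<notin> U \<union> W" using insert.hyps(2) insert.prems(2) by blast
    show "v \<notin> U \<union> W" "w \<in> {1..N}" "v \<noteq> w" using v insert.prems(1,3) by auto
  qed (rule v)
  moreover have "card (U \<union> W) = card U + card W"
    using insert.hyps(1) insert.prems(2) U finite_subset[OF U]
    by (intro card_Un_disjoint) auto
  ultimately show ?case
    using insert.hyps by (simp add: add.assoc)
qed

text \<open>The non-edges at the vertices eliminated first are added first. When the non-edge \<open>vw\<close> is added,
  every \<open>s\<close> eliminated before \<open>v\<close> satisfies \<open>x\<^sub>s x\<^sub>v \<in> I\<close> or \<open>x\<^sub>s x\<^sub>w \<in> I\<close>, since the later neighbours of \<open>s\<close>
  form a clique; hence the colon ideal is generated by variables.\<close>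

lemma linear_strand_peo:
  assumes "peo E V D" "linear_strand Q c" "U \<inter> V = {}" "U \<union> V = {1..N}"
    and "\<And>a b s. a \<in> V \<Longrightarrow> b \<in> V \<Longrightarrow> a \<noteq> b \<Longrightarrow> {a, b} \<notin> E \<Longrightarrow> s \<in> U \<Longrightarrow> {s, a} \<in> Q \<or> {s, b} \<in> Q"
    and "\<And>e. e \<in> Q \<Longrightarrow> e \<inter> U \<noteq> {}"
  shows "\<exists>c'. linear_strand (Q \<union> nonedges V E) c' \<and>
    (\<forall>k. c' k + (\<Sum>l\<in>{card U..<N}. l choose Suc k) = c k + (\<Sum>d\<in>#D. (N - 1 - d) choose Suc k))"
  using assms
proof (induction arbitrary: Q c U rule: peo.induct)
  case peo_empty
  then have "card U = N" "nonedges {} E = {}" by (auto simp: nonedges_def)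
  then show ?case using peo_empty.prems(1) by (intro exI[of _ c]) simp
next
  case (peo_insert V D v K)
  note c = peo_insert.prems(1) and disjoint = peo_insert.prems(2) and union = peo_insert.prems(3)
    and lower = peo_insert.prems(4) and upper = peo_insert.prems(5)
  have finV: "finite V" by (rule peo_finite[OF peo_insert.hyps(1)])
  have finU: "finite U" using union by (metis finite_Un finite_atLeastAtMost)
  let ?W = "{w \<in> V. {w, v} \<notin> E}"
  let ?Q = "(\<lambda>w. {v, w}) ` ?W \<union> Q"
  let ?c = "\<lambda>k. c k + (\<Sum>l<card ?W. (card U + l) choose k)"
  have strand: "linear_strand ?Q ?c"
  proof (rule linear_strand_vertex[OF c])
    show "{s, v} \<in> Q \<or> {s, w} \<in> Q" if "s \<in> U" "w \<in> ?W" for s w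
      using that peo_insert.hyps(2) lower[of v w s] by (auto simp: insert_commute)
    show "U \<subseteq> {1..N}" "v \<in> {1..N}" using union by auto
    show "v \<notin> U" "?W \<inter> U = {}" using disjoint by auto
    show "?W \<subseteq> {1..N}" using union by blast
    show "e \<inter> U \<noteq> {}" if "e \<in> Q" for e using upper[OF that] .
  qed (use finV peo_insert.hyps(2) in simp_all)
  have "\<exists>c'. linear_strand (?Q \<union> nonedges V E) c' \<and>
    (\<forall>k. c' k + (\<Sum>l\<in>{card (insert v U)..<N}. l choose Suc k) = ?c k + (\<Sum>d\<in>#D. (N - 1 - d) choose Suc k))"
  proof (rule peo_insert.IH[OF strand])
    show "insert v U \<inter> V = {}" "insert v U \<union> V = {1..N}"
      using union disjoint peo_insert.hyps(2) by auto
    show "e \<inter> insert v U \<noteq> {}" if "e \<in> ?Q" for e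
      using that upper by blast
    show "{s, a} \<in> ?Q \<or> {s, b} \<in> ?Q"
      if ab: "a \<in> V" "b \<in> V" "a \<noteq> b" "{a, b} \<notin> E" and s: "s \<in> insert v U" for a b s
    proof (cases "s = v")
      case True
      \<comment> \<open>The invariant for the vertex just eliminated: one of the non-adjacent
        \<open>a\<close>, \<open>b\<close> lies outside the clique \<open>K\<close>, so its non-edge
        with \<open>v\<close> has just been added.\<close>
      have "a \<notin> K \<or> b \<notin> K" using peo_insert.hyps(4) ab by blast
      then have "a \<in> ?W \<or> b \<in> ?W" using ab peo_insert.hyps(3) by blast
      then show ?thesis unfolding True by blast
    next
      case False
      then show ?thesis using lower[of a b s] ab s by blast
    qed
  qed
  then obtain c' where c': "linear_strand (?Q \<union> nonedges V E) c'"
    and sum: "\<And>k. c' k + (\<Sum>l\<in>{card (insert v U)..<N}. l choose Suc k) = ?c k + (\<Sum>d\<in>#D. (N - 1 - d) choose Suc k)"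
    by blast
  have card: "card U + card V + 1 = N"
  proof -
    have "card (U \<union> insert v V) = card U + card (insert v V)"
      using disjoint finU finV by (intro card_Un_disjoint) auto
    then show ?thesis using union peo_insert.hyps(2) finV by simp
  qed
  have "V = K \<union> ?W" "K \<inter> ?W = {}" using peo_insert.hyps(3) by auto
  then have "card V = card K + card ?W"
    using finV by (metis (no_types, lifting) card_Un_disjoint finite_Un)
  \<comment> \<open>Each vertex other than \<open>v\<close> is eliminated earlier, or is a later
    neighbour, or a later non-neighbour; this is the origin of \<open>N - 1 - d\<close>.\<close>
  then have W: "card U + card ?W = N - 1 - card K" using card by linarith
  \<comment> \<open>The hockey-stick sum at \<open>v\<close> leaves the lower end
    \<open>card U choose Suc k\<close>, which is moved to the left side; over all vertices these
    ends form a sum that does not depend on the graph.\<close>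
  have "c' k + (\<Sum>l\<in>{card U..<N}. l choose Suc k) = c k + (\<Sum>d\<in>#add_mset (card K) D. (N - 1 - d) choose Suc k)" for k
  proof -
    have "card (insert v U) = Suc (card U)" using finU disjoint by simp
    moreover have "(\<Sum>l\<in>{card U..<N}. l choose Suc k) = (card U choose Suc k) + (\<Sum>l\<in>{Suc (card U)..<N}. l choose Suc k)"
      using card by (intro sum.atLeast_Suc_lessThan) simp
    ultimately show ?thesis
      using sum[of k] sum_choose_consecutive[of "card U" k "card ?W"] unfolding W by simp
  qed
  moreover have "?Q \<union> nonedges V E = Q \<union> nonedges (insert v V) E"
    using nonedges_insert[OF peo_insert.hyps(2)] by blast
  ultimately show ?case using c' by auto
qed

text \<open>With \<open>Q\<close> and \<open>U\<close> empty the correction sum depends on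
  \<open>N\<close> and \<open>k\<close> only, so the Betti numbers carry the same information as the
  binomial sums of positive lower index.\<close>

lemma betti_peo:
  assumes "peo E {1..N} D"
  shows "\<exists>c. (\<forall>i j. betti (nonedge_ideal N E) i j =
      (case i of 0 \<Rightarrow> if j = 0 then 1 else 0 | Suc k \<Rightarrow> if j = int k + 2 then c k else 0)) \<and>
    (\<forall>k. c k + (\<Sum>l<N. l choose Suc k) = (\<Sum>d\<in>#D. (N - 1 - d) choose Suc k))"
  using linear_strand_peo[OF assms linear_strand_empty, of "{}"]
  by (simp add: linear_strand_def nonedge_ideal_eq atLeast0LessThan)

lemma betti_eq_iff:
  assumes "peo E {1..N} D" "peo E' {1..N} D'"
  shows "betti (nonedge_ideal N E) = betti (nonedge_ideal N E') \<longleftrightarrow> D = D'"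
proof -
  obtain c where c: "\<And>i j. betti (nonedge_ideal N E) i j =
      (case i of 0 \<Rightarrow> if j = 0 then 1 else 0 | Suc k \<Rightarrow> if j = int k + 2 then c k else 0)"
    "\<And>k. c k + (\<Sum>l<N. l choose Suc k) = (\<Sum>d\<in>#D. (N - 1 - d) choose Suc k)"
    using betti_peo[OF assms(1)] by blast
  obtain c' where c': "\<And>i j. betti (nonedge_ideal N E') i j =
      (case i of 0 \<Rightarrow> if j = 0 then 1 else 0 | Suc k \<Rightarrow> if j = int k + 2 then c' k else 0)"
    "\<And>k. c' k + (\<Sum>l<N. l choose Suc k) = (\<Sum>d\<in>#D'. (N - 1 - d) choose Suc k)"
    using betti_peo[OF assms(2)] by blast
  show ?thesis
  proof
    assume eq: "betti (nonedge_ideal N E) = betti (nonedge_ideal N E')"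
    have cc': "c k = c' k" for k
      using fun_cong[OF fun_cong[OF eq], of "Suc k" "int k + 2"] c(1)[of "Suc k"] c'(1)[of "Suc k"] by simp
    have "(\<Sum>e\<in>#image_mset ((-) (N - 1)) D. e choose k) = (\<Sum>e\<in>#image_mset ((-) (N - 1)) D'. e choose k)" for k
    proof (cases k)
      \<comment> \<open>The sum for \<open>k = 0\<close> is not a Betti number; it counts elements,
        and both multisets have \<open>N\<close> of them.\<close>
      case 0
      then show ?thesis using peo_size[OF assms(1)] peo_size[OF assms(2)] by simp
    next
      case (Suc n)
      then show ?thesis using c(2)[of n] c'(2)[of n] cc'[of n] by (simp add: multiset.map_comp comp_def)
    qed
    then have "image_mset ((-) (N - 1)) D = image_mset ((-) (N - 1)) D'"
      by (rule multiset_eq_of_binomial_sums)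
    then have "image_mset ((-) (N - 1)) (image_mset ((-) (N - 1)) D) =
        image_mset ((-) (N - 1)) (image_mset ((-) (N - 1)) D')" by simp
    \<comment> \<open>Reflection at \<open>N - 1\<close> is an involution on values below
      \<open>N\<close>, where the truncated subtraction is exact.\<close>
    moreover have "image_mset ((-) (N - 1)) (image_mset ((-) (N - 1)) X) = X" if "\<And>d. d \<in># X \<Longrightarrow> d < N" for X
    proof -
      have "image_mset ((-) (N - 1) \<circ> (-) (N - 1)) X = image_mset (\<lambda>d. d) X"
        by (intro image_mset_cong) (use that in fastforce)
      then show ?thesis by (simp add: multiset.map_comp)
    qed
    ultimately show "D = D'" using peo_less_card[OF assms(1)] peo_less_card[OF assms(2)] by simp
  next
    assume "D = D'"
    then have "c = c'" using c(2) c'(2) by (metis add_right_cancel ext)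
    then show "betti (nonedge_ideal N E) = betti (nonedge_ideal N E')" by (intro ext) (simp only: c(1) c'(1))
  qed
qed

end

text \<open>Since a resolution exists, the one chosen by \<open>SOME\<close> in
  \<open>tor_dim\<close> is genuine, and both Betti tables are computed with the same
  choice.\<close>

lemma graded_betti_eq_iff:
  assumes "peo E {1..N} D" "peo E' {1..N} D'"
  shows "graded_betti TYPE('k::field) N E = graded_betti TYPE('k) N E' \<longleftrightarrow> D = D'"
proof -
  let ?F = "SOME F :: 'k free_complex. graded_free_resolution N (irrelevant_ideal N) F"
  obtain F :: "'k free_complex" where "graded_free_resolution N (irrelevant_ideal N) F"
    using residue_field_resolution_exists[of N] unfolding residue_field_resolution_def free_resolution_def by blast
  then have "graded_free_resolution N (irrelevant_ideal N) ?F" by (rule someI)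
  then interpret residue_field_resolution N ?F by unfold_locales
  have "graded_betti TYPE('k) N H = betti (nonedge_ideal N H)" for H
    by (intro ext) (simp only: graded_betti_def tor_dim_def betti_def Let_def)
  then show ?thesis using betti_eq_iff[OF assms] by simp
qed

theorem mainTheorem6:
  fixes N :: nat and G :: "nat set set"
  assumes "N \<ge> 1"
    and "simple_graph {1..N} G"
    and "chordal {1..N} G"
  shows "\<exists>T. threshold {1..N} T \<and>
             graded_betti TYPE('k::field) N T = graded_betti TYPE('k) N G \<and>
             (\<forall>T'. threshold {1..N} T' \<and>
                   graded_betti TYPE('k) N T' = graded_betti TYPE('k) N G \<longrightarrow>
                   graph_iso {1..N} T {1..N} T')"
proof -
  \<comment> \<open>Adjacency is tested as \<open>{u, v} \<in> G\<close>, which for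
    \<open>u = v\<close> asks for a singleton; simplicity of the graph enters the elimination
    argument only in this form.\<close>
  have "{u} \<notin> G" for u
  proof
    assume "{u} \<in> G"
    with assms(2) have "card {u} = 2" unfolding simple_graph_def by (elim conjE) (drule (1) bspec, elim conjE)
    then show False by simp
  qed
  then have "\<exists>D. peo G {1..N} D" by (rule chordal_peo[OF finite_atLeastAtMost assms(3)])
  then obtain D where D: "peo G {1..N} D" by blast
  have size: "card {1..N} = size D" using peo_size[OF D] by simp
  \<comment> \<open>A threshold graph has at least one vertex, which is where
    \<open>N \<ge> 1\<close> enters.\<close>
  have "D \<noteq> {#}"
  proof
    assume "D = {#}"
    then show False using size assms(1) by simp
  qed
  have "\<exists>T. threshold_with {1..N} T D"
  proof (rule threshold_with_exists[OF \<open>D \<noteq> {#}\<close> _ _ size])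
    show "e \<in># D" if "d \<in># D" "e < d" for d e by (rule peo_downward_closed[OF D that])
  qed simp
  then obtain T where T: "threshold_with {1..N} T D" by blast
  show ?thesis
  proof (intro exI[of _ T] conjI allI impI)
    show "threshold {1..N} T" by (rule threshold_with_imp_threshold[OF T])
    show "graded_betti TYPE('k) N T = graded_betti TYPE('k) N G"
      using graded_betti_eq_iff[OF threshold_with_peo[OF T] D, where ?'k = 'k] by simp
    fix T' assume T': "threshold {1..N} T' \<and> graded_betti TYPE('k) N T' = graded_betti TYPE('k) N G"
    then obtain D' where D': "threshold_with {1..N} T' D'" using threshold_imp_threshold_with by blast
    then have "D' = D" using graded_betti_eq_iff[OF threshold_with_peo[OF D'] D, where ?'k = 'k] T' by simp
    then show "graph_iso {1..N} T {1..N} T'" using threshold_with_unique[OF T] D' by simp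
  qed
qed

end
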